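(* Let $I$ be a downward directed preordered set without minimum and let $\mathcal{G}$ be a locally finitely presented Grothendieck category admitting a set $\mathcal{S}$ of finitely presented generators decomposed as a union $\mathcal{S}=\bigcup_{i\in I}\mathcal{S}_i$ of nonempty subsets. Denote by $tr_j(M)$ the trace of $\bigcup_{k\leq j}\mathcal{S}_k$ in $M$, for each $M\in\mathcal{G}$ and each $j\in I$. Suppose that $\mathcal{T}$ is a hereditary torsion class of finite type in $\mathcal{G}$, with torsion radical $t$, satisfying the following conditions: 1. For each $i\in I$ and each $X\in\mathcal{S}_i$, the set of indices $j<i$ such that either $\mathrm{Hom}_{\mathcal{G}}(X,-)_{|\bar{\mathcal{S}}_j}\neq 0$ or $\mathrm{Ext}^1_{\mathcal{G}}(-,-)_{|\mathcal{T}_X\times\bar{\mathcal{S}}_j}\neq 0$ is finite. 2. For each pair of indices $j<i$ in $I$ and each $X\in\mathcal{S}_i$, one has $X/tr_j(X)\in\mathcal{T}$. Then $\mathcal{G}/\mathcal{T}$ is locally finitely presented and contains no nonzero flat object.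
   Context: In a preordered set, $j<i$ means $j\le i$ and $i\not\le j$. The trace of a set $\mathcal{X}$ of objects in $M$ is the sum of the images of all morphisms $X\to M$ with $X\in\mathcal{X}$. A hereditary torsion class is a class of objects closed under subobjects, quotients, extensions and coproducts; its torsion radical $t$ assigns to $M$ its largest subobject $t(M)$ in $\mathcal{T}$. $\mathcal{G}/\mathcal{T}$ is the Gabriel quotient category with quotient functor $q:\mathcal{G}\to\mathcal{G}/\mathcal{T}$ and its right adjoint $\iota$ (section functor); $\mathcal{T}$ is of finite type if $\iota$ preserves direct limits. For a class $\mathcal{X}$ of objects, $\bar{\mathcal{X}}=\{X/t(X): X\in\mathcal{X}\}$. For an object $X$, $\mathcal{T}_X$ is the class of objects of $\mathcal{T}$ that are epimorphic images of $X$. Thus the first alternative in condition 1 says $\mathrm{Hom}_{\mathcal{G}}(X,Y)\ne0$ for some $Y\in\bar{\mathcal{S}}_j$, and the second says $\mathrm{Ext}^1_{\mathcal{G}}(T,Y)\neq 0$ for some $T\in\mathcal{T}_X$, $Y\in\bar{\mathcal{S}}_j$. An object $X$ of a Grothendieck category $\mathcal{G}$ is finitely presented if $\mathrm{Hom}_{\mathcal{G}}(X,-)$ preserves direct limits. $\mathcal{G}$ is locally finitely presented if it has a set of finitely presented generators and each object is a direct limit of finitely presented objects. In such $\mathcal{G}$, an epimorphism $p:M\to N$ is pure if $\mathrm{Hom}_{\mathcal{G}}(X,p)$ is surjective for each finitely presented $X$. An object $F$ is flat if every epimorphism $M\to F$ in $\mathcal{G}$ is pure. *)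

theory Defs
  imports "HOL-Algebra.Group"
begin

unbundle cardinal_syntax

section \<open>Size\<close>

text \<open>
  Grothendieck categories are large categories with small hom-sets and small colimits.  ``Small''
  is taken relative to a strongly inaccessible cardinal \<open>\<kappa>\<close> (equivalently, a Grothendieck
  universe): a ``set'' of the informal text is a set of cardinality less than \<open>\<kappa>\<close>, a ``class''
  is an arbitrary HOL set.  If \<open>\<kappa>\<close> is a relation on the type \<open>'u\<close>, every small set is in bijection
  with a subset of \<open>'u\<close>, so small families may be indexed by small subsets of \<open>'u\<close>.
\<close>

definition inaccessible :: "'u rel \<Rightarrow> bool" where
  "inaccessible \<kappa> \<longleftrightarrow> Card_order \<kappa> \<and> natLeq <o \<kappa> \<and> regularCard \<kappa> \<and>
     (\<forall>A::'u set. |A| <o \<kappa> \<longrightarrow> |Pow A| <o \<kappa>)"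

definition small :: "'u rel \<Rightarrow> 'x set \<Rightarrow> bool" where
  "small \<kappa> A \<longleftrightarrow> |A| <o \<kappa>"


section \<open>Categories\<close>

record ('o, 'a) cat =
  Obj :: "'o set"
  Arr :: "'a set"
  Dom :: "'a \<Rightarrow> 'o"
  Cod :: "'a \<Rightarrow> 'o"
  Ident :: "'o \<Rightarrow> 'a"
  Comp :: "'a \<Rightarrow> 'a \<Rightarrow> 'a"  (infixr "\<cdot>\<index>" 75)

definition Hom :: "('o, 'a) cat \<Rightarrow> 'o \<Rightarrow> 'o \<Rightarrow> 'a set" where
  "Hom C A B = {f \<in> Arr C. Dom C f = A \<and> Cod C f = B}"

definition category :: "('o, 'a) cat \<Rightarrow> bool" where
  "category C \<longleftrightarrow>
     (\<forall>f\<in>Arr C. Dom C f \<in> Obj C \<and> Cod C f \<in> Obj C) \<and>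
     (\<forall>A\<in>Obj C. Ident C A \<in> Hom C A A) \<and>
     (\<forall>f\<in>Arr C. \<forall>g\<in>Arr C. Cod C f = Dom C g \<longrightarrow> g \<cdot>\<^bsub>C\<^esub> f \<in> Hom C (Dom C f) (Cod C g)) \<and>
     (\<forall>f\<in>Arr C. f \<cdot>\<^bsub>C\<^esub> Ident C (Dom C f) = f \<and> Ident C (Cod C f) \<cdot>\<^bsub>C\<^esub> f = f) \<and>
     (\<forall>f\<in>Arr C. \<forall>g\<in>Arr C. \<forall>h\<in>Arr C. Cod C f = Dom C g \<longrightarrow> Cod C g = Dom C h \<longrightarrow>
        h \<cdot>\<^bsub>C\<^esub> (g \<cdot>\<^bsub>C\<^esub> f) = (h \<cdot>\<^bsub>C\<^esub> g) \<cdot>\<^bsub>C\<^esub> f)"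

definition is_mono :: "('o, 'a) cat \<Rightarrow> 'a \<Rightarrow> bool" where
  "is_mono C m \<longleftrightarrow> m \<in> Arr C \<and>
     (\<forall>A\<in>Obj C. \<forall>u\<in>Hom C A (Dom C m). \<forall>v\<in>Hom C A (Dom C m).
        m \<cdot>\<^bsub>C\<^esub> u = m \<cdot>\<^bsub>C\<^esub> v \<longrightarrow> u = v)"

definition is_epi :: "('o, 'a) cat \<Rightarrow> 'a \<Rightarrow> bool" where
  "is_epi C p \<longleftrightarrow> p \<in> Arr C \<and>
     (\<forall>B\<in>Obj C. \<forall>u\<in>Hom C (Cod C p) B. \<forall>v\<in>Hom C (Cod C p) B.
        u \<cdot>\<^bsub>C\<^esub> p = v \<cdot>\<^bsub>C\<^esub> p \<longrightarrow> u = v)"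

definition is_iso :: "('o, 'a) cat \<Rightarrow> 'a \<Rightarrow> bool" where
  "is_iso C f \<longleftrightarrow> f \<in> Arr C \<and>
     (\<exists>g\<in>Hom C (Cod C f) (Dom C f).
        g \<cdot>\<^bsub>C\<^esub> f = Ident C (Dom C f) \<and> f \<cdot>\<^bsub>C\<^esub> g = Ident C (Cod C f))"

definition zero_object :: "('o, 'a) cat \<Rightarrow> 'o \<Rightarrow> bool" where
  "zero_object C Z \<longleftrightarrow> Z \<in> Obj C \<and>
     (\<forall>A\<in>Obj C. (\<exists>!f. f \<in> Hom C Z A) \<and> (\<exists>!f. f \<in> Hom C A Z))"

definition zero_arrow :: "('o, 'a) cat \<Rightarrow> 'a \<Rightarrow> bool" where
  "zero_arrow C f \<longleftrightarrow> f \<in> Arr C \<and>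
     (\<exists>Z u v. zero_object C Z \<and> u \<in> Hom C (Dom C f) Z \<and> v \<in> Hom C Z (Cod C f) \<and> f = v \<cdot>\<^bsub>C\<^esub> u)"

definition is_kernel :: "('o, 'a) cat \<Rightarrow> 'a \<Rightarrow> 'a \<Rightarrow> bool" where
  "is_kernel C f k \<longleftrightarrow> f \<in> Arr C \<and> k \<in> Arr C \<and> Cod C k = Dom C f \<and> zero_arrow C (f \<cdot>\<^bsub>C\<^esub> k) \<and>
     (\<forall>h\<in>Arr C. Cod C h = Dom C f \<longrightarrow> zero_arrow C (f \<cdot>\<^bsub>C\<^esub> h) \<longrightarrow>
        (\<exists>!u. u \<in> Hom C (Dom C h) (Dom C k) \<and> k \<cdot>\<^bsub>C\<^esub> u = h))"

definition is_cokernel :: "('o, 'a) cat \<Rightarrow> 'a \<Rightarrow> 'a \<Rightarrow> bool" where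
  "is_cokernel C f c \<longleftrightarrow> f \<in> Arr C \<and> c \<in> Arr C \<and> Dom C c = Cod C f \<and> zero_arrow C (c \<cdot>\<^bsub>C\<^esub> f) \<and>
     (\<forall>h\<in>Arr C. Dom C h = Cod C f \<longrightarrow> zero_arrow C (h \<cdot>\<^bsub>C\<^esub> f) \<longrightarrow>
        (\<exists>!u. u \<in> Hom C (Cod C c) (Cod C h) \<and> u \<cdot>\<^bsub>C\<^esub> c = h))"

definition is_image :: "('o, 'a) cat \<Rightarrow> 'a \<Rightarrow> 'a \<Rightarrow> bool" where
  "is_image C f m \<longleftrightarrow> (\<exists>c. is_cokernel C f c \<and> is_kernel C c m)"

definition short_exact :: "('o, 'a) cat \<Rightarrow> 'a \<Rightarrow> 'a \<Rightarrow> bool" where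
  "short_exact C f g \<longleftrightarrow> is_kernel C g f \<and> is_cokernel C f g"

definition is_coproduct ::
  "('o, 'a) cat \<Rightarrow> 'j set \<Rightarrow> ('j \<Rightarrow> 'o) \<Rightarrow> 'o \<Rightarrow> ('j \<Rightarrow> 'a) \<Rightarrow> bool" where
  "is_coproduct C J F P e \<longleftrightarrow> P \<in> Obj C \<and> (\<forall>j\<in>J. e j \<in> Hom C (F j) P) \<and>
     (\<forall>B\<in>Obj C. \<forall>f. (\<forall>j\<in>J. f j \<in> Hom C (F j) B) \<longrightarrow>
        (\<exists>!h. h \<in> Hom C P B \<and> (\<forall>j\<in>J. h \<cdot>\<^bsub>C\<^esub> e j = f j)))"

definition is_binary_coproduct :: "('o, 'a) cat \<Rightarrow> 'o \<Rightarrow> 'o \<Rightarrow> 'o \<Rightarrow> 'a \<Rightarrow> 'a \<Rightarrow> bool" where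
  "is_binary_coproduct C A B P i j \<longleftrightarrow>
     is_coproduct C UNIV (case_bool A B) P (case_bool i j)"

definition preadditive :: "('o, 'a) cat \<Rightarrow> ('a \<Rightarrow> 'a \<Rightarrow> 'a) \<Rightarrow> bool" where
  "preadditive C add \<longleftrightarrow> category C \<and>
     (\<forall>A\<in>Obj C. \<forall>B\<in>Obj C. \<exists>z. comm_group \<lparr>carrier = Hom C A B, mult = add, one = z\<rparr>) \<and>
     (\<forall>f\<in>Arr C. \<forall>g\<in>Hom C (Dom C f) (Cod C f). \<forall>h\<in>Arr C. Dom C h = Cod C f \<longrightarrow>
        h \<cdot>\<^bsub>C\<^esub> (add f g) = add (h \<cdot>\<^bsub>C\<^esub> f) (h \<cdot>\<^bsub>C\<^esub> g)) \<and>
     (\<forall>f\<in>Arr C. \<forall>g\<in>Hom C (Dom C f) (Cod C f). \<forall>h\<in>Arr C. Cod C h = Dom C f \<longrightarrow>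
        (add f g) \<cdot>\<^bsub>C\<^esub> h = add (f \<cdot>\<^bsub>C\<^esub> h) (g \<cdot>\<^bsub>C\<^esub> h))"

text \<open>
  The addition is existentially quantified: an additive category carries exactly one.
\<close>

definition abelian :: "('o, 'a) cat \<Rightarrow> bool" where
  "abelian C \<longleftrightarrow> (\<exists>add. preadditive C add) \<and> (\<exists>Z. zero_object C Z) \<and>
     (\<forall>A\<in>Obj C. \<forall>B\<in>Obj C. \<exists>P i j. is_binary_coproduct C A B P i j) \<and>
     (\<forall>f\<in>Arr C. (\<exists>k. is_kernel C f k) \<and> (\<exists>c. is_cokernel C f c)) \<and>
     (\<forall>m. is_mono C m \<longrightarrow> (\<exists>f. is_kernel C f m)) \<and>
     (\<forall>p. is_epi C p \<longrightarrow> (\<exists>f. is_cokernel C f p))"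


section \<open>Subobjects and traces\<close>

definition sub_le :: "('o, 'a) cat \<Rightarrow> 'a \<Rightarrow> 'a \<Rightarrow> bool" where
  "sub_le C m n \<longleftrightarrow> (\<exists>u\<in>Hom C (Dom C m) (Dom C n). m = n \<cdot>\<^bsub>C\<^esub> u)"

definition subobject :: "('o, 'a) cat \<Rightarrow> 'o \<Rightarrow> 'a \<Rightarrow> bool" where
  "subobject C M m \<longleftrightarrow> is_mono C m \<and> Cod C m = M"

definition is_subobject_sum :: "('o, 'a) cat \<Rightarrow> 'o \<Rightarrow> 'a set \<Rightarrow> 'a \<Rightarrow> bool" where
  "is_subobject_sum C M K s \<longleftrightarrow> subobject C M s \<and> (\<forall>m\<in>K. sub_le C m s) \<and>
     (\<forall>n. subobject C M n \<longrightarrow> (\<forall>m\<in>K. sub_le C m n) \<longrightarrow> sub_le C s n)"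

definition is_trace :: "('o, 'a) cat \<Rightarrow> 'o set \<Rightarrow> 'o \<Rightarrow> 'a \<Rightarrow> bool" where
  "is_trace C XX M s \<longleftrightarrow> is_subobject_sum C M {m. \<exists>X\<in>XX. \<exists>f\<in>Hom C X M. is_image C f m} s"


section \<open>Direct systems and direct limits\<close>

record ('j, 'o, 'a) dsys =
  Idx :: "'j set"
  Ord :: "'j rel"
  DObj :: "'j \<Rightarrow> 'o"
  DArr :: "'j \<Rightarrow> 'j \<Rightarrow> 'a"

definition direct_system :: "'u rel \<Rightarrow> ('o, 'a) cat \<Rightarrow> ('u, 'o, 'a) dsys \<Rightarrow> bool" where
  "direct_system \<kappa> C D \<longleftrightarrow>
     small \<kappa> (Idx D) \<and> Idx D \<noteq> {} \<and> preorder_on (Idx D) (Ord D) \<and>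
     (\<forall>i\<in>Idx D. \<forall>j\<in>Idx D. \<exists>k\<in>Idx D. (i, k) \<in> Ord D \<and> (j, k) \<in> Ord D) \<and>
     (\<forall>i\<in>Idx D. DObj D i \<in> Obj C \<and> DArr D i i = Ident C (DObj D i)) \<and>
     (\<forall>i j. (i, j) \<in> Ord D \<longrightarrow> DArr D i j \<in> Hom C (DObj D i) (DObj D j)) \<and>
     (\<forall>i j k. (i, j) \<in> Ord D \<longrightarrow> (j, k) \<in> Ord D \<longrightarrow>
        DArr D i k = DArr D j k \<cdot>\<^bsub>C\<^esub> DArr D i j)"

definition is_cocone ::
  "('o, 'a) cat \<Rightarrow> ('j, 'o, 'a) dsys \<Rightarrow> 'o \<Rightarrow> ('j \<Rightarrow> 'a) \<Rightarrow> bool" where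
  "is_cocone C D L l \<longleftrightarrow> L \<in> Obj C \<and> (\<forall>i\<in>Idx D. l i \<in> Hom C (DObj D i) L) \<and>
     (\<forall>i j. (i, j) \<in> Ord D \<longrightarrow> l j \<cdot>\<^bsub>C\<^esub> DArr D i j = l i)"

definition is_direct_limit ::
  "('o, 'a) cat \<Rightarrow> ('j, 'o, 'a) dsys \<Rightarrow> 'o \<Rightarrow> ('j \<Rightarrow> 'a) \<Rightarrow> bool" where
  "is_direct_limit C D L l \<longleftrightarrow> is_cocone C D L l \<and>
     (\<forall>M m. is_cocone C D M m \<longrightarrow>
        (\<exists>!h. h \<in> Hom C L M \<and> (\<forall>i\<in>Idx D. h \<cdot>\<^bsub>C\<^esub> l i = m i)))"

definition exact_direct_limits :: "'u rel \<Rightarrow> ('o, 'a) cat \<Rightarrow> bool" where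
  "exact_direct_limits \<kappa> C \<longleftrightarrow>
     (\<forall>(D1 :: ('u, 'o, 'a) dsys) D2 D3 L1 l1 L2 l2 L3 l3 \<phi> \<psi> f g.
        direct_system \<kappa> C D1 \<longrightarrow> direct_system \<kappa> C D2 \<longrightarrow> direct_system \<kappa> C D3 \<longrightarrow>
        Idx D2 = Idx D1 \<longrightarrow> Idx D3 = Idx D1 \<longrightarrow> Ord D2 = Ord D1 \<longrightarrow> Ord D3 = Ord D1 \<longrightarrow>
        is_direct_limit C D1 L1 l1 \<longrightarrow> is_direct_limit C D2 L2 l2 \<longrightarrow>
        is_direct_limit C D3 L3 l3 \<longrightarrow>
        (\<forall>i\<in>Idx D1. \<phi> i \<in> Hom C (DObj D1 i) (DObj D2 i) \<and>
           \<psi> i \<in> Hom C (DObj D2 i) (DObj D3 i) \<and> short_exact C (\<phi> i) (\<psi> i)) \<longrightarrow>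
        (\<forall>i j. (i, j) \<in> Ord D1 \<longrightarrow>
           \<phi> j \<cdot>\<^bsub>C\<^esub> DArr D1 i j = DArr D2 i j \<cdot>\<^bsub>C\<^esub> \<phi> i \<and>
           \<psi> j \<cdot>\<^bsub>C\<^esub> DArr D2 i j = DArr D3 i j \<cdot>\<^bsub>C\<^esub> \<psi> i) \<longrightarrow>
        f \<in> Hom C L1 L2 \<longrightarrow> g \<in> Hom C L2 L3 \<longrightarrow>
        (\<forall>i\<in>Idx D1. f \<cdot>\<^bsub>C\<^esub> l1 i = l2 i \<cdot>\<^bsub>C\<^esub> \<phi> i \<and> g \<cdot>\<^bsub>C\<^esub> l2 i = l3 i \<cdot>\<^bsub>C\<^esub> \<psi> i) \<longrightarrow>
        short_exact C f g)"


section \<open>Grothendieck categories\<close>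

definition locally_small :: "'u rel \<Rightarrow> ('o, 'a) cat \<Rightarrow> bool" where
  "locally_small \<kappa> C \<longleftrightarrow> (\<forall>A\<in>Obj C. \<forall>B\<in>Obj C. small \<kappa> (Hom C A B))"

definition has_coproducts :: "'u rel \<Rightarrow> ('o, 'a) cat \<Rightarrow> bool" where
  "has_coproducts \<kappa> C \<longleftrightarrow>
     (\<forall>(J :: 'u set) F. small \<kappa> J \<longrightarrow> (\<forall>j\<in>J. F j \<in> Obj C) \<longrightarrow> (\<exists>P e. is_coproduct C J F P e))"

definition generates :: "('o, 'a) cat \<Rightarrow> 'o set \<Rightarrow> bool" where
  "generates C S \<longleftrightarrow> S \<subseteq> Obj C \<and>
     (\<forall>f\<in>Arr C. \<forall>g\<in>Hom C (Dom C f) (Cod C f). f \<noteq> g \<longrightarrow>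
        (\<exists>X\<in>S. \<exists>h\<in>Hom C X (Dom C f). f \<cdot>\<^bsub>C\<^esub> h \<noteq> g \<cdot>\<^bsub>C\<^esub> h))"

definition grothendieck :: "'u rel \<Rightarrow> ('o, 'a) cat \<Rightarrow> bool" where
  "grothendieck \<kappa> C \<longleftrightarrow> abelian C \<and> locally_small \<kappa> C \<and> has_coproducts \<kappa> C \<and>
     exact_direct_limits \<kappa> C \<and> (\<exists>U. generates C {U})"


section \<open>Finitely presented and flat objects\<close>

text \<open>
  The direct limit of a direct system of sets \<open>H i\<close> with transition maps \<open>t i j\<close>, as a quotient
  of the disjoint union.
\<close>

definition set_direct_limit ::
  "'j set \<Rightarrow> 'j rel \<Rightarrow> ('j \<Rightarrow> 'x set) \<Rightarrow> ('j \<Rightarrow> 'j \<Rightarrow> 'x \<Rightarrow> 'x) \<Rightarrow> ('j \<times> 'x) set set" where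
  "set_direct_limit J r H t =
     Sigma J H //
     {((i, x), (j, y)). (i, x) \<in> Sigma J H \<and> (j, y) \<in> Sigma J H \<and>
        (\<exists>k. (i, k) \<in> r \<and> (j, k) \<in> r \<and> t i k x = t j k y)}"

definition finitely_presented :: "'u rel \<Rightarrow> ('o, 'a) cat \<Rightarrow> 'o \<Rightarrow> bool" where
  "finitely_presented \<kappa> C X \<longleftrightarrow> X \<in> Obj C \<and>
     (\<forall>(D :: ('u, 'o, 'a) dsys) L l. direct_system \<kappa> C D \<longrightarrow> is_direct_limit C D L l \<longrightarrow>
        bij_betw (\<lambda>\<xi>. the_elem ((\<lambda>(i, u). l i \<cdot>\<^bsub>C\<^esub> u) ` \<xi>))
          (set_direct_limit (Idx D) (Ord D) (\<lambda>i. Hom C X (DObj D i)) (\<lambda>i j u. DArr D i j \<cdot>\<^bsub>C\<^esub> u))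
          (Hom C X L))"

definition locally_finitely_presented :: "'u rel \<Rightarrow> ('o, 'a) cat \<Rightarrow> bool" where
  "locally_finitely_presented \<kappa> C \<longleftrightarrow> grothendieck \<kappa> C \<and>
     (\<exists>S. small \<kappa> S \<and> (\<forall>X\<in>S. finitely_presented \<kappa> C X) \<and> generates C S) \<and>
     (\<forall>M\<in>Obj C. \<exists>(D :: ('u, 'o, 'a) dsys) l. direct_system \<kappa> C D \<and>
        (\<forall>i\<in>Idx D. finitely_presented \<kappa> C (DObj D i)) \<and> is_direct_limit C D M l)"

definition pure_epi :: "'u rel \<Rightarrow> ('o, 'a) cat \<Rightarrow> 'a \<Rightarrow> bool" where
  "pure_epi \<kappa> C p \<longleftrightarrow> is_epi C p \<and>
     (\<forall>X. finitely_presented \<kappa> C X \<longrightarrow>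
        (\<lambda>u. p \<cdot>\<^bsub>C\<^esub> u) ` Hom C X (Dom C p) = Hom C X (Cod C p))"

definition flat :: "'u rel \<Rightarrow> ('o, 'a) cat \<Rightarrow> 'o \<Rightarrow> bool" where
  "flat \<kappa> C F \<longleftrightarrow> F \<in> Obj C \<and> (\<forall>p. is_epi C p \<longrightarrow> Cod C p = F \<longrightarrow> pure_epi \<kappa> C p)"


section \<open>Ext in degree one\<close>

definition extensions :: "('o, 'a) cat \<Rightarrow> 'o \<Rightarrow> 'o \<Rightarrow> ('a \<times> 'a) set" where
  "extensions C T Y = {(f, g). short_exact C f g \<and> Dom C f = Y \<and> Cod C g = T}"

definition extension_equiv :: "('o, 'a) cat \<Rightarrow> 'o \<Rightarrow> 'o \<Rightarrow> ('a \<times> 'a) rel" where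
  "extension_equiv C T Y =
     {((f, g), (f', g')). (f, g) \<in> extensions C T Y \<and> (f', g') \<in> extensions C T Y \<and>
        (\<exists>e\<in>Hom C (Cod C f) (Cod C f'). is_iso C e \<and> e \<cdot>\<^bsub>C\<^esub> f = f' \<and> g' \<cdot>\<^bsub>C\<^esub> e = g)}"

text \<open>
  Yoneda's \<open>Ext\<^sup>1(T, Y)\<close>.  Its zero element is the class consisting of the direct sum extensions
  \<open>Y \<rightarrow> Y \<oplus> T \<rightarrow> T\<close>.
\<close>

definition Ext1 :: "('o, 'a) cat \<Rightarrow> 'o \<Rightarrow> 'o \<Rightarrow> ('a \<times> 'a) set set" where
  "Ext1 C T Y = extensions C T Y // extension_equiv C T Y"

definition Ext1_zero :: "('o, 'a) cat \<Rightarrow> 'o \<Rightarrow> 'o \<Rightarrow> ('a \<times> 'a) set" where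
  "Ext1_zero C T Y =
     {(f, g) \<in> extensions C T Y.
        \<exists>s. is_binary_coproduct C Y T (Cod C f) f s \<and> g \<cdot>\<^bsub>C\<^esub> s = Ident C T}"


section \<open>Hereditary torsion classes\<close>

definition hereditary_torsion_class :: "'u rel \<Rightarrow> ('o, 'a) cat \<Rightarrow> 'o set \<Rightarrow> bool" where
  "hereditary_torsion_class \<kappa> C TT \<longleftrightarrow> TT \<subseteq> Obj C \<and>
     (\<forall>m. is_mono C m \<longrightarrow> Cod C m \<in> TT \<longrightarrow> Dom C m \<in> TT) \<and>
     (\<forall>p. is_epi C p \<longrightarrow> Dom C p \<in> TT \<longrightarrow> Cod C p \<in> TT) \<and>
     (\<forall>f g. short_exact C f g \<longrightarrow> Dom C f \<in> TT \<longrightarrow> Cod C g \<in> TT \<longrightarrow> Cod C f \<in> TT) \<and>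
     (\<forall>(J :: 'u set) F P e. small \<kappa> J \<longrightarrow> (\<forall>j\<in>J. F j \<in> TT) \<longrightarrow> is_coproduct C J F P e \<longrightarrow> P \<in> TT)"

definition is_torsion_radical :: "('o, 'a) cat \<Rightarrow> 'o set \<Rightarrow> 'o \<Rightarrow> 'a \<Rightarrow> bool" where
  "is_torsion_radical C TT M t \<longleftrightarrow> subobject C M t \<and> Dom C t \<in> TT \<and>
     (\<forall>m. subobject C M m \<longrightarrow> Dom C m \<in> TT \<longrightarrow> sub_le C m t)"

text \<open>
  The class of all \<open>X/t(X)\<close> with \<open>X \<in> XX\<close>; quotient objects are only determined up to
  isomorphism, so all choices of \<open>X/t(X)\<close> are included.
\<close>

definition torsion_free_quotients :: "('o, 'a) cat \<Rightarrow> 'o set \<Rightarrow> 'o set \<Rightarrow> 'o set" where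
  "torsion_free_quotients C TT XX =
     {Y. \<exists>X\<in>XX. \<exists>t p. is_torsion_radical C TT X t \<and> is_cokernel C t p \<and> Cod C p = Y}"

definition torsion_images :: "('o, 'a) cat \<Rightarrow> 'o set \<Rightarrow> 'o \<Rightarrow> 'o set" where
  "torsion_images C TT X = {T \<in> TT. \<exists>p. is_epi C p \<and> p \<in> Hom C X T}"


section \<open>Functors\<close>

record ('o, 'a, 'p, 'b) fctr =
  FObj :: "'o \<Rightarrow> 'p"
  FArr :: "'a \<Rightarrow> 'b"

definition is_functor :: "('o, 'a) cat \<Rightarrow> ('p, 'b) cat \<Rightarrow> ('o, 'a, 'p, 'b) fctr \<Rightarrow> bool" where
  "is_functor C D F \<longleftrightarrow>
     (\<forall>A\<in>Obj C. FObj F A \<in> Obj D \<and> FArr F (Ident C A) = Ident D (FObj F A)) \<and>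
     (\<forall>f\<in>Arr C. FArr F f \<in> Hom D (FObj F (Dom C f)) (FObj F (Cod C f))) \<and>
     (\<forall>f\<in>Arr C. \<forall>g\<in>Arr C. Cod C f = Dom C g \<longrightarrow>
        FArr F (g \<cdot>\<^bsub>C\<^esub> f) = FArr F g \<cdot>\<^bsub>D\<^esub> FArr F f)"

definition right_adjoint ::
  "('o, 'a) cat \<Rightarrow> ('p, 'b) cat \<Rightarrow> ('o, 'a, 'p, 'b) fctr \<Rightarrow> ('p, 'b, 'o, 'a) fctr \<Rightarrow> bool" where
  "right_adjoint C D F G \<longleftrightarrow> is_functor C D F \<and> is_functor D C G \<and>
     (\<exists>\<Phi>. (\<forall>A\<in>Obj C. \<forall>B\<in>Obj D. bij_betw (\<Phi> A B) (Hom D (FObj F A) B) (Hom C A (FObj G B))) \<and>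
        (\<forall>a\<in>Arr C. \<forall>b\<in>Arr D. \<forall>f\<in>Hom D (FObj F (Cod C a)) (Dom D b).
           \<Phi> (Dom C a) (Cod D b) (b \<cdot>\<^bsub>D\<^esub> f \<cdot>\<^bsub>D\<^esub> FArr F a) =
           FArr G b \<cdot>\<^bsub>C\<^esub> \<Phi> (Cod C a) (Dom D b) f \<cdot>\<^bsub>C\<^esub> a))"

definition map_dsys :: "('o, 'a, 'p, 'b) fctr \<Rightarrow> ('j, 'o, 'a) dsys \<Rightarrow> ('j, 'p, 'b) dsys" where
  "map_dsys F D =
     \<lparr>Idx = Idx D, Ord = Ord D, DObj = \<lambda>i. FObj F (DObj D i), DArr = \<lambda>i j. FArr F (DArr D i j)\<rparr>"

definition preserves_direct_limits ::
  "'u rel \<Rightarrow> ('o, 'a) cat \<Rightarrow> ('p, 'b) cat \<Rightarrow> ('o, 'a, 'p, 'b) fctr \<Rightarrow> bool" where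
  "preserves_direct_limits \<kappa> C D F \<longleftrightarrow>
     (\<forall>(S :: ('u, 'o, 'a) dsys) L l. direct_system \<kappa> C S \<longrightarrow> is_direct_limit C S L l \<longrightarrow>
        is_direct_limit D (map_dsys F S) (FObj F L) (\<lambda>i. FArr F (l i)))"


section \<open>The Gabriel quotient category\<close>

text \<open>
  The quotient category is the localization at the arrows with torsion kernel and cokernel.
  These arrows admit a calculus of right fractions, so the arrows \<open>M \<rightarrow> N\<close> of the quotient are the
  classes of roofs \<open>(s, f)\<close>, \<open>M \<leftarrow> M' \<rightarrow> N\<close> with \<open>s : M' \<rightarrow> M\<close> inverted, two roofs being identified
  if some roof lies over both.  The composite of the classes of \<open>(s, f)\<close> and \<open>(u, g)\<close> is the
  class of \<open>(s s', g f')\<close> for any completion \<open>f s' = u f'\<close> of \<open>f\<close>, \<open>u\<close> to a square with \<open>s'\<close>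
  inverted.
\<close>

definition torsion_isos :: "('o, 'a) cat \<Rightarrow> 'o set \<Rightarrow> 'a set" where
  "torsion_isos C TT =
     {s. (\<exists>k. is_kernel C s k \<and> Dom C k \<in> TT) \<and> (\<exists>c. is_cokernel C s c \<and> Cod C c \<in> TT)}"

definition roofs :: "('o, 'a) cat \<Rightarrow> 'o set \<Rightarrow> ('a \<times> 'a) set" where
  "roofs C TT = {(s, f). s \<in> torsion_isos C TT \<and> f \<in> Arr C \<and> Dom C s = Dom C f}"

definition roof_equiv :: "('o, 'a) cat \<Rightarrow> 'o set \<Rightarrow> ('a \<times> 'a) rel" where
  "roof_equiv C TT =
     {((s, f), (s', f')). (s, f) \<in> roofs C TT \<and> (s', f') \<in> roofs C TT \<and>
        Cod C s = Cod C s' \<and> Cod C f = Cod C f' \<and>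
        (\<exists>a a'. a \<in> Arr C \<and> a' \<in> Arr C \<and> Dom C a = Dom C a' \<and>
           Cod C a = Dom C s \<and> Cod C a' = Dom C s' \<and>
           s \<cdot>\<^bsub>C\<^esub> a \<in> torsion_isos C TT \<and> s \<cdot>\<^bsub>C\<^esub> a = s' \<cdot>\<^bsub>C\<^esub> a' \<and> f \<cdot>\<^bsub>C\<^esub> a = f' \<cdot>\<^bsub>C\<^esub> a')}"

definition roof_class :: "('o, 'a) cat \<Rightarrow> 'o set \<Rightarrow> 'a \<times> 'a \<Rightarrow> ('a \<times> 'a) set" where
  "roof_class C TT r = roof_equiv C TT `` {r}"

definition gabriel_quotient :: "('o, 'a) cat \<Rightarrow> 'o set \<Rightarrow> ('o, ('a \<times> 'a) set) cat" where
  "gabriel_quotient C TT =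
     \<lparr>Obj = Obj C,
      Arr = roofs C TT // roof_equiv C TT,
      Dom = \<lambda>\<phi>. Cod C (fst (SOME r. r \<in> \<phi>)),
      Cod = \<lambda>\<phi>. Cod C (snd (SOME r. r \<in> \<phi>)),
      Ident = \<lambda>A. roof_class C TT (Ident C A, Ident C A),
      Comp = \<lambda>\<psi> \<phi>. \<Union> {roof_class C TT (s \<cdot>\<^bsub>C\<^esub> s', g \<cdot>\<^bsub>C\<^esub> f') | s f u g s' f'.
        (s, f) \<in> \<phi> \<and> (u, g) \<in> \<psi> \<and> s' \<in> torsion_isos C TT \<and> f' \<in> Arr C \<and> Dom C s' = Dom C f' \<and>
        Cod C s' = Dom C f \<and> Cod C f' = Dom C u \<and> f \<cdot>\<^bsub>C\<^esub> s' = u \<cdot>\<^bsub>C\<^esub> f'}\<rparr>"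

definition quotient_functor ::
  "('o, 'a) cat \<Rightarrow> 'o set \<Rightarrow> ('o, 'a, 'o, ('a \<times> 'a) set) fctr" where
  "quotient_functor C TT = \<lparr>FObj = \<lambda>A. A, FArr = \<lambda>f. roof_class C TT (Ident C (Dom C f), f)\<rparr>"

text \<open>
  The section functor exists for every hereditary torsion class of a Grothendieck category and is
  unique up to natural isomorphism.
\<close>

definition finite_type :: "'u rel \<Rightarrow> ('o, 'a) cat \<Rightarrow> 'o set \<Rightarrow> bool" where
  "finite_type \<kappa> C TT \<longleftrightarrow>
     (\<exists>\<iota>. right_adjoint C (gabriel_quotient C TT) (quotient_functor C TT) \<iota> \<and>
        preserves_direct_limits \<kappa> (gabriel_quotient C TT) C \<iota>)"

end

theory Submission
  imports Defs
begin

text \<open>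
  Write \<open>D\<close> for \<open>\<G>/\<T>\<close> and \<open>q, \<iota>\<close> for the quotient functor and the section functor.

  The category \<open>D\<close> is obtained from a calculus of fractions: every arrow of \<open>D\<close> has the form
  \<open>q f (q s)\<^sup>-\<^sup>1\<close> with \<open>s\<close> in the class \<open>\<Sigma>\<close> of arrows with torsion kernel and cokernel, and \<open>q f = 0\<close>
  exactly when some \<open>z\<close> in \<open>\<Sigma>\<close> satisfies \<open>f z = 0\<close>.  So kernels, monomorphisms and epimorphisms of \<open>D\<close>
  come from \<open>\<G>\<close>.  Everything else about \<open>D\<close> is read off from the adjunction
  \<open>Hom\<^bsub>D\<^esub>(A, B) \<cong> Hom\<^bsub>\<G>\<^esub>(A, \<iota> B)\<close>: the addition, the size of the Hom sets, cokernels, coproducts,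
  direct limits and generators.  Since \<open>\<iota>\<close> preserves direct limits, \<open>q\<close> preserves finitely
  presented objects; finitely presented generators make direct limits exact, so \<open>D\<close> is locally
  finitely presented (\<open>locally_finitely_presented_D\<close>).

  Let \<open>F\<close> be flat in \<open>D\<close> and \<open>X \<in> S i\<close>.  Call \<open>k < i\<close> bad if, for some \<open>A \<in> S k\<close>, there is a nonzero
  \<open>Hom\<close> from \<open>X\<close>, or a nonzero \<open>Ext\<^sup>1\<close> from a torsion quotient of \<open>X\<close>, to \<open>A/t(A)\<close>; by hypothesis there
  are finitely many bad indices.  If \<open>k < i\<close> is not bad and \<open>A \<in> S k\<close>, then every morphism \<open>X \<rightarrow> A\<close> of
  \<open>D\<close> is zero: its adjunct \<open>X \<rightarrow> \<iota> A\<close> takes values in \<open>A/t(A)\<close> because \<open>Ext\<^sup>1\<close> vanishes, and is zero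
  because \<open>Hom\<close> vanishes (\<open>hom_D_zero\<close>).  As the index set is directed and has no minimum, some
  \<open>j < i\<close> lies above no bad index.  Since the quotients by the traces are torsion, the objects in
  the \<open>S k\<close> with \<open>k \<le> j\<close> still generate \<open>D\<close> (\<open>generates_of_trace\<close>), so \<open>F\<close> is a quotient of a
  coproduct \<open>P\<close> of such objects.  This epimorphism is pure, so every morphism \<open>X \<rightarrow> F\<close> factors
  through \<open>P\<close>; but \<open>X\<close> is finitely presented and has no nonzero morphism to a summand of \<open>P\<close>,
  hence none to \<open>P\<close> (\<open>fp_hom_coproduct_zero\<close>).  So the generators \<open>X\<close> admit only zero morphisms to
  \<open>F\<close>, and \<open>F = 0\<close>.
\<close>

section \<open>Small sets\<close>

lemma small_subset: "small \<kappa> A \<Longrightarrow> B \<subseteq> A \<Longrightarrow> small \<kappa> B"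
  unfolding small_def using card_of_mono1 ordLeq_ordLess_trans by blast

lemma small_bij: "bij_betw f A B \<Longrightarrow> small \<kappa> A \<longleftrightarrow> small \<kappa> B"
  unfolding small_def by (meson card_of_ordIsoI ordIso_ordLess_trans ordIso_symmetric)

lemma small_UN:
  assumes "inaccessible \<kappa>" "small \<kappa> I" "\<And>i. i \<in> I \<Longrightarrow> small \<kappa> (A i)"
  shows "small \<kappa> (\<Union>i\<in>I. A i)"
proof -
  have "Cinfinite \<kappa>"
    using assms(1) card_of_mono2[OF ordLess_imp_ordLeq, of natLeq \<kappa>]
      card_of_ordLeq_infinite[of "Field natLeq" "Field \<kappa>"]
    unfolding inaccessible_def cinfinite_def by (auto simp: Field_natLeq)
  then show ?thesis
    using regularCard_UNION_bound assms unfolding small_def inaccessible_def by blast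
qed

text \<open>
  A cardinal on a type bounds the small sets of every other type, so that small families can be
  reindexed by that type.
\<close>

lemma small_encode:
  fixes \<kappa> :: "'u rel"
  assumes "inaccessible \<kappa>" "small \<kappa> A"
  obtains J :: "'u set" and f where "small \<kappa> J" "bij_betw f J A"
proof -
  have "Card_order \<kappa>" "|A| <o \<kappa>"
    using assms unfolding small_def inaccessible_def by auto
  then have "|A| \<le>o |Field \<kappa>|"
    by (metis card_of_Field_ordIso ordIso_symmetric ordLess_imp_ordLeq ordLess_ordIso_trans)
  then obtain g where g: "inj_on g A" "g ` A \<subseteq> Field \<kappa>"
    using card_of_ordLeq[of A "Field \<kappa>"] by auto
  then have b: "bij_betw g A (g ` A)" by (simp add: bij_betw_def)
  show thesis
    using that[OF _ bij_betw_inv_into[OF b]] small_bij[OF b] assms(2) by blast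
qed

section \<open>Categories\<close>

lemma Hom_iff [simp]: "f \<in> Hom C A B \<longleftrightarrow> f \<in> Arr C \<and> Dom C f = A \<and> Cod C f = B"
  by (simp add: Hom_def)

locale category_loc =
  fixes C :: "('o, 'a) cat" (structure)
  assumes category: "category C"
begin

lemma dom_cod_Obj [simp]: "f \<in> Arr C \<Longrightarrow> Dom C f \<in> Obj C" "f \<in> Arr C \<Longrightarrow> Cod C f \<in> Obj C"
  using category by (auto simp: category_def)

lemma Ident_simps [simp]:
  assumes "A \<in> Obj C"
  shows "Ident C A \<in> Arr C" "Dom C (Ident C A) = A" "Cod C (Ident C A) = A"
  using category assms by (auto simp: category_def)

lemma comp_simps [simp]:
  assumes "f \<in> Arr C" "g \<in> Arr C" "Cod C f = Dom C g"
  shows "g \<cdot> f \<in> Arr C" "Dom C (g \<cdot> f) = Dom C f" "Cod C (g \<cdot> f) = Cod C g"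
  using category assms by (auto simp: category_def)

lemma comp_Ident [simp]:
  "f \<in> Arr C \<Longrightarrow> Dom C f = A \<Longrightarrow> f \<cdot> Ident C A = f"
  "f \<in> Arr C \<Longrightarrow> Cod C f = A \<Longrightarrow> Ident C A \<cdot> f = f"
  using category by (auto simp: category_def)

lemma comp_assoc [simp]:
  "f \<in> Arr C \<Longrightarrow> g \<in> Arr C \<Longrightarrow> h \<in> Arr C \<Longrightarrow> Cod C f = Dom C g \<Longrightarrow> Cod C g = Dom C h \<Longrightarrow>
    (h \<cdot> g) \<cdot> f = h \<cdot> g \<cdot> f"
  using category unfolding category_def by metis

lemma comp_Ident_assoc [simp]:
  "f \<in> Arr C \<Longrightarrow> h \<in> Arr C \<Longrightarrow> Cod C f = A \<Longrightarrow> Dom C h = A \<Longrightarrow> h \<cdot> Ident C A \<cdot> f = h \<cdot> f"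
  by simp

text \<open>Composites are kept bracketed to the right; this lets an equation be used inside a longer one.\<close>

lemma comp_whisker:
  assumes "g \<cdot> f = h" "f \<in> Arr C" "g \<in> Arr C" "Cod C f = Dom C g" "x \<in> Arr C" "Cod C x = Dom C f"
  shows "g \<cdot> f \<cdot> x = h \<cdot> x"
  using assms comp_assoc by metis

lemma mono_cancel:
  "is_mono C m \<Longrightarrow> m \<cdot> u = m \<cdot> v \<Longrightarrow> u \<in> Arr C \<Longrightarrow> v \<in> Arr C \<Longrightarrow> Cod C u = Dom C m \<Longrightarrow>
    Cod C v = Dom C m \<Longrightarrow> Dom C u = Dom C v \<Longrightarrow> u = v"
  unfolding is_mono_def by (metis Hom_iff dom_cod_Obj(1))

lemma epi_cancel:
  "is_epi C p \<Longrightarrow> u \<cdot> p = v \<cdot> p \<Longrightarrow> u \<in> Arr C \<Longrightarrow> v \<in> Arr C \<Longrightarrow> Dom C u = Cod C p \<Longrightarrow>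
    Dom C v = Cod C p \<Longrightarrow> Cod C u = Cod C v \<Longrightarrow> u = v"
  unfolding is_epi_def by (metis Hom_iff dom_cod_Obj(2))

lemma mono_Arr: "is_mono C m \<Longrightarrow> m \<in> Arr C" by (simp add: is_mono_def)
lemma epi_Arr: "is_epi C m \<Longrightarrow> m \<in> Arr C" by (simp add: is_epi_def)

lemma mono_comp:
  assumes "is_mono C m" "is_mono C n" "Cod C n = Dom C m"
  shows "is_mono C (m \<cdot> n)"
  unfolding is_mono_def
proof (intro conjI ballI impI)
  have a: "m \<in> Arr C" "n \<in> Arr C" using assms mono_Arr by auto
  show "m \<cdot> n \<in> Arr C" using a assms by simp
  fix A u v assume "A \<in> Obj C" "u \<in> Hom C A (Dom C (m \<cdot> n))" "v \<in> Hom C A (Dom C (m \<cdot> n))"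
    and e: "(m \<cdot> n) \<cdot> u = (m \<cdot> n) \<cdot> v"
  then have h: "u \<in> Arr C" "v \<in> Arr C" "Cod C u = Dom C n" "Cod C v = Dom C n"
    "Dom C u = Dom C v" using a assms by auto
  then have "m \<cdot> (n \<cdot> u) = m \<cdot> (n \<cdot> v)" using e a assms by simp
  then have "n \<cdot> u = n \<cdot> v" by (rule mono_cancel[OF assms(1)]) (use h a assms in auto)
  then show "u = v" by (rule mono_cancel[OF assms(2)]) (use h in auto)
qed

lemma epi_comp:
  assumes "is_epi C m" "is_epi C n" "Cod C n = Dom C m"
  shows "is_epi C (m \<cdot> n)"
  unfolding is_epi_def
proof (intro conjI ballI impI)
  have a: "m \<in> Arr C" "n \<in> Arr C" using assms epi_Arr by auto
  show "m \<cdot> n \<in> Arr C" using a assms by simp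
  fix A u v assume "A \<in> Obj C" "u \<in> Hom C (Cod C (m \<cdot> n)) A" "v \<in> Hom C (Cod C (m \<cdot> n)) A"
    and e: "u \<cdot> (m \<cdot> n) = v \<cdot> (m \<cdot> n)"
  then have h: "u \<in> Arr C" "v \<in> Arr C" "Dom C u = Cod C m" "Dom C v = Cod C m"
    "Cod C u = Cod C v" using a assms by auto
  then have "(u \<cdot> m) \<cdot> n = (v \<cdot> m) \<cdot> n" using e a assms by simp
  then have "u \<cdot> m = v \<cdot> m" by (rule epi_cancel[OF assms(2)]) (use h a assms in auto)
  then show "u = v" by (rule epi_cancel[OF assms(1)]) (use h in auto)
qed

lemma mono_right:
  assumes "is_mono C (g \<cdot> f)" "f \<in> Arr C" "g \<in> Arr C" "Cod C f = Dom C g"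
  shows "is_mono C f"
  unfolding is_mono_def
proof (intro conjI ballI impI)
  fix A u v assume h: "A \<in> Obj C" "u \<in> Hom C A (Dom C f)" "v \<in> Hom C A (Dom C f)" "f \<cdot> u = f \<cdot> v"
  then have "(g \<cdot> f) \<cdot> u = (g \<cdot> f) \<cdot> v" using assms by simp
  then show "u = v" by (rule mono_cancel[OF assms(1)]) (use h assms in auto)
qed fact

lemma epi_left:
  assumes "is_epi C (g \<cdot> f)" "f \<in> Arr C" "g \<in> Arr C" "Cod C f = Dom C g"
  shows "is_epi C g"
  unfolding is_epi_def
proof (intro conjI ballI impI)
  fix A u v assume h: "A \<in> Obj C" "u \<in> Hom C (Cod C g) A" "v \<in> Hom C (Cod C g) A" "u \<cdot> g = v \<cdot> g"
  then have "u \<cdot> (g \<cdot> f) = v \<cdot> (g \<cdot> f)" using comp_assoc assms by (metis Hom_iff)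
  then show "u = v" by (rule epi_cancel[OF assms(1)]) (use h assms in auto)
qed fact

lemma zero_object_Obj: "zero_object C Z \<Longrightarrow> Z \<in> Obj C"
  by (simp add: zero_object_def)

lemma zero_object_unique:
  "zero_object C Z \<Longrightarrow> f \<in> Arr C \<Longrightarrow> g \<in> Arr C \<Longrightarrow> Dom C f = Z \<Longrightarrow> Dom C g = Z \<Longrightarrow>
    Cod C f = Cod C g \<Longrightarrow> f = g"
  "zero_object C Z \<Longrightarrow> f \<in> Arr C \<Longrightarrow> g \<in> Arr C \<Longrightarrow> Cod C f = Z \<Longrightarrow> Cod C g = Z \<Longrightarrow>
    Dom C f = Dom C g \<Longrightarrow> f = g"
  unfolding zero_object_def by (metis Hom_iff dom_cod_Obj)+

lemma coproduct_ex:
  assumes "is_coproduct C J F P e" "\<And>j. j \<in> J \<Longrightarrow> f j \<in> Hom C (F j) B" "B \<in> Obj C"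
  obtains h where "h \<in> Arr C" "Dom C h = P" "Cod C h = B" "\<And>j. j \<in> J \<Longrightarrow> h \<cdot> e j = f j"
proof -
  have "\<exists>!h. h \<in> Hom C P B \<and> (\<forall>j\<in>J. h \<cdot> e j = f j)"
    using assms(1)[unfolded is_coproduct_def, THEN conjunct2, THEN conjunct2, rule_format] assms
    by blast
  then show thesis using that by auto
qed

lemma coproduct_eq:
  assumes "is_coproduct C J F P e" "h \<in> Arr C" "h' \<in> Arr C" "Dom C h = P" "Dom C h' = P"
    "Cod C h = Cod C h'" "\<And>j. j \<in> J \<Longrightarrow> h \<cdot> e j = h' \<cdot> e j"
  shows "h = h'"
proof -
  have e: "\<forall>j\<in>J. e j \<in> Hom C (F j) P" using assms(1) unfolding is_coproduct_def by blast
  then have "\<forall>j\<in>J. h \<cdot> e j \<in> Hom C (F j) (Cod C h)" using assms by simp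
  then have "\<exists>!k. k \<in> Hom C P (Cod C h) \<and> (\<forall>j\<in>J. k \<cdot> e j = h \<cdot> e j)"
    using assms(1)[unfolded is_coproduct_def, THEN conjunct2, THEN conjunct2, rule_format,
        OF dom_cod_Obj(2)[OF assms(2)], of "\<lambda>j. h \<cdot> e j"]
    by blast
  then show ?thesis using assms by (metis Hom_iff)
qed

lemma coproductD:
  assumes "is_coproduct C J F P e"
  shows "P \<in> Obj C" "j \<in> J \<Longrightarrow> e j \<in> Arr C" "j \<in> J \<Longrightarrow> Dom C (e j) = F j" "j \<in> J \<Longrightarrow> Cod C (e j) = P"
  using assms by (auto simp: is_coproduct_def)

end

section \<open>Preadditive categories\<close>

locale preadditive_cat = category_loc +
  fixes add :: "'b \<Rightarrow> 'b \<Rightarrow> 'b"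
  assumes preadditive: "preadditive C add"
    and zero_ex: "\<exists>Z. zero_object C Z"
begin

text \<open>
  The zero of a Hom group, which is its only idempotent.  It is the zero arrow (\<open>zero_arrow_iff\<close>),
  and with it equations can be handled by rewriting.
\<close>

definition nul :: "'a \<Rightarrow> 'a \<Rightarrow> 'b" where
  "nul A B = (THE z. z \<in> Hom C A B \<and> add z z = z)"

definition sub :: "'b \<Rightarrow> 'b \<Rightarrow> 'b" where
  "sub f g = (THE h. h \<in> Hom C (Dom C f) (Cod C f) \<and> add h g = f)"

lemma hom_group:
  assumes "A \<in> Obj C" "B \<in> Obj C"
  shows "comm_group \<lparr>carrier = Hom C A B, mult = add, one = nul A B\<rparr>"
proof -
  obtain z where z: "comm_group \<lparr>carrier = Hom C A B, mult = add, one = z\<rparr>"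
    using preadditive assms unfolding preadditive_def by blast
  interpret G: comm_group "\<lparr>carrier = Hom C A B, mult = add, one = z\<rparr>" by fact
  have "nul A B = z"
    unfolding nul_def
  proof (rule the_equality)
    show "z \<in> Hom C A B \<and> add z z = z" using G.one_closed G.l_one[of z] by simp
    show "w = z" if "w \<in> Hom C A B \<and> add w w = w" for w
      using that G.r_cancel_one[of w w] by auto
  qed
  then show ?thesis using z by simp
qed

lemma nul_simps [simp]:
  assumes "A \<in> Obj C" "B \<in> Obj C"
  shows "nul A B \<in> Arr C" "Dom C (nul A B) = A" "Cod C (nul A B) = B"
  using group.is_monoid[OF comm_group.axioms(2)[OF hom_group[OF assms]]] monoid.one_closed by fastforce+

lemma add_simps [simp]:
  assumes "f \<in> Arr C" "g \<in> Arr C" "Dom C f = Dom C g" "Cod C f = Cod C g"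
  shows "add f g \<in> Arr C" "Dom C (add f g) = Dom C g" "Cod C (add f g) = Cod C g"
proof -
  interpret G: comm_group "\<lparr>carrier = Hom C (Dom C g) (Cod C g), mult = add, one = nul (Dom C g) (Cod C g)\<rparr>"
    using hom_group assms by simp
  show "add f g \<in> Arr C" "Dom C (add f g) = Dom C g" "Cod C (add f g) = Cod C g"
    using G.m_closed[of f g] assms by auto
qed

lemma add_nul [simp]:
  assumes "f \<in> Arr C" "Dom C f = A" "Cod C f = B"
  shows "add f (nul A B) = f" "add (nul A B) f = f"
proof -
  have "A \<in> Obj C" "B \<in> Obj C" using assms by auto
  then interpret G: comm_group "\<lparr>carrier = Hom C A B, mult = add, one = nul A B\<rparr>"
    using hom_group by simp
  show "add f (nul A B) = f" "add (nul A B) f = f"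
    using G.r_one[of f] G.l_one[of f] assms by auto
qed

lemma idem_nul:
  assumes "f \<in> Arr C" "add f f = f"
  shows "f = nul (Dom C f) (Cod C f)"
proof -
  interpret G: comm_group "\<lparr>carrier = Hom C (Dom C f) (Cod C f), mult = add, one = nul (Dom C f) (Cod C f)\<rparr>"
    using hom_group assms by simp
  show ?thesis using G.r_cancel_one[of f f] assms by auto
qed

lemma comp_add:
  assumes "f \<in> Arr C" "g \<in> Arr C" "Dom C f = Dom C g" "Cod C f = Cod C g" "h \<in> Arr C"
  shows "Dom C h = Cod C g \<Longrightarrow> h \<cdot> add f g = add (h \<cdot> f) (h \<cdot> g)"
    "Cod C h = Dom C g \<Longrightarrow> add f g \<cdot> h = add (f \<cdot> h) (g \<cdot> h)"
  using assms preadditive unfolding preadditive_def by auto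

lemma comp_nul [simp]:
  assumes "f \<in> Arr C" "A \<in> Obj C"
  shows "Dom C f = B \<Longrightarrow> f \<cdot> nul A B = nul A (Cod C f)" "Cod C f = B \<Longrightarrow> nul B A \<cdot> f = nul (Dom C f) A"
proof -
  assume B: "Dom C f = B"
  then have BO: "B \<in> Obj C" using assms by auto
  have "add (f \<cdot> nul A B) (f \<cdot> nul A B) = f \<cdot> nul A B"
    using comp_add(1)[of "nul A B" "nul A B" f] B BO assms by simp
  then show "f \<cdot> nul A B = nul A (Cod C f)"
    using idem_nul[of "f \<cdot> nul A B"] assms B BO by simp
next
  assume B: "Cod C f = B"
  then have BO: "B \<in> Obj C" using assms by auto
  have "add (nul B A \<cdot> f) (nul B A \<cdot> f) = nul B A \<cdot> f"
    using comp_add(2)[of "nul B A" "nul B A" f] B BO assms by simp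
  then show "nul B A \<cdot> f = nul (Dom C f) A"
    using idem_nul[of "nul B A \<cdot> f"] assms B BO by simp
qed

lemma sub_props:
  assumes "f \<in> Arr C" "g \<in> Arr C" "Dom C f = Dom C g" "Cod C f = Cod C g"
  shows "sub f g \<in> Arr C" "Dom C (sub f g) = Dom C g" "Cod C (sub f g) = Cod C g" "add (sub f g) g = f"
    "h \<in> Arr C \<Longrightarrow> Dom C h = Dom C g \<Longrightarrow> Cod C h = Cod C g \<Longrightarrow> add h g = f \<Longrightarrow> sub f g = h"
proof -
  let ?H = "\<lparr>carrier = Hom C (Dom C g) (Cod C g), mult = add, one = nul (Dom C g) (Cod C g)\<rparr>"
  interpret G: comm_group ?H
    using hom_group assms by simp
  have ex: "\<exists>!h. h \<in> Hom C (Dom C g) (Cod C g) \<and> add h g = f"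
  proof
    let ?h = "f \<otimes>\<^bsub>?H\<^esub> inv\<^bsub>?H\<^esub> g"
    have g: "f \<in> carrier ?H" "g \<in> carrier ?H" using assms by auto
    have "?h \<in> carrier ?H" "?h \<otimes>\<^bsub>?H\<^esub> g = f"
      using G.m_closed[OF g(1) G.inv_closed[OF g(2)]]
      by (simp_all only: G.m_assoc[OF g(1) G.inv_closed[OF g(2)] g(2)] G.l_inv[OF g(2)] G.r_one[OF g(1)])
    then show "?h \<in> Hom C (Dom C g) (Cod C g) \<and> add ?h g = f" by simp
    show "h = ?h" if "h \<in> Hom C (Dom C g) (Cod C g) \<and> add h g = f" for h
      using that \<open>?h \<in> carrier ?H\<close> \<open>?h \<otimes>\<^bsub>?H\<^esub> g = f\<close> G.right_cancel[OF g(2) _ \<open>?h \<in> carrier ?H\<close>, of h]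
      by (metis partial_object.simps(1) monoid.simps(1))
  qed
  have "sub f g \<in> Hom C (Dom C g) (Cod C g) \<and> add (sub f g) g = f"
    unfolding sub_def using theI'[OF ex] assms by simp
  then show "sub f g \<in> Arr C" "Dom C (sub f g) = Dom C g" "Cod C (sub f g) = Cod C g" "add (sub f g) g = f"
    by auto
  then show "h \<in> Arr C \<Longrightarrow> Dom C h = Dom C g \<Longrightarrow> Cod C h = Cod C g \<Longrightarrow> add h g = f \<Longrightarrow> sub f g = h"
    using ex by auto
qed

declare sub_props(1-3) [simp]

lemma sub_nul:
  assumes "f \<in> Arr C" "g \<in> Arr C" "Dom C f = Dom C g" "Cod C f = Cod C g"
  shows "sub f g = nul (Dom C g) (Cod C g) \<longleftrightarrow> f = g"
  using sub_props[OF assms] assms by (metis add_nul(2) dom_cod_Obj nul_simps)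

lemma sub_self [simp]: "f \<in> Arr C \<Longrightarrow> sub f f = nul (Dom C f) (Cod C f)"
  by (simp add: sub_nul)

lemma sub_nul_right [simp]: "f \<in> Arr C \<Longrightarrow> Dom C f = A \<Longrightarrow> Cod C f = B \<Longrightarrow> sub f (nul A B) = f"
  by (rule sub_props(5)) auto

lemma comp_sub:
  assumes "f \<in> Arr C" "g \<in> Arr C" "Dom C f = Dom C g" "Cod C f = Cod C g" "h \<in> Arr C"
  shows "Dom C h = Cod C g \<Longrightarrow> h \<cdot> sub f g = sub (h \<cdot> f) (h \<cdot> g)"
    "Cod C h = Dom C g \<Longrightarrow> sub f g \<cdot> h = sub (f \<cdot> h) (g \<cdot> h)"
proof -
  assume a: "Dom C h = Cod C g"
  have "sub (h \<cdot> f) (h \<cdot> g) = h \<cdot> sub f g"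
    by (rule sub_props(5)) (use assms a comp_add(1)[of "sub f g" g h] in \<open>auto simp: sub_props(4)\<close>)
  then show "h \<cdot> sub f g = sub (h \<cdot> f) (h \<cdot> g)" by simp
next
  assume a: "Cod C h = Dom C g"
  have "sub (f \<cdot> h) (g \<cdot> h) = sub f g \<cdot> h"
    by (rule sub_props(5)) (use assms a comp_add(2)[of "sub f g" g h] in \<open>auto simp: sub_props(4)\<close>)
  then show "sub f g \<cdot> h = sub (f \<cdot> h) (g \<cdot> h)" by simp
qed

lemma zero_object_nul:
  assumes "zero_object C Z" "f \<in> Arr C" "Dom C f = Z \<or> Cod C f = Z"
  shows "f = nul (Dom C f) (Cod C f)"
  using zero_object_unique[OF assms(1), of f "nul (Dom C f) (Cod C f)"] assms by auto

lemma zero_arrow_iff: "zero_arrow C f \<longleftrightarrow> f \<in> Arr C \<and> f = nul (Dom C f) (Cod C f)"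
proof
  assume "zero_arrow C f"
  then obtain Z u v where h: "f \<in> Arr C" "zero_object C Z" "u \<in> Hom C (Dom C f) Z"
      "v \<in> Hom C Z (Cod C f)" "f = v \<cdot> u"
    unfolding zero_arrow_def by blast
  then have "v = nul Z (Cod C f)" using zero_object_nul by (metis Hom_iff)
  then show "f \<in> Arr C \<and> f = nul (Dom C f) (Cod C f)"
    using h comp_nul(2)[of u "Cod C f" Z] by (metis Hom_iff dom_cod_Obj(2))
next
  assume a: "f \<in> Arr C \<and> f = nul (Dom C f) (Cod C f)"
  obtain Z where Z: "zero_object C Z" using zero_ex by blast
  note [simp] = zero_object_Obj[OF Z]
  have "nul (Dom C f) (Cod C f) = nul Z (Cod C f) \<cdot> nul (Dom C f) Z"
    using conjunct1[OF a] by simp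
  then have "f = nul Z (Cod C f) \<cdot> nul (Dom C f) Z" using a by metis
  then show "zero_arrow C f"
    unfolding zero_arrow_def using Z a
    by (intro conjI exI[of _ Z] exI[of _ "nul (Dom C f) Z"] exI[of _ "nul Z (Cod C f)"])
      (simp_all only: Hom_iff nul_simps dom_cod_Obj zero_object_Obj)
qed

lemma zero_objectI:
  assumes "A \<in> Obj C" "Ident C A = nul A A"
  shows "zero_object C A"
proof -
  have 1: "f = nul A (Cod C f)" if "f \<in> Arr C" "Dom C f = A" for f
  proof -
    have "f = f \<cdot> Ident C A" using that by simp
    also have "\<dots> = nul A (Cod C f)" using that assms by (simp del: comp_Ident)
    finally show ?thesis .
  qed
  have 2: "f = nul (Dom C f) A" if "f \<in> Arr C" "Cod C f = A" for f
  proof -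
    have "f = Ident C A \<cdot> f" using that by simp
    also have "\<dots> = nul (Dom C f) A" using that assms by (simp del: comp_Ident)
    finally show ?thesis .
  qed
  show ?thesis
    unfolding zero_object_def
  proof (intro conjI ballI)
    fix B assume B: "B \<in> Obj C"
    show "\<exists>!f. f \<in> Hom C A B" by (rule ex1I[of _ "nul A B"]) (use 1 B assms in auto)
    show "\<exists>!f. f \<in> Hom C B A" by (rule ex1I[of _ "nul B A"]) (use 2 B assms in auto)
  qed fact
qed

lemma monoI:
  assumes "m \<in> Arr C"
    and "\<And>u. u \<in> Arr C \<Longrightarrow> Cod C u = Dom C m \<Longrightarrow> m \<cdot> u = nul (Dom C u) (Cod C m) \<Longrightarrow>
      u = nul (Dom C u) (Dom C m)"
  shows "is_mono C m"
  unfolding is_mono_def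
proof (intro conjI ballI impI)
  fix A u v assume h: "A \<in> Obj C" "u \<in> Hom C A (Dom C m)" "v \<in> Hom C A (Dom C m)" "m \<cdot> u = m \<cdot> v"
  then have "m \<cdot> sub u v = nul A (Cod C m)" using assms(1) by (simp add: comp_sub sub_nul)
  then show "u = v" using assms(2)[of "sub u v"] h sub_nul[of u v] by simp
qed fact

lemma epiI:
  assumes "p \<in> Arr C"
    and "\<And>u. u \<in> Arr C \<Longrightarrow> Dom C u = Cod C p \<Longrightarrow> u \<cdot> p = nul (Dom C p) (Cod C u) \<Longrightarrow>
      u = nul (Cod C p) (Cod C u)"
  shows "is_epi C p"
  unfolding is_epi_def
proof (intro conjI ballI impI)
  fix B u v assume h: "B \<in> Obj C" "u \<in> Hom C (Cod C p) B" "v \<in> Hom C (Cod C p) B" "u \<cdot> p = v \<cdot> p"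
  then have "sub u v \<cdot> p = nul (Dom C p) B" using assms(1) by (simp add: comp_sub sub_nul)
  then show "u = v" using assms(2)[of "sub u v"] h sub_nul[of u v] by simp
qed fact

lemma mono_nul:
  "is_mono C m \<Longrightarrow> u \<in> Arr C \<Longrightarrow> Cod C u = Dom C m \<Longrightarrow> m \<cdot> u = nul (Dom C u) (Cod C m) \<Longrightarrow>
    u = nul (Dom C u) (Dom C m)"
  by (rule mono_cancel) (auto simp: mono_Arr)

lemma epi_nul:
  "is_epi C p \<Longrightarrow> u \<in> Arr C \<Longrightarrow> Dom C u = Cod C p \<Longrightarrow> u \<cdot> p = nul (Dom C p) (Cod C u) \<Longrightarrow>
    u = nul (Cod C p) (Cod C u)"
  by (rule epi_cancel) (auto simp: epi_Arr)

lemma is_kernelI: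
  assumes "f \<in> Arr C" "is_mono C k" "Cod C k = Dom C f" "f \<cdot> k = nul (Dom C k) (Cod C f)"
    and "\<And>h. h \<in> Arr C \<Longrightarrow> Cod C h = Dom C f \<Longrightarrow> f \<cdot> h = nul (Dom C h) (Cod C f) \<Longrightarrow>
      \<exists>u. u \<in> Arr C \<and> Dom C u = Dom C h \<and> Cod C u = Dom C k \<and> k \<cdot> u = h"
  shows "is_kernel C f k"
proof -
  have k: "k \<in> Arr C" using assms mono_Arr by blast
  have "\<exists>!u. u \<in> Hom C (Dom C h) (Dom C k) \<and> k \<cdot> u = h"
    if h: "h \<in> Arr C" "Cod C h = Dom C f" "zero_arrow C (f \<cdot> h)" for h
  proof -
    have "f \<cdot> h = nul (Dom C h) (Cod C f)" using h assms(1) by (auto simp: zero_arrow_iff)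
    then obtain u where "u \<in> Arr C" "Dom C u = Dom C h" "Cod C u = Dom C k" "k \<cdot> u = h"
      using assms(5) h by blast
    then show ?thesis
      by (intro ex1I[of _ u]) (auto intro: mono_cancel[OF assms(2)])
  qed
  then show ?thesis
    unfolding is_kernel_def using assms k by (auto simp: zero_arrow_iff)
qed

lemma is_kernelD:
  assumes "is_kernel C f k"
  shows "f \<in> Arr C" "k \<in> Arr C" "Cod C k = Dom C f" "f \<cdot> k = nul (Dom C k) (Cod C f)" "is_mono C k"
proof -
  show 1: "f \<in> Arr C" "k \<in> Arr C" "Cod C k = Dom C f" using assms unfolding is_kernel_def by auto
  have "zero_arrow C (f \<cdot> k)" using assms unfolding is_kernel_def by auto
  then show 2: "f \<cdot> k = nul (Dom C k) (Cod C f)" using 1 by (simp add: zero_arrow_iff)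
  show "is_mono C k"
    unfolding is_mono_def
  proof (intro conjI ballI impI)
    fix A u v assume h: "A \<in> Obj C" "u \<in> Hom C A (Dom C k)" "v \<in> Hom C A (Dom C k)" "k \<cdot> u = k \<cdot> v"
    have "f \<cdot> k \<cdot> u = nul (Dom C u) (Cod C f)"
      using comp_whisker[OF 2, of u] 1 h by simp
    then have "zero_arrow C (f \<cdot> k \<cdot> u)"
      using h 1 by (simp add: zero_arrow_iff)
    then have "\<exists>!w. w \<in> Hom C (Dom C (k \<cdot> u)) (Dom C k) \<and> k \<cdot> w = k \<cdot> u"
      using assms(1)[unfolded is_kernel_def, THEN conjunct2, THEN conjunct2, THEN conjunct2, THEN conjunct2,
          rule_format, of "k \<cdot> u"] h 1 by simp
    then show "u = v" using h 1 by (metis Hom_iff comp_simps(2))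
  qed (rule 1)
qed

lemma is_kernel_factor:
  assumes "is_kernel C f k" "h \<in> Arr C" "Cod C h = Dom C f" "f \<cdot> h = nul (Dom C h) (Cod C f)"
  obtains u where "u \<in> Arr C" "Dom C u = Dom C h" "Cod C u = Dom C k" "k \<cdot> u = h"
proof -
  have "zero_arrow C (f \<cdot> h)" using assms is_kernelD[OF assms(1)] by (simp add: zero_arrow_iff)
  then have "\<exists>u. u \<in> Hom C (Dom C h) (Dom C k) \<and> k \<cdot> u = h"
    using assms(1)[unfolded is_kernel_def, THEN conjunct2, THEN conjunct2, THEN conjunct2, THEN conjunct2,
          rule_format, OF assms(2,3)] by blast
  then show thesis using that by auto
qed

lemma is_cokernelI:
  assumes "f \<in> Arr C" "is_epi C c" "Dom C c = Cod C f" "c \<cdot> f = nul (Dom C f) (Cod C c)"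
    and "\<And>h. h \<in> Arr C \<Longrightarrow> Dom C h = Cod C f \<Longrightarrow> h \<cdot> f = nul (Dom C f) (Cod C h) \<Longrightarrow>
      \<exists>u. u \<in> Arr C \<and> Dom C u = Cod C c \<and> Cod C u = Cod C h \<and> u \<cdot> c = h"
  shows "is_cokernel C f c"
proof -
  have k: "c \<in> Arr C" using assms epi_Arr by blast
  have "\<exists>!u. u \<in> Hom C (Cod C c) (Cod C h) \<and> u \<cdot> c = h"
    if h: "h \<in> Arr C" "Dom C h = Cod C f" "zero_arrow C (h \<cdot> f)" for h
  proof -
    have "h \<cdot> f = nul (Dom C f) (Cod C h)" using h assms(1) by (auto simp: zero_arrow_iff)
    then obtain u where "u \<in> Arr C" "Dom C u = Cod C c" "Cod C u = Cod C h" "u \<cdot> c = h"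
      using assms(5) h by blast
    then show ?thesis
      by (intro ex1I[of _ u]) (auto intro: epi_cancel[OF assms(2)])
  qed
  then show ?thesis
    unfolding is_cokernel_def using assms k by (auto simp: zero_arrow_iff)
qed

lemma is_cokernelD:
  assumes "is_cokernel C f c"
  shows "f \<in> Arr C" "c \<in> Arr C" "Dom C c = Cod C f" "c \<cdot> f = nul (Dom C f) (Cod C c)" "is_epi C c"
proof -
  show 1: "f \<in> Arr C" "c \<in> Arr C" "Dom C c = Cod C f" using assms unfolding is_cokernel_def by auto
  have "zero_arrow C (c \<cdot> f)" using assms unfolding is_cokernel_def by auto
  then show 2: "c \<cdot> f = nul (Dom C f) (Cod C c)" using 1 by (simp add: zero_arrow_iff)
  show "is_epi C c"
    unfolding is_epi_def
  proof (intro conjI ballI impI)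
    fix B u v assume h: "B \<in> Obj C" "u \<in> Hom C (Cod C c) B" "v \<in> Hom C (Cod C c) B" "u \<cdot> c = v \<cdot> c"
    have "(u \<cdot> c) \<cdot> f = nul (Dom C f) (Cod C u)"
      using 1 2 h by simp
    then have "zero_arrow C ((u \<cdot> c) \<cdot> f)"
      using h 1 by (simp add: zero_arrow_iff)
    then have "\<exists>!w. w \<in> Hom C (Cod C c) (Cod C (u \<cdot> c)) \<and> w \<cdot> c = u \<cdot> c"
      using assms(1)[unfolded is_cokernel_def, THEN conjunct2, THEN conjunct2, THEN conjunct2, THEN conjunct2,
          rule_format, of "u \<cdot> c"] h 1 by simp
    then show "u = v" using h 1 by (metis Hom_iff comp_simps(3))
  qed (rule 1)
qed

lemma is_cokernel_factor:
  assumes "is_cokernel C f c" "h \<in> Arr C" "Dom C h = Cod C f" "h \<cdot> f = nul (Dom C f) (Cod C h)"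
  obtains u where "u \<in> Arr C" "Dom C u = Cod C c" "Cod C u = Cod C h" "u \<cdot> c = h"
proof -
  have "zero_arrow C (h \<cdot> f)" using assms is_cokernelD[OF assms(1)] by (simp add: zero_arrow_iff)
  then have "\<exists>u. u \<in> Hom C (Cod C c) (Cod C h) \<and> u \<cdot> c = h"
    using assms(1)[unfolded is_cokernel_def, THEN conjunct2, THEN conjunct2, THEN conjunct2, THEN conjunct2,
          rule_format, OF assms(2,3)] by blast
  then show thesis using that by auto
qed

end

section \<open>Abelian categories\<close>

locale abelian_cat = preadditive_cat +
  assumes abelian: "abelian C"

lemma abelian_cat_ex: "abelian C \<Longrightarrow> \<exists>add. abelian_cat C add"
  unfolding abelian_cat_def abelian_cat_axioms_def preadditive_cat_def preadditive_cat_axioms_def category_loc_def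
  by (auto simp: abelian_def preadditive_def)

context abelian_cat
begin

lemma kernel_ex:
  assumes "f \<in> Arr C" obtains k where "is_kernel C f k"
  using abelian assms unfolding abelian_def by blast

lemma cokernel_ex:
  assumes "f \<in> Arr C" obtains c where "is_cokernel C f c"
  using abelian assms unfolding abelian_def by blast

text \<open>
  A monomorphism is the kernel of some \<open>f\<close>, and \<open>f\<close> factors through its cokernel \<open>c\<close>; so what \<open>c\<close>
  kills is killed by \<open>f\<close>.  The next lemma is dual.
\<close>

lemma mono_is_kernel_of_cokernel:
  assumes "is_mono C m" "is_cokernel C m c"
  shows "is_kernel C c m"
proof -
  note c = is_cokernelD[OF assms(2)]
  obtain f where f: "is_kernel C f m" using abelian assms(1) unfolding abelian_def by blast
  note f' = is_kernelD[OF f]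
  obtain g where g: "g \<in> Arr C" "Dom C g = Cod C c" "Cod C g = Cod C f" "g \<cdot> c = f"
    using is_cokernel_factor[OF assms(2), of f] f' by auto
  show ?thesis
  proof (rule is_kernelI)
    fix h assume h: "h \<in> Arr C" "Cod C h = Dom C c" "c \<cdot> h = nul (Dom C h) (Cod C c)"
    then have "f \<cdot> h = nul (Dom C h) (Cod C f)"
      using g c comp_assoc[of h c g] by simp
    then show "\<exists>u. u \<in> Arr C \<and> Dom C u = Dom C h \<and> Cod C u = Dom C m \<and> m \<cdot> u = h"
      using is_kernel_factor[OF f, of h] h c f' by metis
  qed (use c assms in auto)
qed

lemma epi_is_cokernel_of_kernel:
  assumes "is_epi C p" "is_kernel C p k"
  shows "is_cokernel C k p"
proof -
  note k = is_kernelD[OF assms(2)]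
  obtain f where f: "is_cokernel C f p" using abelian assms(1) unfolding abelian_def by blast
  note f' = is_cokernelD[OF f]
  obtain g where g: "g \<in> Arr C" "Cod C g = Dom C k" "Dom C g = Dom C f" "k \<cdot> g = f"
    using is_kernel_factor[OF assms(2), of f] f' by auto
  show ?thesis
  proof (rule is_cokernelI)
    fix h assume h: "h \<in> Arr C" "Dom C h = Cod C k" "h \<cdot> k = nul (Dom C k) (Cod C h)"
    then have "h \<cdot> f = nul (Dom C f) (Cod C h)"
      using g k comp_assoc[of g k h] by simp
    then show "\<exists>u. u \<in> Arr C \<and> Dom C u = Cod C p \<and> Cod C u = Cod C h \<and> u \<cdot> p = h"
      using is_cokernel_factor[OF f, of h] h k f' by metis
  qed (use k assms in auto)
qed

definition image_factorization where
  "image_factorization f m e c \<longleftrightarrow> is_cokernel C f c \<and> is_kernel C c m \<and> is_cokernel C m c \<and> is_mono C m \<and>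
    is_epi C e \<and> Dom C e = Dom C f \<and> Cod C e = Dom C m \<and> m \<cdot> e = f"

lemma image_factorizationD:
  assumes "image_factorization f m e c"
  shows "is_cokernel C f c" "is_kernel C c m" "is_cokernel C m c" "is_mono C m" "is_epi C e"
    "m \<in> Arr C" "e \<in> Arr C" "Dom C e = Dom C f" "Cod C e = Dom C m" "Cod C m = Cod C f" "m \<cdot> e = f"
  using assms is_kernelD(2,3)[of c m] is_cokernelD(3)[of f c] epi_Arr[of e] by (auto simp: image_factorization_def)

text \<open>
  If \<open>w\<close> kills the corestriction \<open>e\<close> of \<open>f\<close> to its image \<open>m\<close>, then \<open>f\<close>
  factors through \<open>m\<close> restricted to the kernel of \<open>w\<close>, and the cokernel of this smaller subobject
  factors through that of \<open>f\<close>; so the smaller subobject is all of \<open>m\<close> and \<open>w = 0\<close>.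
\<close>

lemma image_factor:
  assumes f: "f \<in> Arr C"
  obtains m e c where "image_factorization f m e c"
proof -
  obtain c where c: "is_cokernel C f c" using cokernel_ex[OF f] .
  note c' [simp] = is_cokernelD[OF c]
  obtain m where m: "is_kernel C c m" using kernel_ex[OF c'(2)] .
  note m' [simp] = is_kernelD[OF m]
  obtain e where e [simp]: "e \<in> Arr C" "Dom C e = Dom C f" "Cod C e = Dom C m" and fe: "m \<cdot> e = f"
    using is_kernel_factor[OF m f] by auto
  have "is_epi C e"
  proof (rule epiI)
    fix w assume w [simp]: "w \<in> Arr C" "Dom C w = Cod C e" and we: "w \<cdot> e = nul (Dom C e) (Cod C w)"
    obtain k where k: "is_kernel C w k" using kernel_ex[OF w(1)] .
    note k' [simp] = is_kernelD[OF k]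
    obtain e' where e' [simp]: "e' \<in> Arr C" "Dom C e' = Dom C e" "Cod C e' = Dom C k" and ke: "k \<cdot> e' = e"
      using is_kernel_factor[OF k, of e] we by auto
    have mk: "is_mono C (m \<cdot> k)" by (rule mono_comp) auto
    obtain d where d: "is_cokernel C (m \<cdot> k) d" using cokernel_ex[of "m \<cdot> k"] by auto
    note d' [simp] = is_cokernelD[OF d]
    have dc: "Dom C d = Cod C f" using d'(3) by simp
    have "d \<cdot> m \<cdot> k = nul (Dom C k) (Cod C d)" using d'(4) by simp
    then have "(d \<cdot> m \<cdot> k) \<cdot> e' = nul (Dom C e') (Cod C d)" by simp
    then have "d \<cdot> f = nul (Dom C f) (Cod C d)"
      using dc ke fe by (simp del: d'(4))
    then obtain x where x [simp]: "x \<in> Arr C" "Dom C x = Cod C c" "Cod C x = Cod C d" and xc: "x \<cdot> c = d"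
      using is_cokernel_factor[OF c, of d] dc by auto
    have "(x \<cdot> c) \<cdot> m = nul (Dom C m) (Cod C d)" by (simp add: m'(4))
    then have "d \<cdot> m = nul (Dom C m) (Cod C d)" by (simp only: xc)
    then obtain y where y [simp]: "y \<in> Arr C" "Dom C y = Dom C m" "Cod C y = Dom C k" and ym: "(m \<cdot> k) \<cdot> y = m"
      using is_kernel_factor[OF mono_is_kernel_of_cokernel[OF mk d], of m] dc by auto
    have "m \<cdot> (k \<cdot> y) = m \<cdot> Ident C (Dom C m)" using ym by simp
    then have ky: "k \<cdot> y = Ident C (Dom C m)"
      by (rule mono_cancel[OF m'(5)]) auto
    have "w = w \<cdot> (k \<cdot> y)" by (simp add: ky)
    also have "\<dots> = nul (Cod C e) (Cod C w)" using comp_whisker[OF k'(4), of y] by simp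
    finally show "w = nul (Cod C e) (Cod C w)" .
  qed simp
  moreover have "is_cokernel C m c"
    by (rule epi_is_cokernel_of_kernel[OF c'(5) m])
  ultimately have "image_factorization f m e c" using c m m'(5) fe by (simp add: image_factorization_def)
  then show thesis by (rule that)
qed

text \<open>
  With \<open>m e\<close> an image factorization of \<open>f\<close>, this transfers a kernel from \<open>f\<close> to the epimorphism \<open>e\<close>,
  which is then its cokernel.
\<close>

lemma kernel_of_mono_comp:
  assumes "is_kernel C f k" "f = m \<cdot> e" "is_mono C m" "e \<in> Arr C" "Cod C e = Dom C m"
  shows "is_kernel C e k"
proof (rule is_kernelI)
  note [simp] = is_kernelD[OF assms(1)] mono_Arr[OF assms(3)] assms(4,5)
  have d: "Dom C f = Dom C e" "Cod C f = Cod C m" using assms(2) by auto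
  show "is_mono C k" "Cod C k = Dom C e" using d by auto
  have "m \<cdot> e \<cdot> k = nul (Dom C k) (Cod C m)"
    using is_kernelD(4)[OF assms(1)] d assms(2) by simp
  then show "e \<cdot> k = nul (Dom C k) (Cod C e)"
    using mono_nul[OF assms(3), of "e \<cdot> k"] d by simp
  fix h assume h: "h \<in> Arr C" "Cod C h = Dom C e" "e \<cdot> h = nul (Dom C h) (Cod C e)"
  have "f \<cdot> h = m \<cdot> e \<cdot> h" using assms(2) h by simp
  also have "\<dots> = nul (Dom C h) (Cod C f)" using h d by simp
  finally show "\<exists>u. u \<in> Arr C \<and> Dom C u = Dom C h \<and> Cod C u = Dom C k \<and> k \<cdot> u = h"
    using is_kernel_factor[OF assms(1), of h] h d by metis
qed fact

lemma kernels_iso: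
  assumes "is_kernel C f k" "is_kernel C f k'"
  obtains u where "is_mono C u" "Dom C u = Dom C k" "Cod C u = Dom C k'"
proof -
  note [simp] = is_kernelD[OF assms(1)] is_kernelD[OF assms(2)]
  obtain u where u: "u \<in> Arr C" "Dom C u = Dom C k" "Cod C u = Dom C k'" "k' \<cdot> u = k"
    using is_kernel_factor[OF assms(2), of k] by auto
  then have "is_mono C u" using mono_right[of k' u] by simp
  then show thesis using that u by auto
qed

lemma cokernels_iso:
  assumes "is_cokernel C f k" "is_cokernel C f k'"
  obtains u where "is_epi C u" "Dom C u = Cod C k'" "Cod C u = Cod C k"
proof -
  note [simp] = is_cokernelD[OF assms(1)] is_cokernelD[OF assms(2)]
  obtain u where u: "u \<in> Arr C" "Dom C u = Cod C k'" "Cod C u = Cod C k" "u \<cdot> k' = k"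
    using is_cokernel_factor[OF assms(2), of k] by auto
  then have "is_epi C u" using epi_left[of u k'] by simp
  then show thesis using that u by auto
qed

lemma mono_kernel_zero:
  assumes "is_mono C m" "is_kernel C m k"
  shows "zero_object C (Dom C k)"
proof (rule zero_objectI)
  note [simp] = is_kernelD[OF assms(2)]
  have "k = nul (Dom C k) (Cod C k)"
    using mono_nul[OF assms(1), of k] by simp
  then have "k \<cdot> Ident C (Dom C k) = k \<cdot> nul (Dom C k) (Dom C k)" by simp
  then show "Ident C (Dom C k) = nul (Dom C k) (Dom C k)"
    by (rule mono_cancel[OF is_kernelD(5)[OF assms(2)]]) auto
qed (use is_kernelD[OF assms(2)] in simp)

lemma epi_cokernel_zero:
  assumes "is_epi C p" "is_cokernel C p c"
  shows "zero_object C (Cod C c)"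
proof (rule zero_objectI)
  note [simp] = is_cokernelD[OF assms(2)]
  have "c = nul (Dom C c) (Cod C c)"
    using epi_nul[OF assms(1), of c] by simp
  then have "Ident C (Cod C c) \<cdot> c = nul (Cod C c) (Cod C c) \<cdot> c" by simp
  then show "Ident C (Cod C c) = nul (Cod C c) (Cod C c)"
    by (rule epi_cancel[OF is_cokernelD(5)[OF assms(2)]]) auto
qed (use is_cokernelD[OF assms(2)] in simp)

lemma biproduct_ex:
  assumes "A \<in> Obj C" "B \<in> Obj C"
  obtains P i j p q where "is_binary_coproduct C A B P i j" "P \<in> Obj C"
    "i \<in> Arr C" "Dom C i = A" "Cod C i = P" "j \<in> Arr C" "Dom C j = B" "Cod C j = P"
    "p \<in> Arr C" "Dom C p = P" "Cod C p = A" "q \<in> Arr C" "Dom C q = P" "Cod C q = B"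
    "p \<cdot> i = Ident C A" "p \<cdot> j = nul B A" "q \<cdot> i = nul A B" "q \<cdot> j = Ident C B"
    "add (i \<cdot> p) (j \<cdot> q) = Ident C P"
proof -
  obtain P i j where c: "is_binary_coproduct C A B P i j"
    using abelian assms unfolding abelian_def by blast
  note c' = c[unfolded is_binary_coproduct_def]
  have PO [simp]: "P \<in> Obj C" using coproductD[OF c'] by simp
  have ij [simp]: "i \<in> Arr C" "Dom C i = A" "Cod C i = P" "j \<in> Arr C" "Dom C j = B" "Cod C j = P"
    using coproductD(2-4)[OF c', of True] coproductD(2-4)[OF c', of False] by auto
  obtain p where p [simp]: "p \<in> Arr C" "Dom C p = P" "Cod C p = A" and
    p': "\<And>b. p \<cdot> (case_bool i j b) = (case_bool (Ident C A) (nul B A) b)"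
    by (rule coproduct_ex[OF c', of "case_bool (Ident C A) (nul B A)" A]) (use assms in \<open>auto split: bool.splits\<close>)
  obtain q where q [simp]: "q \<in> Arr C" "Dom C q = P" "Cod C q = B" and
    q': "\<And>b. q \<cdot> (case_bool i j b) = (case_bool (nul A B) (Ident C B) b)"
    by (rule coproduct_ex[OF c', of "case_bool (nul A B) (Ident C B)" B]) (use assms in \<open>auto split: bool.splits\<close>)
  have pq [simp]: "p \<cdot> i = Ident C A" "p \<cdot> j = nul B A" "q \<cdot> i = nul A B" "q \<cdot> j = Ident C B"
    using p'[of True] p'[of False] q'[of True] q'[of False] by auto
  have "add (i \<cdot> p) (j \<cdot> q) = Ident C P"
  proof (rule coproduct_eq[OF c'])
    fix b :: bool
    show "add (i \<cdot> p) (j \<cdot> q) \<cdot> (case_bool i j b) = Ident C P \<cdot> (case_bool i j b)"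
      using assms by (cases b) (auto simp: comp_add)
  qed auto
  then show thesis using that[OF c PO ij p q pq] by blast
qed

text \<open>
  The pullback of \<open>e\<close> along \<open>f\<close> is constructed as the kernel of \<open>f p - e q\<close> on the biproduct.  The
  projection \<open>p1\<close> is again epic because \<open>f p - e q\<close> is epic, hence the cokernel of its kernel; and \<open>p2\<close>
  carries the kernel of \<open>p1\<close> isomorphically onto that of \<open>e\<close>.
\<close>

lemma pullback_epi:
  assumes e: "is_epi C e" and k: "is_kernel C e k" and f: "f \<in> Arr C" "Cod C f = Cod C e"
  obtains p1 p2 k' where "p1 \<in> Arr C" "p2 \<in> Arr C" "Dom C p2 = Dom C p1" "Cod C p1 = Dom C f"
    "Cod C p2 = Dom C e" "f \<cdot> p1 = e \<cdot> p2" "is_epi C p1" "is_kernel C p1 k'" "Dom C k' = Dom C k" "p2 \<cdot> k' = k"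
proof -
  note [simp] = epi_Arr[OF e] is_kernelD[OF k] f
  obtain P i j p q where P: "P \<in> Obj C"
    "i \<in> Arr C" "Dom C i = Dom C f" "Cod C i = P" "j \<in> Arr C" "Dom C j = Dom C e" "Cod C j = P"
    "p \<in> Arr C" "Dom C p = P" "Cod C p = Dom C f" "q \<in> Arr C" "Dom C q = P" "Cod C q = Dom C e"
    "p \<cdot> i = Ident C (Dom C f)" "p \<cdot> j = nul (Dom C e) (Dom C f)" "q \<cdot> i = nul (Dom C f) (Dom C e)"
    "q \<cdot> j = Ident C (Dom C e)" "add (i \<cdot> p) (j \<cdot> q) = Ident C P"
    using biproduct_ex[of "Dom C f" "Dom C e"] by (metis dom_cod_Obj(1) f(1) \<open>e \<in> Arr C\<close>)
  note [simp] = P(1-17)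
  define d where "d = sub (f \<cdot> p) (e \<cdot> q)"
  have d [simp]: "d \<in> Arr C" "Dom C d = P" "Cod C d = Cod C e" unfolding d_def by auto
  have dj: "d \<cdot> j = sub (nul (Dom C e) (Cod C e)) e"
    unfolding d_def by (simp add: comp_sub)
  \<comment> \<open>Restricted to the second summand, \<open>d\<close> is \<open>-e\<close>.\<close>
  have depi: "x = nul (Cod C e) (Cod C x)"
    if x: "x \<in> Arr C" "Dom C x = Cod C e" "x \<cdot> (d \<cdot> j) = nul (Dom C e) (Cod C x)" for x
  proof (rule epi_nul[OF e])
    have "sub (nul (Dom C e) (Cod C x)) (x \<cdot> e) = nul (Dom C e) (Cod C x)"
      using x by (simp add: dj comp_sub)
    then show "x \<cdot> e = nul (Dom C e) (Cod C x)"
      using sub_nul[of "nul (Dom C e) (Cod C x)" "x \<cdot> e"] x by simp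
  qed (use x in auto)
  have epid: "is_epi C d"
  proof (rule epiI)
    fix x assume x: "x \<in> Arr C" "Dom C x = Cod C d" "x \<cdot> d = nul (Dom C d) (Cod C x)"
    have "x \<cdot> (d \<cdot> j) = (x \<cdot> d) \<cdot> j" using x(1,2) by simp
    also have "\<dots> = nul (Dom C e) (Cod C x)" using x by (simp del: comp_assoc)
    finally show "x = nul (Cod C d) (Cod C x)" using depi[of x] x by simp
  qed simp
  obtain l where l: "is_kernel C d l" using kernel_ex[OF d(1)] .
  note [simp] = is_kernelD(1-3,5)[OF l]
  have Cl [simp]: "Cod C l = P" by simp
  define p1 where "p1 = p \<cdot> l"
  define p2 where "p2 = q \<cdot> l"
  have pp [simp]: "p1 \<in> Arr C" "p2 \<in> Arr C" "Dom C p2 = Dom C l" "Dom C p1 = Dom C l" "Cod C p1 = Dom C f"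
    "Cod C p2 = Dom C e"
    unfolding p1_def p2_def by auto
  have joint: "u = v" if "u \<in> Arr C" "v \<in> Arr C" "Dom C u = Dom C v" "Cod C u = P" "Cod C v = P"
    "p \<cdot> u = p \<cdot> v" "q \<cdot> u = q \<cdot> v" for u v
  proof -
    have *: "add (i \<cdot> p \<cdot> w) (j \<cdot> q \<cdot> w) = w" if "w \<in> Arr C" "Cod C w = P" for w
    proof -
      have "add (i \<cdot> p \<cdot> w) (j \<cdot> q \<cdot> w) = add (i \<cdot> p) (j \<cdot> q) \<cdot> w"
        using that by (simp add: comp_add(2))
      then show ?thesis using that P(18) by simp
    qed
    have "add (i \<cdot> p \<cdot> u) (j \<cdot> q \<cdot> u) = add (i \<cdot> p \<cdot> v) (j \<cdot> q \<cdot> v)" using that(6,7) by simp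
    then show ?thesis by (simp only: *[OF that(1,4)] *[OF that(2,5)])
  qed
  have dl: "d \<cdot> l = sub (f \<cdot> p \<cdot> l) (e \<cdot> q \<cdot> l)"
    unfolding d_def by (simp add: comp_sub)
  have "sub (f \<cdot> p \<cdot> l) (e \<cdot> q \<cdot> l) = nul (Dom C (e \<cdot> q \<cdot> l)) (Cod C (e \<cdot> q \<cdot> l))"
    using is_kernelD(4)[OF l] unfolding dl by simp
  then have "f \<cdot> p \<cdot> l = e \<cdot> q \<cdot> l"
    by (subst (asm) sub_nul) simp_all
  then have sq: "f \<cdot> p1 = e \<cdot> p2" unfolding p1_def p2_def .
  have epi: "is_epi C p1"
  proof (rule epiI)
    fix x assume x: "x \<in> Arr C" "Dom C x = Cod C p1" "x \<cdot> p1 = nul (Dom C p1) (Cod C x)"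
    have "(x \<cdot> p) \<cdot> l = nul (Dom C l) (Cod C x)" using x unfolding p1_def by simp
    then obtain y where y: "y \<in> Arr C" "Dom C y = Cod C d" "Cod C y = Cod C x" "y \<cdot> d = x \<cdot> p"
      using is_cokernel_factor[OF epi_is_cokernel_of_kernel[OF epid l], of "x \<cdot> p"] x by auto
    have "y \<cdot> (d \<cdot> j) = (x \<cdot> p) \<cdot> j" using y(1-3) x(1,2) by (simp flip: y(4))
    then have "y = nul (Cod C e) (Cod C x)" using depi[of y] y x by simp
    then have "x \<cdot> p = nul P (Cod C x)" using y x by simp
    then have "(x \<cdot> p) \<cdot> i = nul (Dom C f) (Cod C x)" using x by (simp del: comp_assoc)
    then show "x = nul (Cod C p1) (Cod C x)" using x by simp
  qed simp
  have "d \<cdot> (j \<cdot> k) = (d \<cdot> j) \<cdot> k" by simp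
  also have "\<dots> = nul (Dom C k) (Cod C d)"
    unfolding dj by (simp add: comp_sub is_kernelD(4)[OF k])
  finally obtain k' where k' [simp]: "k' \<in> Arr C" "Dom C k' = Dom C k" "Cod C k' = Dom C l" and lk: "l \<cdot> k' = j \<cdot> k"
    using is_kernel_factor[OF l, of "j \<cdot> k"] by auto
  have p1k: "p1 \<cdot> k' = nul (Dom C k) (Dom C f)" unfolding p1_def using comp_whisker[OF P(15), of k]
    by (simp add: lk)
  have p2k: "p2 \<cdot> k' = k" unfolding p2_def using comp_whisker[OF P(17), of k] by (simp add: lk)
  have "is_kernel C p1 k'"
  proof (rule is_kernelI)
    show "is_mono C k'" by (rule mono_right[of p2]) (auto simp: p2k)
    fix h assume h: "h \<in> Arr C" "Cod C h = Dom C p1" "p1 \<cdot> h = nul (Dom C h) (Cod C p1)"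
    have "e \<cdot> (p2 \<cdot> h) = (f \<cdot> p1) \<cdot> h" using h(1,2) by (simp add: sq)
    also have "\<dots> = nul (Dom C h) (Cod C e)" using h by simp
    finally obtain w where w: "w \<in> Arr C" "Dom C w = Dom C h" "Cod C w = Dom C k" "k \<cdot> w = p2 \<cdot> h"
      using is_kernel_factor[OF k, of "p2 \<cdot> h"] h by auto
    have "l \<cdot> (k' \<cdot> w) = l \<cdot> h"
    proof (rule joint)
      have "p \<cdot> (l \<cdot> (k' \<cdot> w)) = (p1 \<cdot> k') \<cdot> w" unfolding p1_def using w by simp
      also have "\<dots> = nul (Dom C h) (Dom C f)" using w by (simp only: p1k) simp
      finally show "p \<cdot> (l \<cdot> (k' \<cdot> w)) = p \<cdot> (l \<cdot> h)" using h unfolding p1_def by simp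
      have "q \<cdot> (l \<cdot> (k' \<cdot> w)) = (p2 \<cdot> k') \<cdot> w" unfolding p2_def using w by simp
      also have "\<dots> = p2 \<cdot> h" using w by (simp only: p2k)
      finally show "q \<cdot> (l \<cdot> (k' \<cdot> w)) = q \<cdot> (l \<cdot> h)" using h unfolding p2_def by simp
    qed (use w h in auto)
    then have "k' \<cdot> w = h" by (rule mono_cancel[OF is_kernelD(5)[OF l]]) (use w h in auto)
    then show "\<exists>u. u \<in> Arr C \<and> Dom C u = Dom C h \<and> Cod C u = Dom C k' \<and> k' \<cdot> u = h"
      using w by auto
  qed (auto simp: p1k)
  then show thesis using that[of p1 p2 k'] sq epi p2k by simp
qed

end

section \<open>Arrows with torsion kernel and cokernel\<close>

locale torsion_cat = abelian_cat +
  fixes \<kappa> :: "'u rel" and T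
  assumes inacc: "inaccessible \<kappa>"
    and htc: "hereditary_torsion_class \<kappa> C T"
begin

abbreviation \<Sigma> where "\<Sigma> \<equiv> torsion_isos C T"

lemma T_sub: "is_mono C m \<Longrightarrow> Cod C m \<in> T \<Longrightarrow> Dom C m \<in> T"
  using htc unfolding hereditary_torsion_class_def by blast

lemma T_quo: "is_epi C p \<Longrightarrow> Dom C p \<in> T \<Longrightarrow> Cod C p \<in> T"
  using htc unfolding hereditary_torsion_class_def by blast

lemma T_ext: "short_exact C f g \<Longrightarrow> Dom C f \<in> T \<Longrightarrow> Cod C g \<in> T \<Longrightarrow> Cod C f \<in> T"
  using htc unfolding hereditary_torsion_class_def by blast

text \<open>
  A zero object is the coproduct of the empty family.
\<close>

lemma T_zero:
  assumes "zero_object C Z" shows "Z \<in> T"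
proof -
  have "small \<kappa> ({} :: 'u set)"
  proof -
    have "|{} :: 'u set| \<le>o natLeq" by (simp add: card_of_Card_order card_of_empty1 ordLess_imp_ordLeq finite_iff_ordLess_natLeq[symmetric])
    then show ?thesis using inacc ordLeq_ordLess_trans unfolding inaccessible_def small_def by blast
  qed
  moreover have "is_coproduct C ({} :: 'u set) (\<lambda>_. Z) Z (\<lambda>_. undefined)"
    using assms by (simp add: is_coproduct_def zero_object_def)
  ultimately show ?thesis
    using htc unfolding hereditary_torsion_class_def by blast
qed

lemma Sig_Arr [simp]: "s \<in> \<Sigma> \<Longrightarrow> s \<in> Arr C"
  by (auto simp: torsion_isos_def dest: is_kernelD)

lemma SigI: "is_kernel C s k \<Longrightarrow> Dom C k \<in> T \<Longrightarrow> is_cokernel C s c \<Longrightarrow> Cod C c \<in> T \<Longrightarrow> s \<in> \<Sigma>"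
  by (auto simp: torsion_isos_def)

lemma Sig_kernel:
  assumes "s \<in> \<Sigma>" "is_kernel C s k" shows "Dom C k \<in> T"
proof -
  obtain k' where k': "is_kernel C s k'" "Dom C k' \<in> T"
    using assms unfolding torsion_isos_def by blast
  obtain u where "is_mono C u" "Dom C u = Dom C k" "Cod C u = Dom C k'"
    using kernels_iso[OF assms(2) k'(1)] .
  then show ?thesis using T_sub[of u] k' by simp
qed

lemma Sig_cokernel:
  assumes "s \<in> \<Sigma>" "is_cokernel C s c" shows "Cod C c \<in> T"
proof -
  obtain c' where c': "is_cokernel C s c'" "Cod C c' \<in> T"
    using assms unfolding torsion_isos_def by blast
  obtain u where "is_epi C u" "Dom C u = Cod C c'" "Cod C u = Cod C c"
    using cokernels_iso[OF assms(2) c'(1)] .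
  then show ?thesis using T_quo[of u] c' by simp
qed

lemma Sig_monoI:
  assumes "is_mono C m" "is_cokernel C m c" "Cod C c \<in> T" shows "m \<in> \<Sigma>"
proof -
  obtain k where "is_kernel C m k" using kernel_ex[OF mono_Arr[OF assms(1)]] .
  then show ?thesis using SigI assms T_zero mono_kernel_zero by blast
qed

lemma Sig_epiI:
  assumes "is_epi C p" "is_kernel C p k" "Dom C k \<in> T" shows "p \<in> \<Sigma>"
proof -
  obtain c where "is_cokernel C p c" using cokernel_ex[OF epi_Arr[OF assms(1)]] .
  then show ?thesis using SigI assms T_zero epi_cokernel_zero by blast
qed

lemma Sig_Ident [simp]: "A \<in> Obj C \<Longrightarrow> Ident C A \<in> \<Sigma>"
proof -
  assume A: "A \<in> Obj C"
  have "is_mono C (Ident C A)" "is_epi C (Ident C A)"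
    unfolding is_mono_def is_epi_def using A by auto
  moreover obtain c where "is_cokernel C (Ident C A) c" using cokernel_ex[of "Ident C A"] A by auto
  ultimately show "Ident C A \<in> \<Sigma>"
    using Sig_monoI epi_cokernel_zero T_zero by blast
qed

text \<open>
  The image factorization exhibits the domain as an extension of a subobject of the codomain by
  the kernel.  Dually, the codomain is an extension of the cokernel by a quotient of the domain.
\<close>

lemma torsion_dom:
  assumes "is_kernel C f k" "Dom C k \<in> T" "Cod C f \<in> T" shows "Dom C f \<in> T"
proof -
  note f = is_kernelD[OF assms(1)]
  obtain m e c where im: "image_factorization f m e c" using image_factor[OF f(1)] .
  note m = image_factorizationD[OF im]
  have "is_kernel C e k"
    by (rule kernel_of_mono_comp[OF assms(1)]) (use m in auto)
  then have "short_exact C k e"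
    using epi_is_cokernel_of_kernel[OF m(5)] by (simp add: short_exact_def)
  then have "Cod C k \<in> T"
    by (rule T_ext) (use assms m T_sub in auto)
  then show ?thesis using f by simp
qed

lemma torsion_cod:
  assumes "is_cokernel C f c" "Cod C c \<in> T" "Dom C f \<in> T" shows "Cod C f \<in> T"
proof -
  note f = is_cokernelD[OF assms(1)]
  obtain m e d where im: "image_factorization f m e d" using image_factor[OF f(1)] .
  note m = image_factorizationD[OF im]
  have "short_exact C m d" using m by (simp add: short_exact_def)
  moreover obtain u where "is_epi C u" "Dom C u = Cod C c" "Cod C u = Cod C d"
    using cokernels_iso[OF m(1) assms(1)] .
  then have "Cod C d \<in> T" using T_quo[of u] assms(2) by simp
  ultimately have "Cod C m \<in> T"
    using T_ext[of m d] T_quo[OF m(5)] assms m by simp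
  then show ?thesis using m by simp
qed

text \<open>
  The kernel \<open>k\<close> of \<open>s s'\<close> maps to that of \<open>s\<close>, and the kernel of this map embeds into that of \<open>s'\<close>;
  so \<open>torsion_dom\<close> applies.  The argument for the cokernel is dual.
\<close>

lemma Sig_comp [simp]:
  assumes s: "s \<in> \<Sigma>" and s': "s' \<in> \<Sigma>" and d: "Cod C s' = Dom C s"
  shows "s \<cdot> s' \<in> \<Sigma>"
proof -
  note [simp] = Sig_Arr[OF s] Sig_Arr[OF s'] d
  obtain k where k: "is_kernel C (s \<cdot> s') k" using kernel_ex[of "s \<cdot> s'"] by auto
  note [simp] = is_kernelD(2,3)[OF k]
  obtain k0 where k0: "is_kernel C s k0" using kernel_ex[of s] by auto
  obtain k1 where k1: "is_kernel C s' k1" using kernel_ex[of s'] by auto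
  have sk: "s \<cdot> (s' \<cdot> k) = nul (Dom C k) (Cod C s)" using is_kernelD(4)[OF k] by simp
  then obtain x where x: "x \<in> Arr C" "Dom C x = Dom C k" "Cod C x = Dom C k0" "k0 \<cdot> x = s' \<cdot> k"
    using is_kernel_factor[OF k0, of "s' \<cdot> k"] by auto
  obtain l where l: "is_kernel C x l" using kernel_ex[OF x(1)] .
  note l' = is_kernelD[OF l]
  have "s' \<cdot> (k \<cdot> l) = (s' \<cdot> k) \<cdot> l" using l' x by simp
  also have "\<dots> = k0 \<cdot> (x \<cdot> l)" unfolding x(4)[symmetric] using l' x(1-3) is_kernelD[OF k0] by simp
  also have "\<dots> = nul (Dom C l) (Cod C s')" using l' x is_kernelD[OF k0] by simp
  finally obtain y where y: "y \<in> Arr C" "Dom C y = Dom C l" "Cod C y = Dom C k1" "k1 \<cdot> y = k \<cdot> l"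
    using is_kernel_factor[OF k1, of "k \<cdot> l"] l' x by auto
  have "is_mono C (k \<cdot> l)" using mono_comp is_kernelD(5)[OF k] l' x by simp
  then have "is_mono C y" using mono_right[of k1 y] y is_kernelD[OF k1] by simp
  then have "Dom C l \<in> T" using T_sub[of y] y Sig_kernel[OF s' k1] by simp
  then have K: "Dom C k \<in> T"
    using torsion_dom[OF l] x Sig_kernel[OF s k0] by simp
  obtain c where c: "is_cokernel C (s \<cdot> s') c" using cokernel_ex[of "s \<cdot> s'"] by auto
  note [simp] = is_cokernelD(2,3)[OF c]
  obtain c0 where c0: "is_cokernel C s c0" using cokernel_ex[of s] by auto
  obtain c1 where c1: "is_cokernel C s' c1" using cokernel_ex[of s'] by auto
  have "(c \<cdot> s) \<cdot> s' = nul (Dom C s') (Cod C c)" using is_cokernelD(4)[OF c] by simp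
  then obtain x where x: "x \<in> Arr C" "Cod C x = Cod C c" "Dom C x = Cod C c1" "x \<cdot> c1 = c \<cdot> s"
    using is_cokernel_factor[OF c1, of "c \<cdot> s"] by auto
  obtain l where l: "is_cokernel C x l" using cokernel_ex[OF x(1)] .
  note l' = is_cokernelD[OF l]
  have "(l \<cdot> c) \<cdot> s = l \<cdot> (c \<cdot> s)" using l' x by simp
  also have "\<dots> = nul (Dom C s) (Cod C l)"
    unfolding x(4)[symmetric] using comp_whisker[OF l'(4), of c1] l' x(1-3) is_cokernelD[OF c1] by simp
  finally obtain y where y: "y \<in> Arr C" "Dom C y = Cod C c0" "Cod C y = Cod C l" "y \<cdot> c0 = l \<cdot> c"
    using is_cokernel_factor[OF c0, of "l \<cdot> c"] l' x by auto
  have "is_epi C (l \<cdot> c)" using epi_comp is_cokernelD(5)[OF c] l' x by simp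
  then have "is_epi C y" using epi_left[of y c0] y is_cokernelD[OF c0] by simp
  then have "Cod C l \<in> T" using T_quo[of y] y Sig_cokernel[OF s c0] by simp
  then have "Cod C c \<in> T"
    using torsion_cod[OF l] x Sig_cokernel[OF s' c1] by simp
  then show ?thesis using SigI[OF k K c] by simp
qed

text \<open>
  If zero is in \<open>\<Sigma>\<close>, then its codomain, as the cokernel, is torsion.  In the lemmas \<open>mono_torsion\<close> and
  \<open>epi_torsion\<close> the equation \<open>m z = 0\<close> means \<open>q m = 0\<close>.
\<close>

lemma Sig_nul:
  assumes z: "z \<in> \<Sigma>" "z = nul (Dom C z) (Cod C z)" shows "Cod C z \<in> T"
proof -
  obtain c where c: "is_cokernel C z c" using cokernel_ex[of z] z by auto
  note c' = is_cokernelD[OF c]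
  have "Ident C (Cod C z) \<cdot> z = nul (Dom C z) (Cod C z)" using z c' by (metis comp_Ident(2))
  then obtain w where w: "w \<in> Arr C" "Dom C w = Cod C c" "Cod C w = Cod C z" "w \<cdot> c = Ident C (Cod C z)"
    using is_cokernel_factor[OF c, of "Ident C (Cod C z)"] c' by auto
  have "is_mono C (Ident C (Cod C z))" using c' by (auto simp: is_mono_def)
  then have "is_mono C c" using mono_right[of w c] w c' by simp
  then show ?thesis using T_sub[of c] c' Sig_cokernel[OF z(1) c] by simp
qed

lemma mono_torsion:
  assumes "is_mono C m" "z \<in> \<Sigma>" "Cod C z = Dom C m" "m \<cdot> z = nul (Dom C z) (Cod C m)"
  shows "Dom C m \<in> T"
  using Sig_nul[of z] mono_nul[OF assms(1), of z] assms by simp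

lemma epi_torsion:
  assumes "is_epi C p" "z \<in> \<Sigma>" "Cod C z = Dom C p" "p \<cdot> z = nul (Dom C z) (Cod C p)"
  shows "Cod C p \<in> T"
proof -
  note p = epi_Arr[OF assms(1)]
  obtain c where c: "is_cokernel C z c" using cokernel_ex[of z] assms by auto
  note c' = is_cokernelD[OF c]
  obtain w where w: "w \<in> Arr C" "Dom C w = Cod C c" "Cod C w = Cod C p" "w \<cdot> c = p"
    using is_cokernel_factor[OF c, of p] c' p assms by auto
  then have "is_epi C w" using epi_left[of w c] c' assms by simp
  then show ?thesis using T_quo[of w] w Sig_cokernel[OF assms(2) c] by simp
qed

text \<open>
  The image of \<open>d\<close> lies in the kernel of \<open>s\<close>, so it is torsion; hence the kernel \<open>z\<close> of \<open>d\<close>, whose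
  cokernel is this image, belongs to \<open>\<Sigma>\<close>.
\<close>

lemma torsion_annihilate:
  assumes s: "s \<in> \<Sigma>" and d: "d \<in> Arr C" "Cod C d = Dom C s" "s \<cdot> d = nul (Dom C d) (Cod C s)"
  obtains z where "z \<in> \<Sigma>" "Cod C z = Dom C d" "d \<cdot> z = nul (Dom C z) (Cod C d)"
proof -
  note [simp] = Sig_Arr[OF s]
  obtain k where k: "is_kernel C s k" using kernel_ex[of s] by auto
  note k' = is_kernelD[OF k]
  obtain z where z: "is_kernel C d z" using kernel_ex[OF d(1)] .
  note z' = is_kernelD[OF z]
  obtain m e c where im: "image_factorization d m e c" using image_factor[OF d(1)] .
  note m = image_factorizationD[OF im]
  have "(s \<cdot> m) \<cdot> e = nul (Dom C e) (Cod C s)" using m d by simp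
  then have "s \<cdot> m = nul (Dom C m) (Cod C s)" using epi_nul[OF m(5), of "s \<cdot> m"] m d by simp
  then obtain y where y: "y \<in> Arr C" "Dom C y = Dom C m" "Cod C y = Dom C k" "k \<cdot> y = m"
    using is_kernel_factor[OF k, of m] m d by auto
  then have "is_mono C y" using mono_right[of k y] m k' by simp
  then have "Cod C e \<in> T" using T_sub[of y] y m Sig_kernel[OF s k] by simp
  moreover have "is_cokernel C z e"
    by (rule epi_is_cokernel_of_kernel[OF m(5)], rule kernel_of_mono_comp[OF z]) (use m in auto)
  ultimately have "z \<in> \<Sigma>" using Sig_monoI[of z e] z' by simp
  then show thesis using that z' by simp
qed

lemma Sig_cancel:
  assumes s: "s \<in> \<Sigma>" and fg: "f \<in> Arr C" "g \<in> Arr C" "Dom C f = Dom C g" "Cod C f = Dom C s" "Cod C g = Dom C s"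
    "s \<cdot> f = s \<cdot> g"
  obtains z where "z \<in> \<Sigma>" "Cod C z = Dom C g" "f \<cdot> z = g \<cdot> z"
proof -
  have "s \<cdot> sub f g = nul (Dom C g) (Cod C s)" using s fg by (simp add: comp_sub)
  then obtain z where z: "z \<in> \<Sigma>" "Cod C z = Dom C g" "sub f g \<cdot> z = nul (Dom C z) (Cod C g)"
    using torsion_annihilate[OF s, of "sub f g"] fg by auto
  then have "sub (f \<cdot> z) (g \<cdot> z) = nul (Dom C (g \<cdot> z)) (Cod C (g \<cdot> z))" using fg by (simp add: comp_sub)
  then have "f \<cdot> z = g \<cdot> z" by (subst (asm) sub_nul) (use z fg in auto)
  then show thesis using that z by blast
qed

text \<open>
  Let \<open>m e\<close> be the image factorization of \<open>s\<close>.  The preimage \<open>a\<close> under \<open>f\<close> of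
  the image of \<open>s\<close> has a quotient that embeds into the cokernel of \<open>s\<close>; over this preimage it
  remains to pull back the epimorphism \<open>e\<close>, which keeps its kernel.
\<close>

lemma Ore:
  assumes s: "s \<in> \<Sigma>" and f: "f \<in> Arr C" "Cod C f = Cod C s"
  obtains s' f' where "s' \<in> \<Sigma>" "f' \<in> Arr C" "Dom C f' = Dom C s'" "Cod C s' = Dom C f" "Cod C f' = Dom C s"
    "f \<cdot> s' = s \<cdot> f'"
proof -
  note [simp] = Sig_Arr[OF s] f
  obtain m e c where im: "image_factorization s m e c" using image_factor[OF Sig_Arr[OF s]] .
  note m [simp] = image_factorizationD(1-10)[OF im] and me = image_factorizationD(11)[OF im]
  note c' [simp] = is_cokernelD(2,3)[OF m(1)]
  obtain k where k: "is_kernel C s k" using kernel_ex[of s] by auto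
  have ke: "is_kernel C e k" by (rule kernel_of_mono_comp[OF k]) (use me in auto)
  obtain a where a: "is_kernel C (c \<cdot> f) a" using kernel_ex[of "c \<cdot> f"] by auto
  note a' [simp] = is_kernelD(2,3,5)[OF a]
  obtain n e1 c1 where im: "image_factorization (c \<cdot> f) n e1 c1" by (rule image_factor[of "c \<cdot> f"]) auto
  note n = image_factorizationD[OF im]
  \<comment> \<open>The cokernel of \<open>a\<close> is the image of \<open>c f\<close>, a subobject of the cokernel of \<open>s\<close>.\<close>
  have "is_cokernel C a e1"
    by (rule epi_is_cokernel_of_kernel[OF n(5)], rule kernel_of_mono_comp[OF a]) (use n in auto)
  moreover have "Cod C e1 \<in> T"
    using T_sub[OF n(4)] n Sig_cokernel[OF s m(1)] by simp
  ultimately have aS: "a \<in> \<Sigma>" using Sig_monoI[of a e1] by simp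
  have "c \<cdot> (f \<cdot> a) = nul (Dom C a) (Cod C c)" using is_kernelD(4)[OF a] by simp
  then obtain g where g: "g \<in> Arr C" "Dom C g = Dom C a" "Cod C g = Dom C m" "m \<cdot> g = f \<cdot> a"
    using is_kernel_factor[OF m(2), of "f \<cdot> a"] by auto
  obtain p1 p2 k' where p: "p1 \<in> Arr C" "p2 \<in> Arr C" "Dom C p2 = Dom C p1" "Cod C p1 = Dom C g"
    "Cod C p2 = Dom C e" "g \<cdot> p1 = e \<cdot> p2" "is_epi C p1" "is_kernel C p1 k'" "Dom C k' = Dom C k" "p2 \<cdot> k' = k"
    using pullback_epi[OF m(5) ke g(1)] g by auto
  have "p1 \<in> \<Sigma>" using Sig_epiI[OF p(7,8)] p Sig_kernel[OF s k] by simp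
  then have ap: "a \<cdot> p1 \<in> \<Sigma>" using aS p g by simp
  have "f \<cdot> (a \<cdot> p1) = (m \<cdot> g) \<cdot> p1" using g(1-3) p(1-5) by (simp add: g(4))
  also have "\<dots> = m \<cdot> (e \<cdot> p2)" using g(1-3) p(1-6) by simp
  also have "\<dots> = s \<cdot> p2" unfolding me[symmetric] using p by simp
  finally show thesis using that[OF ap p(2)] p g by simp
qed

section \<open>Roofs\<close>

lemma roofs_iff: "(s, f) \<in> roofs C T \<longleftrightarrow> s \<in> \<Sigma> \<and> f \<in> Arr C \<and> Dom C s = Dom C f"
  by (simp add: roofs_def)

lemma roof_equivI:
  assumes "(s, f) \<in> roofs C T" "(s', f') \<in> roofs C T" "Cod C s = Cod C s'" "Cod C f = Cod C f'"
    "a \<in> Arr C" "a' \<in> Arr C" "Dom C a = Dom C a'" "Cod C a = Dom C s" "Cod C a' = Dom C s'"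
    "s \<cdot> a \<in> \<Sigma>" "s \<cdot> a = s' \<cdot> a'" "f \<cdot> a = f' \<cdot> a'"
  shows "((s, f), (s', f')) \<in> roof_equiv C T"
  unfolding roof_equiv_def using assms by blast

lemma roof_equivE:
  assumes "((s, f), (s', f')) \<in> roof_equiv C T"
  obtains a a' where "(s, f) \<in> roofs C T" "(s', f') \<in> roofs C T" "Cod C s = Cod C s'" "Cod C f = Cod C f'"
    "a \<in> Arr C" "a' \<in> Arr C" "Dom C a = Dom C a'" "Cod C a = Dom C s" "Cod C a' = Dom C s'"
    "s \<cdot> a \<in> \<Sigma>" "s \<cdot> a = s' \<cdot> a'" "f \<cdot> a = f' \<cdot> a'"
  using assms unfolding roof_equiv_def by blast

text \<open>
  Transitivity: complete the witnesses \<open>s1 a1\<close> and \<open>s1 b1\<close> to a square and cancel \<open>s1\<close>.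
\<close>

lemma roof_equiv_trans:
  assumes \<Sigma>: "s \<in> \<Sigma>" "s1 \<in> \<Sigma>" "s2 \<in> \<Sigma>"
    and arr [simp]: "f \<in> Arr C" "f1 \<in> Arr C" "f2 \<in> Arr C"
      "a \<in> Arr C" "a1 \<in> Arr C" "b1 \<in> Arr C" "b2 \<in> Arr C"
    and obj [simp]: "Cod C s = A" "Dom C s = M" "Dom C f = M" "Cod C f = B" "Cod C s1 = A" "Dom C s1 = M1" "Dom C f1 = M1"
      "Cod C f1 = B" "Cod C s2 = A" "Dom C s2 = M2" "Dom C f2 = M2" "Cod C f2 = B"
      "Cod C a = M" "Cod C a1 = M1" "Dom C a = V" "Dom C a1 = V"
      "Cod C b1 = M1" "Cod C b2 = M2" "Dom C b1 = W" "Dom C b2 = W"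
    and e: "s \<cdot> a \<in> \<Sigma>" "s \<cdot> a = s1 \<cdot> a1" "f \<cdot> a = f1 \<cdot> a1"
      "s1 \<cdot> b1 \<in> \<Sigma>" "s1 \<cdot> b1 = s2 \<cdot> b2" "f1 \<cdot> b1 = f2 \<cdot> b2"
  shows "((s, f), (s2, f2)) \<in> roof_equiv C T"
proof -
  note [simp] = Sig_Arr[OF \<Sigma>(1)] Sig_Arr[OF \<Sigma>(2)] Sig_Arr[OF \<Sigma>(3)]
  obtain x y where x [simp]: "x \<in> \<Sigma>" "y \<in> Arr C" "Dom C y = Dom C x" "Cod C x = V" "Cod C y = W"
    and xy: "s1 \<cdot> a1 \<cdot> x = s1 \<cdot> b1 \<cdot> y"
    using Ore[OF e(4), of "s1 \<cdot> a1"] by (auto simp del: Sig_comp)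
  obtain z where z [simp]: "z \<in> \<Sigma>" "Cod C z = Dom C x" and za: "a1 \<cdot> x \<cdot> z = b1 \<cdot> y \<cdot> z"
    using Sig_cancel[OF \<Sigma>(2), of "a1 \<cdot> x" "b1 \<cdot> y"] xy by auto
  show ?thesis
  proof (rule roof_equivI[where a = "a \<cdot> x \<cdot> z" and a' = "b2 \<cdot> y \<cdot> z"])
    have "s \<cdot> a \<cdot> x \<cdot> z = s1 \<cdot> a1 \<cdot> x \<cdot> z" using arg_cong[OF e(2), of "\<lambda>h. h \<cdot> x \<cdot> z"] by simp
    also have "\<dots> = s1 \<cdot> b1 \<cdot> y \<cdot> z" by (simp only: za)
    also have "\<dots> = s2 \<cdot> b2 \<cdot> y \<cdot> z" using arg_cong[OF e(5), of "\<lambda>h. h \<cdot> y \<cdot> z"] by simp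
    finally show "s \<cdot> a \<cdot> x \<cdot> z = s2 \<cdot> b2 \<cdot> y \<cdot> z" .
    have "f \<cdot> a \<cdot> x \<cdot> z = f1 \<cdot> a1 \<cdot> x \<cdot> z" using arg_cong[OF e(3), of "\<lambda>h. h \<cdot> x \<cdot> z"] by simp
    also have "\<dots> = f1 \<cdot> b1 \<cdot> y \<cdot> z" by (simp only: za)
    also have "\<dots> = f2 \<cdot> b2 \<cdot> y \<cdot> z" using arg_cong[OF e(6), of "\<lambda>h. h \<cdot> y \<cdot> z"] by simp
    finally show "f \<cdot> a \<cdot> x \<cdot> z = f2 \<cdot> b2 \<cdot> y \<cdot> z" .
    have "(s \<cdot> a) \<cdot> (x \<cdot> z) \<in> \<Sigma>" by (rule Sig_comp[OF e(1)]) auto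
    then show "s \<cdot> a \<cdot> x \<cdot> z \<in> \<Sigma>" by simp
  qed (use \<Sigma> in \<open>auto simp: roofs_iff\<close>)
qed

lemma roof_equiv_equiv: "equiv (roofs C T) (roof_equiv C T)"
proof (rule equivI)
  show "roof_equiv C T \<subseteq> roofs C T \<times> roofs C T" unfolding roof_equiv_def by auto
  show "refl_on (roofs C T) (roof_equiv C T)"
  proof (rule refl_onI, clarify)
    fix s f assume r: "(s, f) \<in> roofs C T"
    then show "((s, f), (s, f)) \<in> roof_equiv C T"
      by (intro roof_equivI[where a = "Ident C (Dom C s)" and a' = "Ident C (Dom C s)"]) (auto simp: roofs_iff)
  qed
  show "sym (roof_equiv C T)"
  proof (rule symI, clarify)
    fix s f s' f' assume "((s, f), (s', f')) \<in> roof_equiv C T"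
    then obtain a a' where "(s, f) \<in> roofs C T" "(s', f') \<in> roofs C T" "Cod C s = Cod C s'" "Cod C f = Cod C f'"
    "a \<in> Arr C" "a' \<in> Arr C" "Dom C a = Dom C a'" "Cod C a = Dom C s" "Cod C a' = Dom C s'"
    "s \<cdot> a \<in> \<Sigma>" "s \<cdot> a = s' \<cdot> a'" "f \<cdot> a = f' \<cdot> a'" by (rule roof_equivE)
    then show "((s', f'), (s, f)) \<in> roof_equiv C T"
      by (intro roof_equivI[where a = a' and a' = a]) simp_all
  qed
  show "trans (roof_equiv C T)"
  proof (rule transI, clarify)
    fix s f s1 f1 s2 f2
    assume 1: "((s, f), (s1, f1)) \<in> roof_equiv C T" and 2: "((s1, f1), (s2, f2)) \<in> roof_equiv C T"
    from 1 obtain a a1 where a: "(s, f) \<in> roofs C T" "(s1, f1) \<in> roofs C T" "Cod C s = Cod C s1" "Cod C f = Cod C f1"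
      "a \<in> Arr C" "a1 \<in> Arr C" "Dom C a = Dom C a1" "Cod C a = Dom C s" "Cod C a1 = Dom C s1"
      "s \<cdot> a \<in> \<Sigma>" "s \<cdot> a = s1 \<cdot> a1" "f \<cdot> a = f1 \<cdot> a1"
      by (elim roof_equivE)
    from 2 obtain b1 b2 where b: "(s2, f2) \<in> roofs C T" "Cod C s1 = Cod C s2" "Cod C f1 = Cod C f2"
      "b1 \<in> Arr C" "b2 \<in> Arr C" "Dom C b1 = Dom C b2" "Cod C b1 = Dom C s1" "Cod C b2 = Dom C s2"
      "s1 \<cdot> b1 \<in> \<Sigma>" "s1 \<cdot> b1 = s2 \<cdot> b2" "f1 \<cdot> b1 = f2 \<cdot> b2"
      by (elim roof_equivE)
    note r = a(1,2)[unfolded roofs_iff] b(1)[unfolded roofs_iff]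
    show "((s, f), (s2, f2)) \<in> roof_equiv C T"
      by (rule roof_equiv_trans[where A = "Cod C s2" and B = "Cod C f2" and M = "Dom C f" and ?M1.0 = "Dom C f1"
            and ?M2.0 = "Dom C f2" and V = "Dom C a1" and W = "Dom C b2", OF _ _ _ _ _ _ a(5,6) b(4,5)])
        (use a(3,4,7-12) b(2,3,6-11) r in auto)
  qed
qed

text \<open>
  All the roofs involved are refined, by the Ore condition, until they agree after composition with
  arrows of \<open>\<Sigma>\<close>, which are then cancelled at the cost of a further refinement.  Hence composition of
  roofs does not depend on the representatives and on the completing square.
\<close>

lemma roof_comp_equiv:
  assumes \<Sigma>: "s \<in> \<Sigma>" "s1 \<in> \<Sigma>" "u \<in> \<Sigma>" "u1 \<in> \<Sigma>" "s' \<in> \<Sigma>" "s1' \<in> \<Sigma>"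
    and arr [simp]: "f \<in> Arr C" "f1 \<in> Arr C" "g \<in> Arr C" "g1 \<in> Arr C" "f' \<in> Arr C" "f1' \<in> Arr C"
      "a \<in> Arr C" "a1 \<in> Arr C" "b \<in> Arr C" "b1 \<in> Arr C"
    and obj [simp]: "Cod C s = A" "Dom C s = M" "Dom C f = M" "Cod C f = B" "Cod C s1 = A" "Dom C s1 = M1" "Dom C f1 = M1"
      "Cod C f1 = B" "Cod C u = B" "Dom C u = N" "Dom C g = N" "Cod C g = E" "Cod C u1 = B" "Dom C u1 = N1" "Dom C g1 = N1"
      "Cod C g1 = E" "Cod C s' = M" "Dom C s' = P" "Dom C f' = P" "Cod C f' = N" "Cod C s1' = M1" "Dom C s1' = P1"
      "Dom C f1' = P1" "Cod C f1' = N1" "Cod C a = M" "Cod C a1 = M1" "Dom C a = V" "Dom C a1 = V"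
      "Cod C b = N" "Cod C b1 = N1" "Dom C b = W" "Dom C b1 = W"
    and e: "f \<cdot> s' = u \<cdot> f'" "f1 \<cdot> s1' = u1 \<cdot> f1'" "s \<cdot> a \<in> \<Sigma>" "s \<cdot> a = s1 \<cdot> a1" "f \<cdot> a = f1 \<cdot> a1"
      "u \<cdot> b \<in> \<Sigma>" "u \<cdot> b = u1 \<cdot> b1" "g \<cdot> b = g1 \<cdot> b1"
  shows "((s \<cdot> s', g \<cdot> f'), (s1 \<cdot> s1', g1 \<cdot> f1')) \<in> roof_equiv C T"
proof -
  note [simp] = Sig_Arr[OF \<Sigma>(1)] Sig_Arr[OF \<Sigma>(2)] Sig_Arr[OF \<Sigma>(3)] Sig_Arr[OF \<Sigma>(4)] Sig_Arr[OF \<Sigma>(5)] Sig_Arr[OF \<Sigma>(6)]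
  note w = arg_cong[where f = "\<lambda>h. h \<cdot> _"]
  obtain x y where x [simp]: "x \<in> \<Sigma>" "y \<in> Arr C" "Dom C y = Dom C x" "Cod C x = P" "Cod C y = V"
    and xy: "s \<cdot> s' \<cdot> x = s \<cdot> a \<cdot> y"
    using Ore[OF e(3), of "s \<cdot> s'"] by (auto simp del: Sig_comp)
  obtain x2 y2 where x2 [simp]: "x2 \<in> \<Sigma>" "y2 \<in> Arr C" "Dom C y2 = Dom C x2" "Cod C x2 = Dom C x" "Cod C y2 = P1"
    and xy2: "s \<cdot> a \<cdot> y \<cdot> x2 = s1 \<cdot> s1' \<cdot> y2"
    using Ore[OF Sig_comp[OF \<Sigma>(2,6)], of "s \<cdot> a \<cdot> y"] by (auto simp del: Sig_comp)
  have "s \<cdot> s' \<cdot> x \<cdot> x2 = s \<cdot> a \<cdot> y \<cdot> x2" using arg_cong[OF xy, of "\<lambda>h. h \<cdot> x2"] by simp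
  then obtain z1 where z1 [simp]: "z1 \<in> \<Sigma>" "Cod C z1 = Dom C x2" and ez1: "s' \<cdot> x \<cdot> x2 \<cdot> z1 = a \<cdot> y \<cdot> x2 \<cdot> z1"
    using Sig_cancel[OF \<Sigma>(1), of "s' \<cdot> x \<cdot> x2" "a \<cdot> y \<cdot> x2"] by auto
  have "s1 \<cdot> a1 \<cdot> y \<cdot> x2 \<cdot> z1 = s1 \<cdot> s1' \<cdot> y2 \<cdot> z1"
    using arg_cong[OF e(4), of "\<lambda>h. h \<cdot> y \<cdot> x2 \<cdot> z1"] arg_cong[OF xy2, of "\<lambda>h. h \<cdot> z1"] by simp
  then obtain z2 where z2 [simp]: "z2 \<in> \<Sigma>" "Cod C z2 = Dom C z1"
    and ez2: "a1 \<cdot> y \<cdot> x2 \<cdot> z1 \<cdot> z2 = s1' \<cdot> y2 \<cdot> z1 \<cdot> z2"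
    using Sig_cancel[OF \<Sigma>(2), of "a1 \<cdot> y \<cdot> x2 \<cdot> z1" "s1' \<cdot> y2 \<cdot> z1"] by auto
  define p where "p = x \<cdot> x2 \<cdot> z1 \<cdot> z2"
  define y' where "y' = y \<cdot> x2 \<cdot> z1 \<cdot> z2"
  define p1 where "p1 = y2 \<cdot> z1 \<cdot> z2"
  define R where "R = Dom C z2"
  have p [simp]: "p \<in> \<Sigma>" "p \<in> Arr C" "y' \<in> Arr C" "p1 \<in> Arr C" "Dom C p = R" "Dom C y' = R" "Dom C p1 = R"
    "Cod C p = P" "Cod C y' = V" "Cod C p1 = P1"
    unfolding p_def y'_def p1_def R_def by auto
  have sp: "s' \<cdot> p = a \<cdot> y'" using arg_cong[OF ez1, of "\<lambda>h. h \<cdot> z2"] unfolding p_def y'_def by simp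
  have ay: "a1 \<cdot> y' = s1' \<cdot> p1" using ez2 unfolding y'_def p1_def by simp
  have 1: "u \<cdot> f' \<cdot> p = f \<cdot> a \<cdot> y'" using arg_cong[OF e(1), of "\<lambda>h. h \<cdot> p"] sp by simp
  have 2: "f \<cdot> a \<cdot> y' = f1 \<cdot> s1' \<cdot> p1" using arg_cong[OF e(5), of "\<lambda>h. h \<cdot> y'"] ay by simp
  have 3: "f1 \<cdot> s1' \<cdot> p1 = u1 \<cdot> f1' \<cdot> p1" using arg_cong[OF e(2), of "\<lambda>h. h \<cdot> p1"] by simp
  obtain v v' where v [simp]: "v \<in> \<Sigma>" "v' \<in> Arr C" "Dom C v' = Dom C v" "Cod C v = R" "Cod C v' = W"
    and vv: "u \<cdot> f' \<cdot> p \<cdot> v = u \<cdot> b \<cdot> v'"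
    using Ore[OF e(6), of "u \<cdot> f' \<cdot> p"] by (auto simp del: Sig_comp)
  obtain z3 where z3 [simp]: "z3 \<in> \<Sigma>" "Cod C z3 = Dom C v" and ez3: "f' \<cdot> p \<cdot> v \<cdot> z3 = b \<cdot> v' \<cdot> z3"
    using Sig_cancel[OF \<Sigma>(3), of "f' \<cdot> p \<cdot> v" "b \<cdot> v'"] vv by auto
  have "u1 \<cdot> b1 \<cdot> v' \<cdot> z3 = u \<cdot> b \<cdot> v' \<cdot> z3" using arg_cong[OF e(7), of "\<lambda>h. h \<cdot> v' \<cdot> z3"] by simp
  also have "\<dots> = u \<cdot> f' \<cdot> p \<cdot> v \<cdot> z3" using arg_cong[OF vv, of "\<lambda>h. h \<cdot> z3"] by simp
  also have "\<dots> = u1 \<cdot> f1' \<cdot> p1 \<cdot> v \<cdot> z3" using arg_cong[OF trans[OF trans[OF 1 2] 3], of "\<lambda>h. h \<cdot> v \<cdot> z3"] by simp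
  finally obtain z4 where z4 [simp]: "z4 \<in> \<Sigma>" "Cod C z4 = Dom C z3"
    and ez4: "b1 \<cdot> v' \<cdot> z3 \<cdot> z4 = f1' \<cdot> p1 \<cdot> v \<cdot> z3 \<cdot> z4"
    using Sig_cancel[OF \<Sigma>(4), of "b1 \<cdot> v' \<cdot> z3" "f1' \<cdot> p1 \<cdot> v \<cdot> z3"] by auto
  define q where "q = v \<cdot> z3 \<cdot> z4"
  have q [simp]: "q \<in> \<Sigma>" "Cod C q = R" unfolding q_def by auto
  show ?thesis
  proof (rule roof_equivI[where a = "p \<cdot> q" and a' = "p1 \<cdot> q"])
    have "(s \<cdot> s') \<cdot> (p \<cdot> q) = s \<cdot> a \<cdot> y' \<cdot> q" using arg_cong[OF sp, of "\<lambda>h. s \<cdot> h \<cdot> q"] by simp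
    also have "\<dots> = s1 \<cdot> a1 \<cdot> y' \<cdot> q" using arg_cong[OF e(4), of "\<lambda>h. h \<cdot> y' \<cdot> q"] by simp
    also have "\<dots> = (s1 \<cdot> s1') \<cdot> (p1 \<cdot> q)" using arg_cong[OF ay, of "\<lambda>h. s1 \<cdot> h \<cdot> q"] by simp
    finally show "(s \<cdot> s') \<cdot> (p \<cdot> q) = (s1 \<cdot> s1') \<cdot> (p1 \<cdot> q)" .
    have "(g \<cdot> f') \<cdot> (p \<cdot> q) = g \<cdot> b \<cdot> v' \<cdot> z3 \<cdot> z4"
      using arg_cong[OF ez3, of "\<lambda>h. g \<cdot> h \<cdot> z4"] unfolding q_def by simp
    also have "\<dots> = g1 \<cdot> b1 \<cdot> v' \<cdot> z3 \<cdot> z4" using arg_cong[OF e(8), of "\<lambda>h. h \<cdot> v' \<cdot> z3 \<cdot> z4"] by simp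
    also have "\<dots> = (g1 \<cdot> f1') \<cdot> (p1 \<cdot> q)"
      using arg_cong[OF ez4, of "\<lambda>h. g1 \<cdot> h"] unfolding q_def by simp
    finally show "(g \<cdot> f') \<cdot> (p \<cdot> q) = (g1 \<cdot> f1') \<cdot> (p1 \<cdot> q)" .
    show "(s \<cdot> s') \<cdot> (p \<cdot> q) \<in> \<Sigma>" by (intro Sig_comp \<Sigma>) auto
  qed (use \<Sigma> in \<open>auto simp: roofs_iff\<close>)
qed

end

section \<open>The quotient category\<close>

context torsion_cat
begin

abbreviation D where "D \<equiv> gabriel_quotient C T"

abbreviation comp_D (infixr "\<odot>" 75) where "g \<odot> f \<equiv> g \<cdot>\<^bsub>D\<^esub> f"

abbreviation cl where "cl s f \<equiv> roof_class C T (s, f)"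

definition q where "q f = cl (Ident C (Dom C f)) f"

lemma quotient_functor_simps [simp]:
  "FObj (quotient_functor C T) A = A" "FArr (quotient_functor C T) f = q f"
  by (simp_all add: quotient_functor_def q_def)

lemma Obj_D [simp]: "Obj D = Obj C" and Ident_D: "Ident D A = cl (Ident C A) (Ident C A)"
  by (simp_all add: gabriel_quotient_def)

lemma Arr_D: "\<phi> \<in> Arr D \<longleftrightarrow> (\<exists>s f. s \<in> \<Sigma> \<and> f \<in> Arr C \<and> Dom C s = Dom C f \<and> \<phi> = cl s f)"
  by (auto simp: gabriel_quotient_def roof_class_def quotient_def roofs_iff) (use roofs_iff in blast)+

lemma Arr_DI: "s \<in> \<Sigma> \<Longrightarrow> f \<in> Arr C \<Longrightarrow> Dom C s = Dom C f \<Longrightarrow> cl s f \<in> Arr D"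
  using Arr_D by blast

lemma cl_eq_iff:
  assumes "(s, f) \<in> roofs C T" "(s', f') \<in> roofs C T"
  shows "cl s f = cl s' f' \<longleftrightarrow> ((s, f), (s', f')) \<in> roof_equiv C T"
  unfolding roof_class_def using eq_equiv_class_iff[OF roof_equiv_equiv assms] .

lemma mem_cl: "(s', f') \<in> cl s f \<longleftrightarrow> ((s, f), (s', f')) \<in> roof_equiv C T"
  by (simp add: roof_class_def)

lemma self_mem_cl: "(s, f) \<in> roofs C T \<Longrightarrow> (s, f) \<in> cl s f"
  unfolding mem_cl by (meson roof_equiv_equiv equivE refl_onD)

lemma Dom_Cod_cl:
  assumes "s \<in> \<Sigma>" "f \<in> Arr C" "Dom C s = Dom C f"
  shows "Dom D (cl s f) = Cod C s" "Cod D (cl s f) = Cod C f"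
proof -
  define r where "r = (SOME r. r \<in> cl s f)"
  have "r \<in> cl s f"
    unfolding r_def by (rule someI[of _ "(s, f)"]) (use assms self_mem_cl in \<open>simp add: roofs_iff\<close>)
  then have "((s, f), (fst r, snd r)) \<in> roof_equiv C T" using mem_cl[of "fst r" "snd r" s f] by simp
  then have "Cod C (fst r) = Cod C s" "Cod C (snd r) = Cod C f" by (rule roof_equivE; simp)+
  then show "Dom D (cl s f) = Cod C s" "Cod D (cl s f) = Cod C f"
    unfolding r_def by (simp_all add: gabriel_quotient_def)
qed

text \<open>
  Composition is defined as the union of the classes of all composite roofs.  By \<open>roof_comp_equiv\<close>
  these classes are all equal.
\<close>

lemma Comp_cl:
  assumes a: "s \<in> \<Sigma>" "f \<in> Arr C" "Dom C s = Dom C f" "u \<in> \<Sigma>" "g \<in> Arr C" "Dom C u = Dom C g" "Cod C f = Cod C u"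
    and b: "s' \<in> \<Sigma>" "f' \<in> Arr C" "Dom C s' = Dom C f'" "Cod C s' = Dom C f" "Cod C f' = Dom C u" "f \<cdot> s' = u \<cdot> f'"
  shows "cl u g \<odot> cl s f = cl (s \<cdot> s') (g \<cdot> f')"
proof -
  define S where "S = {cl (s1 \<cdot> s1') (g1 \<cdot> f1') | s1 f1 u1 g1 s1' f1'.
        (s1, f1) \<in> cl s f \<and> (u1, g1) \<in> cl u g \<and> s1' \<in> \<Sigma> \<and> f1' \<in> Arr C \<and> Dom C s1' = Dom C f1' \<and>
        Cod C s1' = Dom C f1 \<and> Cod C f1' = Dom C u1 \<and> f1 \<cdot> s1' = u1 \<cdot> f1'}"
  have "cl u g \<odot> cl s f = \<Union> S"
    unfolding S_def by (simp add: gabriel_quotient_def)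
  moreover have "S = {cl (s \<cdot> s') (g \<cdot> f')}"
  proof
    show "{cl (s \<cdot> s') (g \<cdot> f')} \<subseteq> S"
      unfolding S_def using a b self_mem_cl roofs_iff by blast
    show "S \<subseteq> {cl (s \<cdot> s') (g \<cdot> f')}"
    proof
      fix x assume "x \<in> S"
      then obtain s1 f1 u1 g1 s1' f1' where x: "x = cl (s1 \<cdot> s1') (g1 \<cdot> f1')"
        and 1: "((s, f), (s1, f1)) \<in> roof_equiv C T" and 2: "((u, g), (u1, g1)) \<in> roof_equiv C T"
        and c: "s1' \<in> \<Sigma>" "f1' \<in> Arr C" "Dom C s1' = Dom C f1'"
        "Cod C s1' = Dom C f1" "Cod C f1' = Dom C u1" "f1 \<cdot> s1' = u1 \<cdot> f1'"
        unfolding S_def mem_cl by blast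
      from 1 obtain p p1 where p: "(s, f) \<in> roofs C T" "(s1, f1) \<in> roofs C T" "Cod C s = Cod C s1" "Cod C f = Cod C f1"
        "p \<in> Arr C" "p1 \<in> Arr C" "Dom C p = Dom C p1" "Cod C p = Dom C s" "Cod C p1 = Dom C s1"
        "s \<cdot> p \<in> \<Sigma>" "s \<cdot> p = s1 \<cdot> p1" "f \<cdot> p = f1 \<cdot> p1" by (rule roof_equivE)
      from 2 obtain b b1 where b': "(u, g) \<in> roofs C T" "(u1, g1) \<in> roofs C T" "Cod C u = Cod C u1" "Cod C g = Cod C g1"
        "b \<in> Arr C" "b1 \<in> Arr C" "Dom C b = Dom C b1" "Cod C b = Dom C u" "Cod C b1 = Dom C u1"
        "u \<cdot> b \<in> \<Sigma>" "u \<cdot> b = u1 \<cdot> b1" "g \<cdot> b = g1 \<cdot> b1" by (rule roof_equivE)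
      note r = p(2)[unfolded roofs_iff] b'(2)[unfolded roofs_iff]
      have "((s \<cdot> s', g \<cdot> f'), (s1 \<cdot> s1', g1 \<cdot> f1')) \<in> roof_equiv C T"
        by (rule roof_comp_equiv[where a = p and ?a1.0 = p1 and b = b and ?b1.0 = b1 and f = f and ?f1.0 = f1 and u = u
              and ?u1.0 = u1 and A = "Cod C s1" and M = "Dom C f" and B = "Cod C u1" and ?M1.0 = "Dom C f1" and N = "Dom C g"
              and E = "Cod C g1" and ?N1.0 = "Dom C g1" and P = "Dom C f'" and ?P1.0 = "Dom C f1'"
              and V = "Dom C p1" and W = "Dom C b1"])
          (use a b c p(3-12) b'(3-12) r in auto)
      moreover have "(s \<cdot> s', g \<cdot> f') \<in> roofs C T" "(s1 \<cdot> s1', g1 \<cdot> f1') \<in> roofs C T"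
        using a b c r by (auto simp: roofs_iff)
      ultimately show "x \<in> {cl (s \<cdot> s') (g \<cdot> f')}" unfolding x using cl_eq_iff[of "s \<cdot> s'" "g \<cdot> f'" "s1 \<cdot> s1'" "g1 \<cdot> f1'"] by simp
    qed
  qed
  ultimately show ?thesis by simp
qed

text \<open>
  Associativity: squares that complete \<open>f, u\<close> and \<open>g, v\<close>, together with a third one that completes
  \<open>f', u'\<close>, compute both bracketings of a triple composite by the same roof.
\<close>

lemma category_D: "category D"
proof -
  have id: "Ident D A \<in> Hom D A A" if "A \<in> Obj C" for A
    using that by (simp add: Ident_D Arr_DI Dom_Cod_cl)
  have comp: "\<psi> \<odot> \<phi> \<in> Hom D (Dom D \<phi>) (Cod D \<psi>)"
    if a: "\<phi> \<in> Arr D" "\<psi> \<in> Arr D" "Cod D \<phi> = Dom D \<psi>" for \<phi> \<psi>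
  proof -
    obtain s f where r1: "s \<in> \<Sigma>" "f \<in> Arr C" "Dom C s = Dom C f" "\<phi> = cl s f"
      using a(1) unfolding Arr_D by blast
    obtain u g where r2: "u \<in> \<Sigma>" "g \<in> Arr C" "Dom C u = Dom C g" "\<psi> = cl u g"
      using a(2) unfolding Arr_D by blast
    note r = r1 r2
    then have fu: "Cod C f = Cod C u" using a by (simp add: Dom_Cod_cl)
    obtain s' f' where c: "s' \<in> \<Sigma>" "f' \<in> Arr C" "Dom C f' = Dom C s'" "Cod C s' = Dom C f" "Cod C f' = Dom C u"
      "f \<cdot> s' = u \<cdot> f'" using Ore[OF r(5,2) fu] .
    show ?thesis using Comp_cl[OF r(1-3,5-7) fu c(1,2) _ c(4-6)] r c
      by (simp add: Arr_DI Dom_Cod_cl)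
  qed
  have unit: "\<phi> \<odot> Ident D (Dom D \<phi>) = \<phi>" "Ident D (Cod D \<phi>) \<odot> \<phi> = \<phi>"
    if a: "\<phi> \<in> Arr D" for \<phi>
  proof -
    obtain s f where r: "s \<in> \<Sigma>" "f \<in> Arr C" "Dom C s = Dom C f" "\<phi> = cl s f" using a unfolding Arr_D by blast
    show "\<phi> \<odot> Ident D (Dom D \<phi>) = \<phi>"
      using Comp_cl[of "Ident C (Cod C s)" "Ident C (Cod C s)" s f s "Ident C (Dom C f)"] r
      by (simp add: Dom_Cod_cl Ident_D)
    show "Ident D (Cod D \<phi>) \<odot> \<phi> = \<phi>"
      using Comp_cl[of s f "Ident C (Cod C f)" "Ident C (Cod C f)" "Ident C (Dom C f)" f] r
      by (simp add: Dom_Cod_cl Ident_D)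
  qed
  have assoc: "\<chi> \<odot> (\<psi> \<odot> \<phi>) = (\<chi> \<odot> \<psi>) \<odot> \<phi>"
    if a: "\<phi> \<in> Arr D" "\<psi> \<in> Arr D" "\<chi> \<in> Arr D" "Cod D \<phi> = Dom D \<psi>" "Cod D \<psi> = Dom D \<chi>" for \<phi> \<psi> \<chi>
  proof -
    obtain s f where s: "s \<in> \<Sigma>" "f \<in> Arr C" "Dom C s = Dom C f" "\<phi> = cl s f" using a(1) unfolding Arr_D by blast
    obtain u g where u: "u \<in> \<Sigma>" "g \<in> Arr C" "Dom C u = Dom C g" "\<psi> = cl u g" using a(2) unfolding Arr_D by blast
    obtain v h where v: "v \<in> \<Sigma>" "h \<in> Arr C" "Dom C v = Dom C h" "\<chi> = cl v h" using a(3) unfolding Arr_D by blast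
    have d: "Cod C f = Cod C u" "Cod C g = Cod C v" using a(4,5) s u v by (simp_all add: Dom_Cod_cl)
    obtain s' f' where c: "s' \<in> \<Sigma>" "f' \<in> Arr C" "Dom C f' = Dom C s'" "Cod C s' = Dom C f" "Cod C f' = Dom C u"
      "f \<cdot> s' = u \<cdot> f'" using Ore[OF u(1) s(2) d(1)] .
    obtain u' g' where e: "u' \<in> \<Sigma>" "g' \<in> Arr C" "Dom C g' = Dom C u'" "Cod C u' = Dom C g" "Cod C g' = Dom C v"
      "g \<cdot> u' = v \<cdot> g'" using Ore[OF v(1) u(2) d(2)] .
    obtain x f'' where x: "x \<in> \<Sigma>" "f'' \<in> Arr C" "Dom C f'' = Dom C x" "Cod C x = Dom C f'" "Cod C f'' = Dom C u'"
      "f' \<cdot> x = u' \<cdot> f''" using Ore[OF e(1) c(2)] c u e by auto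
    have 1: "\<psi> \<odot> \<phi> = cl (s \<cdot> s') (g \<cdot> f')"
      using Comp_cl[OF s(1-3) u(1-3) d(1) c(1,2) _ c(4-6)] s u c by simp
    have 2: "\<chi> \<odot> \<psi> = cl (u \<cdot> u') (h \<cdot> g')"
      using Comp_cl[OF u(1-3) v(1-3) d(2) e(1,2) _ e(4-6)] u v e by simp
    have gf: "(g \<cdot> f') \<cdot> x = v \<cdot> g' \<cdot> f''"
      using arg_cong[OF x(6), of "\<lambda>w. g \<cdot> w"] arg_cong[OF e(6), of "\<lambda>w. w \<cdot> f''"] c(1-5) e(1-5) x(1-5) u(1-3) v(1-3) d
      by simp
    have 3: "\<chi> \<odot> (\<psi> \<odot> \<phi>) = cl ((s \<cdot> s') \<cdot> x) (h \<cdot> g' \<cdot> f'')"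
      unfolding 1 v(4) by (rule Comp_cl) (use gf s u v c(1-5) e(1-5) x(1-5) d in auto)
    have sx: "f \<cdot> s' \<cdot> x = (u \<cdot> u') \<cdot> f''"
      using arg_cong[OF c(6), of "\<lambda>w. w \<cdot> x"] arg_cong[OF x(6), of "\<lambda>w. u \<cdot> w"] c(1-5) e(1-5) x(1-5) s(1-3) u(1-3) d
      by simp
    have 4: "(\<chi> \<odot> \<psi>) \<odot> \<phi> = cl (s \<cdot> s' \<cdot> x) ((h \<cdot> g') \<cdot> f'')"
      unfolding 2 s(4) by (rule Comp_cl) (use sx s u v c(1-5) e(1-5) x(1-5) d in auto)
    show ?thesis unfolding 3 4 using s u v c(1-5) e(1-5) x(1-5) d by simp
  qed
  show ?thesis
    unfolding category_def
  proof (intro conjI ballI impI)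
    fix \<phi> assume "\<phi> \<in> Arr D"
    then obtain s f where r: "s \<in> \<Sigma>" "f \<in> Arr C" "Dom C s = Dom C f" "\<phi> = cl s f" unfolding Arr_D by blast
    then show "Dom D \<phi> \<in> Obj D" "Cod D \<phi> \<in> Obj D" by (simp_all add: Dom_Cod_cl)
  qed (use id comp unit assoc in auto)
qed

end

sublocale torsion_cat \<subseteq> D: category_loc "gabriel_quotient C T"
  by unfold_locales (rule category_D)

context torsion_cat
begin

lemma q_simps [simp]:
  assumes "f \<in> Arr C" shows "q f \<in> Arr D" "Dom D (q f) = Dom C f" "Cod D (q f) = Cod C f"
  using assms by (simp_all add: q_def Arr_DI Dom_Cod_cl)

lemma q_Ident [simp]: "A \<in> Obj C \<Longrightarrow> q (Ident C A) = Ident D A"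
  by (simp add: q_def Ident_D)

lemma q_comp:
  assumes "f \<in> Arr C" "g \<in> Arr C" "Cod C f = Dom C g"
  shows "q (g \<cdot> f) = q g \<odot> q f"
  unfolding q_def
  by (subst Comp_cl[of "Ident C (Dom C f)" f "Ident C (Dom C g)" g "Ident C (Dom C f)" f]) (use assms in auto)

lemma cl_q:
  assumes "s \<in> \<Sigma>" "f \<in> Arr C" "Dom C s = Dom C f"
  shows "cl s f \<odot> q s = q f"
  unfolding q_def
  by (subst Comp_cl[of "Ident C (Dom C s)" s s f "Ident C (Dom C f)" "Ident C (Dom C f)"]) (use assms in auto)

text \<open>The inverse of \<open>q s\<close>, for \<open>s\<close> in \<open>\<Sigma>\<close>.\<close>

definition qi where "qi s = cl s (Ident C (Dom C s))"

lemma qi_simps [simp]: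
  assumes "s \<in> \<Sigma>" shows "qi s \<in> Arr D" "Dom D (qi s) = Cod C s" "Cod D (qi s) = Dom C s"
  using assms by (simp_all add: qi_def Arr_DI Dom_Cod_cl)

lemma qi_inverse [simp]:
  assumes s: "s \<in> \<Sigma>"
  shows "qi s \<odot> q s = Ident D (Dom C s)" "q s \<odot> qi s = Ident D (Cod C s)"
proof -
  show "qi s \<odot> q s = Ident D (Dom C s)" using cl_q[OF s, of "Ident C (Dom C s)"] s by (simp add: qi_def)
  have "q s \<odot> qi s = cl s s"
    unfolding q_def qi_def
    by (subst Comp_cl[of s "Ident C (Dom C s)" "Ident C (Dom C s)" s "Ident C (Dom C s)" "Ident C (Dom C s)"]) (use s in auto)
  also have "\<dots> = Ident D (Cod C s)"
    unfolding Ident_D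
    by (subst cl_eq_iff, simp_all add: roofs_iff s, rule roof_equivI[where a = "Ident C (Dom C s)" and a' = s])
      (use s in \<open>auto simp: roofs_iff\<close>)
  finally show "q s \<odot> qi s = Ident D (Cod C s)" .
qed

lemma qi_cancel [simp]:
  assumes "s \<in> \<Sigma>" "x \<in> Arr D"
  shows "Cod D x = Dom C s \<Longrightarrow> qi s \<odot> q s \<odot> x = x" "Cod D x = Cod C s \<Longrightarrow> q s \<odot> qi s \<odot> x = x"
  using assms D.comp_whisker[of "qi s" "q s" _ x] D.comp_whisker[of "q s" "qi s" _ x] by auto

lemma q_Sig_epi: "s \<in> \<Sigma> \<Longrightarrow> is_epi D (q s)"
  by (rule D.epi_left[of _ "qi s"]) (auto simp: is_epi_def)

lemma q_Sig_mono: "s \<in> \<Sigma> \<Longrightarrow> is_mono D (q s)"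
  by (rule D.mono_right[of "qi s"]) (auto simp: is_mono_def)

text \<open>
  The two legs that witness the equivalence of \<open>(1, f)\<close> and \<open>(1, g)\<close> coincide, as both roofs have the
  left leg \<open>1\<close>.
\<close>

lemma q_eq_iff:
  assumes "f \<in> Arr C" "g \<in> Arr C" "Dom C f = Dom C g" "Cod C f = Cod C g"
  shows "q f = q g \<longleftrightarrow> (\<exists>z\<in>\<Sigma>. Cod C z = Dom C g \<and> f \<cdot> z = g \<cdot> z)"
proof
  assume "q f = q g"
  then have "((Ident C (Dom C f), f), (Ident C (Dom C g), g)) \<in> roof_equiv C T"
    unfolding q_def by (subst (asm) cl_eq_iff) (use assms in \<open>auto simp: roofs_iff\<close>)
  then obtain a a' where a: "a \<in> Arr C" "a' \<in> Arr C" "Dom C a = Dom C a'" "Cod C a = Dom C (Ident C (Dom C f))"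
    "Cod C a' = Dom C (Ident C (Dom C g))"
    "Ident C (Dom C f) \<cdot> a \<in> \<Sigma>" "Ident C (Dom C f) \<cdot> a = Ident C (Dom C g) \<cdot> a'" "f \<cdot> a = g \<cdot> a'"
    by (rule roof_equivE)
  then have "a = a'" "a \<in> \<Sigma>" "Cod C a = Dom C g" using assms by auto
  then show "\<exists>z\<in>\<Sigma>. Cod C z = Dom C g \<and> f \<cdot> z = g \<cdot> z" using a(8) by auto
next
  assume "\<exists>z\<in>\<Sigma>. Cod C z = Dom C g \<and> f \<cdot> z = g \<cdot> z"
  then obtain z where z: "z \<in> \<Sigma>" "Cod C z = Dom C g" "f \<cdot> z = g \<cdot> z" by blast
  have "q f \<odot> q z = q g \<odot> q z" using z assms by (simp flip: q_comp)
  then show "q f = q g" by (rule D.epi_cancel[OF q_Sig_epi[OF z(1)]]) (use z assms in auto)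
qed

text \<open>The arrow \<open>\<phi>\<close> is the fraction \<open>f s\<^sup>-\<^sup>1\<close>.\<close>

definition fraction where
  "fraction s f \<phi> \<longleftrightarrow> s \<in> \<Sigma> \<and> f \<in> Arr C \<and> Dom C f = Dom C s \<and> Cod C s = Dom D \<phi> \<and> Cod C f = Cod D \<phi> \<and>
    \<phi> \<odot> q s = q f"

lemma fractionD:
  assumes "fraction s f \<phi>"
  shows "s \<in> \<Sigma>" "f \<in> Arr C" "Dom C f = Dom C s" "Cod C s = Dom D \<phi>" "Cod C f = Cod D \<phi>" "\<phi> \<odot> q s = q f"
  using assms by (simp_all add: fraction_def)

lemma fraction_ex:
  assumes "\<phi> \<in> Arr D" obtains s f where "fraction s f \<phi>"
proof -
  obtain s f where "s \<in> \<Sigma>" "f \<in> Arr C" "Dom C s = Dom C f" "\<phi> = cl s f" using assms unfolding Arr_D by blast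
  then show thesis using that[of s f] cl_q by (simp add: Dom_Cod_cl fraction_def)
qed

end

section \<open>The quotient category of a torsion class with a section functor\<close>

text \<open>
  As \<open>q\<close> is the identity on objects, the adjunction consists of bijections from \<open>Hom\<^bsub>D\<^esub>(A, B)\<close> to
  \<open>Hom\<^bsub>C\<^esub>(A, \<iota> B)\<close>.
\<close>

locale torsion_section = torsion_cat +
  fixes \<iota> \<Phi>
  assumes section_functor: "is_functor D C \<iota>"
    and Phi_bij: "\<And>A B. A \<in> Obj C \<Longrightarrow> B \<in> Obj C \<Longrightarrow> bij_betw (\<Phi> A B) (Hom D A B) (Hom C A (FObj \<iota> B))"
    and Phi_nat: "\<And>a b f. a \<in> Arr C \<Longrightarrow> b \<in> Arr D \<Longrightarrow> f \<in> Hom D (Cod C a) (Dom D b) \<Longrightarrow>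
      \<Phi> (Dom C a) (Cod D b) (b \<odot> f \<odot> q a) = FArr \<iota> b \<cdot> \<Phi> (Cod C a) (Dom D b) f \<cdot> a"
begin

abbreviation I where "I \<equiv> FObj \<iota>"
abbreviation Ia where "Ia \<equiv> FArr \<iota>"

lemma section_simps [simp]:
  "B \<in> Obj C \<Longrightarrow> I B \<in> Obj C" "B \<in> Obj C \<Longrightarrow> Ia (Ident D B) = Ident C (I B)"
  "b \<in> Arr D \<Longrightarrow> Ia b \<in> Arr C" "b \<in> Arr D \<Longrightarrow> Dom C (Ia b) = I (Dom D b)" "b \<in> Arr D \<Longrightarrow> Cod C (Ia b) = I (Cod D b)"
  using section_functor unfolding is_functor_def by auto

lemma section_comp: "f \<in> Arr D \<Longrightarrow> g \<in> Arr D \<Longrightarrow> Cod D f = Dom D g \<Longrightarrow> Ia (g \<odot> f) = Ia g \<cdot> Ia f"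
  using section_functor unfolding is_functor_def by auto

lemma D_Obj [simp]: "f \<in> Arr D \<Longrightarrow> Dom D f \<in> Obj C" "f \<in> Arr D \<Longrightarrow> Cod D f \<in> Obj C"
  using D.dom_cod_Obj by auto

text \<open>The adjunct of an arrow of the quotient category.\<close>

definition Ph where "Ph f = \<Phi> (Dom D f) (Cod D f) f"

lemma Ph_simps [simp]:
  assumes "f \<in> Arr D" shows "Ph f \<in> Arr C" "Dom C (Ph f) = Dom D f" "Cod C (Ph f) = I (Cod D f)"
  using bij_betwE[OF Phi_bij[of "Dom D f" "Cod D f"]] assms unfolding Ph_def by auto

lemma Ph_inj: "Ph f = Ph g \<Longrightarrow> f \<in> Arr D \<Longrightarrow> g \<in> Arr D \<Longrightarrow> Dom D f = Dom D g \<Longrightarrow> Cod D f = Cod D g \<Longrightarrow> f = g"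
  using bij_betw_imp_inj_on[OF Phi_bij[of "Dom D g" "Cod D g"]] unfolding Ph_def inj_on_def by auto

lemma Ph_surj:
  assumes "h \<in> Arr C" "Cod C h = I B" "B \<in> Obj C"
  obtains f where "f \<in> Arr D" "Dom D f = Dom C h" "Cod D f = B" "Ph f = h"
proof -
  have "h \<in> \<Phi> (Dom C h) B ` Hom D (Dom C h) B"
    using bij_betw_imp_surj_on[OF Phi_bij[of "Dom C h" B]] assms by simp
  then show thesis using that unfolding Ph_def by auto
qed

lemma Ph_pre: "f \<in> Arr D \<Longrightarrow> a \<in> Arr C \<Longrightarrow> Cod C a = Dom D f \<Longrightarrow> Ph (f \<odot> q a) = Ph f \<cdot> a"
  using Phi_nat[of a "Ident D (Cod D f)" f] Ph_simps[of f] unfolding Ph_def by auto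

lemma Ph_post: "f \<in> Arr D \<Longrightarrow> b \<in> Arr D \<Longrightarrow> Cod D f = Dom D b \<Longrightarrow> Ph (b \<odot> f) = Ia b \<cdot> Ph f"
  using Phi_nat[of "Ident C (Dom D f)" b f] Ph_simps[of f] unfolding Ph_def by auto

text \<open>
  The addition of the Hom groups of \<open>D\<close>, transported along the adjunction.
\<close>

definition addD where
  "addD f g = (THE h. h \<in> Arr D \<and> Dom D h = Dom D g \<and> Cod D h = Cod D g \<and> Ph h = add (Ph f) (Ph g))"

lemma addD:
  assumes "f \<in> Arr D" "g \<in> Arr D" "Dom D f = Dom D g" "Cod D f = Cod D g"
  shows "addD f g \<in> Arr D" "Dom D (addD f g) = Dom D g" "Cod D (addD f g) = Cod D g"
    "Ph (addD f g) = add (Ph f) (Ph g)"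
proof -
  obtain h where h: "h \<in> Arr D" "Dom D h = Dom D g" "Cod D h = Cod D g" "Ph h = add (Ph f) (Ph g)"
    using Ph_surj[of "add (Ph f) (Ph g)" "Cod D g"] assms by auto
  have "addD f g = h"
    unfolding addD_def
  proof (rule the_equality)
    fix k assume "k \<in> Arr D \<and> Dom D k = Dom D g \<and> Cod D k = Cod D g \<and> Ph k = add (Ph f) (Ph g)"
    then show "k = h" by (intro Ph_inj) (use h in simp_all)
  qed (use h in simp)
  then show "addD f g \<in> Arr D" "Dom D (addD f g) = Dom D g" "Cod D (addD f g) = Cod D g"
    "Ph (addD f g) = add (Ph f) (Ph g)" using h by auto
qed

lemma addD_group:
  assumes A: "A \<in> Obj C" and B: "B \<in> Obj C"
  shows "\<exists>z. comm_group \<lparr>carrier = Hom D A B, mult = addD, one = z\<rparr>"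
proof -
  let ?G = "\<lparr>carrier = Hom C A (I B), mult = add, one = nul A (I B)\<rparr>"
  interpret G: comm_group ?G using hom_group[of A "I B"] A B by simp
  obtain z where z: "z \<in> Arr D" "Dom D z = A" "Cod D z = B" "Ph z = nul A (I B)"
    using Ph_surj[of "nul A (I B)" B] A B by auto
  have "comm_group \<lparr>carrier = Hom D A B, mult = addD, one = z\<rparr>"
  proof (rule comm_groupI, simp_all only: partial_object.select_convs monoid.select_convs)
    fix x y assume xy: "x \<in> Hom D A B" "y \<in> Hom D A B"
    then show "addD x y \<in> Hom D A B" by (simp add: addD)
    show "addD x y = addD y x"
      using G.m_comm[of "Ph x" "Ph y"] xy by (intro Ph_inj) (simp_all add: addD)
    fix w assume w: "w \<in> Hom D A B"
    show "addD (addD x y) w = addD x (addD y w)"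
      using G.m_assoc[of "Ph x" "Ph y" "Ph w"] xy w by (intro Ph_inj) (simp_all add: addD)
  next
    show "z \<in> Hom D A B" using z by simp
    fix x assume x: "x \<in> Hom D A B"
    show "addD z x = x" by (rule Ph_inj) (use x z in \<open>simp_all add: addD\<close>)
    obtain m where m: "m \<in> Hom C A (I B)" "add m (Ph x) = nul A (I B)"
      using G.l_inv_ex[of "Ph x"] x by auto
    then obtain y where y: "y \<in> Arr D" "Dom D y = A" "Cod D y = B" "Ph y = m"
      using Ph_surj[of m B] x B by auto
    then have "addD y x = z" by (intro Ph_inj) (use x z m in \<open>simp_all add: addD\<close>)
    then show "\<exists>y\<in>Hom D A B. addD y x = z"
      using y by auto
  qed
  then show ?thesis by blast
qed

text \<open>
  The addition is bilinear on the left by naturality of the adjunction; on the right, naturality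
  applies only to arrows \<open>q a\<close>, and an arbitrary arrow is such an arrow up to some \<open>q s\<close>.
\<close>

lemma preadditive_D: "preadditive D addD"
  unfolding preadditive_def
proof (intro conjI ballI impI category_D)
  fix A B assume "A \<in> Obj D" "B \<in> Obj D"
  then show "\<exists>z. comm_group \<lparr>carrier = Hom D A B, mult = addD, one = z\<rparr>" using addD_group by simp
next
  fix f g h assume "f \<in> Arr D" "g \<in> Hom D (Dom D f) (Cod D f)" "h \<in> Arr D" "Dom D h = Cod D f"
  then show "h \<odot> addD f g = addD (h \<odot> f) (h \<odot> g)"
    by (intro Ph_inj) (auto simp: addD Ph_post comp_add)
next
  fix f g h assume a: "f \<in> Arr D" "g \<in> Hom D (Dom D f) (Cod D f)" "h \<in> Arr D" "Cod D h = Dom D f"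
  obtain s b where fr: "fraction s b h" using fraction_ex[OF a(3)] .
  note s = fractionD[OF fr]
  have r: "x \<odot> h \<odot> q s = x \<odot> q b" if "x \<in> Arr D" "Dom D x = Dom D f" for x
    using that a s by simp
  have "Ph ((addD f g \<odot> h) \<odot> q s) = Ph (addD f g \<odot> q b)"
    using a s(1-5) by (simp add: addD r)
  also have "\<dots> = add (Ph f \<cdot> b) (Ph g \<cdot> b)"
    using a s(1-5) by (simp add: addD Ph_pre comp_add)
  also have "\<dots> = add (Ph (f \<odot> q b)) (Ph (g \<odot> q b))"
    using a s(1-5) by (simp add: Ph_pre)
  also have "\<dots> = add (Ph ((f \<odot> h) \<odot> q s)) (Ph ((g \<odot> h) \<odot> q s))"
    using a s(1-5) by (simp add: r)
  also have "\<dots> = add (Ph (f \<odot> h) \<cdot> s) (Ph (g \<odot> h) \<cdot> s)"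
    using a s(1-5) by (subst (1 2) Ph_pre) auto
  also have "\<dots> = Ph (addD (f \<odot> h) (g \<odot> h) \<odot> q s)"
    using a s(1-5) by (simp add: addD Ph_pre comp_add)
  finally have "(addD f g \<odot> h) \<odot> q s = addD (f \<odot> h) (g \<odot> h) \<odot> q s"
    by (rule Ph_inj) (use a s(1-5) in \<open>auto simp: addD\<close>)
  then show "addD f g \<odot> h = addD (f \<odot> h) (g \<odot> h)"
    by (rule D.epi_cancel[OF q_Sig_epi[OF s(1)]]) (use a s(1-5) in \<open>auto simp: addD\<close>)
qed

text \<open>
  Maps out of \<open>Z\<close> are compared by their adjuncts, maps into \<open>Z\<close> by a representing fraction.
\<close>

lemma zero_object_D:
  assumes Z: "zero_object C Z" shows "zero_object D Z"
  unfolding zero_object_def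
proof (intro conjI ballI)
  note [simp] = zero_object_Obj[OF Z]
  show "Z \<in> Obj D" by simp
  fix B assume "B \<in> Obj D"
  then have B [simp]: "B \<in> Obj C" by simp
  show "\<exists>!f. f \<in> Hom D Z B"
  proof (rule ex1I)
    show "q (nul Z B) \<in> Hom D Z B" by simp
    fix f assume "f \<in> Hom D Z B"
    then show "f = q (nul Z B)" by (intro Ph_inj zero_object_unique(1)[OF Z]) auto
  qed
  show "\<exists>!f. f \<in> Hom D B Z"
  proof (rule ex1I)
    show "q (nul B Z) \<in> Hom D B Z" by simp
    fix f assume f: "f \<in> Hom D B Z"
    then obtain s b where "fraction s b f" using fraction_ex[of f] by auto
    note s = fractionD[OF this]
    have "b = nul B Z \<cdot> s" by (rule zero_object_unique(2)[OF Z]) (use s f in auto)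
    then have "f \<odot> q s = q (nul B Z) \<odot> q s" using s f by (simp flip: q_comp)
    then show "f = q (nul B Z)" by (rule D.epi_cancel[OF q_Sig_epi[OF s(1)]]) (use s f in auto)
  qed
qed

end

sublocale torsion_section \<subseteq> D: preadditive_cat "gabriel_quotient C T" addD
  by unfold_locales (use preadditive_D zero_ex zero_object_D in blast)+

context torsion_section
begin

lemma q_nul [simp]:
  assumes "A \<in> Obj C" "B \<in> Obj C" shows "q (nul A B) = D.nul A B"
proof -
  obtain Z where Z: "zero_object C Z" using zero_ex by blast
  note [simp] = zero_object_Obj[OF Z]
  have "q (nul A Z) = D.nul A Z" using D.zero_object_nul[OF zero_object_D[OF Z], of "q (nul A Z)"] assms by simp
  moreover have "q (nul A B) = q (nul Z B) \<odot> q (nul A Z)" using assms by (simp flip: q_comp)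
  ultimately show ?thesis using assms by simp
qed

lemma Ph_nul [simp]:
  assumes "A \<in> Obj C" "B \<in> Obj C" shows "Ph (D.nul A B) = nul A (I B)"
  using addD(4)[of "D.nul A B" "D.nul A B"] idem_nul[of "Ph (D.nul A B)"] assms by simp

lemma Ph_eq_nul:
  assumes "f \<in> Arr D" "Ph f = nul (Dom D f) (I (Cod D f))" shows "f = D.nul (Dom D f) (Cod D f)"
  by (rule Ph_inj) (use assms in auto)

lemma q_eq_nul:
  assumes "f \<in> Arr C" "q f = D.nul (Dom C f) (Cod C f)"
  obtains z where "z \<in> \<Sigma>" "Cod C z = Dom C f" "f \<cdot> z = nul (Dom C z) (Cod C f)"
  using q_eq_iff[of f "nul (Dom C f) (Cod C f)"] assms that by auto

text \<open>
  As a left adjoint, \<open>q\<close> preserves coproducts; likewise cokernels and direct limits below.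
\<close>

lemma coproduct_q:
  assumes c: "is_coproduct C K F P e" and F: "\<And>k. k \<in> K \<Longrightarrow> F k \<in> Obj C"
  shows "is_coproduct D K F P (\<lambda>k. q (e k))"
  unfolding is_coproduct_def
proof (intro conjI ballI allI impI)
  note c' [simp] = coproductD[OF c]
  show "P \<in> Obj D" by simp
  show "q (e k) \<in> Hom D (F k) P" if "k \<in> K" for k using that by simp
  fix B f assume B: "B \<in> Obj D" and f: "\<forall>k\<in>K. f k \<in> Hom D (F k) B"
  have "Ph (f k) \<in> Hom C (F k) (I B)" if "k \<in> K" for k using f that by auto
  then obtain h where h: "h \<in> Arr C" "Dom C h = P" "Cod C h = I B" "\<And>k. k \<in> K \<Longrightarrow> h \<cdot> e k = Ph (f k)"
    using coproduct_ex[OF c, of "\<lambda>k. Ph (f k)" "I B"] B by auto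
  obtain g where g: "g \<in> Arr D" "Dom D g = P" "Cod D g = B" "Ph g = h"
    using Ph_surj[of h B] h B by auto
  show "\<exists>!h. h \<in> Hom D P B \<and> (\<forall>k\<in>K. h \<odot> q (e k) = f k)"
  proof (rule ex1I)
    have "g \<odot> q (e k) = f k" if "k \<in> K" for k
      by (rule Ph_inj) (use that g f h in \<open>auto simp: Ph_pre\<close>)
    then show "g \<in> Hom D P B \<and> (\<forall>k\<in>K. g \<odot> q (e k) = f k)" using g by simp
    fix g' assume g': "g' \<in> Hom D P B \<and> (\<forall>k\<in>K. g' \<odot> q (e k) = f k)"
    have "Ph g' = h"
    proof (rule coproduct_eq[OF c])
      fix k assume k: "k \<in> K"
      have "Ph g' \<cdot> e k = Ph (g' \<odot> q (e k))" by (rule Ph_pre[symmetric]) (use g' k in auto)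
      also have "\<dots> = h \<cdot> e k" using g' k h by simp
      finally show "Ph g' \<cdot> e k = h \<cdot> e k" .
    qed (use g' h in auto)
    then show "g' = g" by (intro Ph_inj) (use g g' in auto)
  qed
qed

lemma cokernel_q:
  assumes c: "is_cokernel C f c" shows "is_cokernel D (q f) (q c)"
proof (rule D.is_cokernelI)
  note c' [simp] = is_cokernelD(1-3)[OF c]
  show "q f \<in> Arr D" "Dom D (q c) = Cod D (q f)" by auto
  show "q c \<odot> q f = D.nul (Dom D (q f)) (Cod D (q c))"
    by (simp add: is_cokernelD(4)[OF c] flip: q_comp)
  show "is_epi D (q c)"
  proof (rule D.epiI)
    fix u assume u: "u \<in> Arr D" "Dom D u = Cod D (q c)" "u \<odot> q c = D.nul (Dom D (q c)) (Cod D u)"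
    have "Ph u \<cdot> c = nul (Dom C c) (Cod C (Ph u))"
      using arg_cong[OF u(3), of Ph] u(1,2) by (simp add: Ph_pre)
    then have "Ph u = nul (Cod C c) (Cod C (Ph u))"
      using epi_nul[OF is_cokernelD(5)[OF c], of "Ph u"] u by simp
    then show "u = D.nul (Cod D (q c)) (Cod D u)" using Ph_eq_nul[of u] u by simp
  qed simp
  fix h assume h: "h \<in> Arr D" "Dom D h = Cod D (q f)" "h \<odot> q f = D.nul (Dom D (q f)) (Cod D h)"
  have "Ph h \<cdot> f = nul (Dom C f) (Cod C (Ph h))"
    using arg_cong[OF h(3), of Ph] h(1,2) by (simp add: Ph_pre)
  then obtain w where w: "w \<in> Arr C" "Dom C w = Cod C c" "Cod C w = I (Cod D h)" "w \<cdot> c = Ph h"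
    using is_cokernel_factor[OF c, of "Ph h"] h by auto
  obtain u where u: "u \<in> Arr D" "Dom D u = Cod C c" "Cod D u = Cod D h" "Ph u = w"
    using Ph_surj[of w "Cod D h"] w h by auto
  have "u \<odot> q c = h" by (rule Ph_inj) (use u w h in \<open>auto simp: Ph_pre\<close>)
  then show "\<exists>u. u \<in> Arr D \<and> Dom D u = Cod D (q c) \<and> Cod D u = Cod D h \<and> u \<odot> q c = h"
    using u by auto
qed

text \<open>
  This is the exactness of \<open>q\<close> on the side that its being a left adjoint does not give: if \<open>v\<close> is a fraction with
  numerator \<open>g\<close>, then \<open>q m v = 0\<close> means \<open>m g z = 0\<close> for some \<open>z\<close> in \<open>\<Sigma>\<close>, an equation in \<open>C\<close>.
\<close>

lemma mono_q:
  assumes m: "is_mono C m" shows "is_mono D (q m)"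
proof (rule D.monoI)
  note [simp] = mono_Arr[OF m]
  fix v assume v: "v \<in> Arr D" "Cod D v = Dom D (q m)" "q m \<odot> v = D.nul (Dom D v) (Cod D (q m))"
  obtain s g where fr: "fraction s g v" using fraction_ex[OF v(1)] .
  note s = fractionD[OF fr]
  have "q (m \<cdot> g) = q m \<odot> v \<odot> q s" using s v(1,2) by (simp add: q_comp)
  also have "\<dots> = D.nul (Dom C (m \<cdot> g)) (Cod C (m \<cdot> g))"
    using D.comp_whisker[OF v(3), of "q s"] s(1-5) v(1,2) by simp
  finally obtain z where z: "z \<in> \<Sigma>" "Cod C z = Dom C g" "m \<cdot> g \<cdot> z = nul (Dom C z) (Cod C m)"
    using q_eq_nul[of "m \<cdot> g"] s v by auto
  then have "g \<cdot> z = nul (Dom C z) (Cod C g)" using mono_nul[OF m, of "g \<cdot> z"] s v by simp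
  then have "q g \<odot> q z = D.nul (Dom C g) (Cod C g) \<odot> q z"
    using z s(1-5) v(1) by (simp flip: q_comp)
  then have "q g = D.nul (Dom C g) (Cod C g)"
    by (rule D.epi_cancel[OF q_Sig_epi[OF z(1)]]) (use z s v(1) in auto)
  then have "v \<odot> q s = D.nul (Dom D v) (Cod D v) \<odot> q s" using s v(1) by simp
  then have "v = D.nul (Dom D v) (Cod D v)"
    by (rule D.epi_cancel[OF q_Sig_epi[OF s(1)]]) (use s v(1) in auto)
  then show "v = D.nul (Dom D v) (Dom D (q m))" using v(2) by simp
qed (use m mono_Arr in simp)

text \<open>
  If a fraction with numerator \<open>g\<close> is killed by \<open>\<phi>\<close>, then \<open>f g z = 0\<close> for some \<open>z\<close> in \<open>\<Sigma>\<close>, so \<open>g z\<close>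
  factors through \<open>k\<close>.
\<close>

lemma kernel_D:
  assumes \<phi>: "\<phi> \<in> Arr D" and fr: "fraction s f \<phi>" and k: "is_kernel C f k"
  shows "is_kernel D \<phi> (q (s \<cdot> k))"
proof (rule D.is_kernelI[OF \<phi>])
  note s = fractionD[OF fr]
  note k' = is_kernelD[OF k]
  note [simp] = s(1-3) k'(2,3)
  have sk: "q (s \<cdot> k) = q s \<odot> q k" by (simp add: q_comp)
  show "is_mono D (q (s \<cdot> k))" unfolding sk
    by (rule D.mono_comp) (auto simp: q_Sig_mono mono_q k'(5))
  show "Cod D (q (s \<cdot> k)) = Dom D \<phi>" using s by simp
  have f\<phi>: "\<phi> \<odot> q s \<odot> x = q f \<odot> x" if "x \<in> Arr D" "Cod D x = Dom C s" for x
    using D.comp_whisker[OF s(6), of x] that \<phi> s by simp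
  show "\<phi> \<odot> q (s \<cdot> k) = D.nul (Dom D (q (s \<cdot> k))) (Cod D \<phi>)"
  proof -
    have "\<phi> \<odot> q (s \<cdot> k) = q (f \<cdot> k)" unfolding sk using s(4,5) by (simp add: f\<phi> q_comp)
    then show ?thesis using k'(4) s(4,5) \<phi> by simp
  qed
  fix h assume h: "h \<in> Arr D" "Cod D h = Dom D \<phi>" "\<phi> \<odot> h = D.nul (Dom D h) (Cod D \<phi>)"
  define h' where "h' = qi s \<odot> h"
  have h' [simp]: "h' \<in> Arr D" "Dom D h' = Dom D h" "Cod D h' = Dom C s" and sh: "q s \<odot> h' = h"
    unfolding h'_def using h s by auto
  obtain u g where fr: "fraction u g h'" using fraction_ex[OF h'(1)] .
  note u = fractionD[OF fr]
  have "q (f \<cdot> g) = q f \<odot> h' \<odot> q u" using u by (simp add: q_comp)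
  also have "\<dots> = \<phi> \<odot> (q s \<odot> h') \<odot> q u" using u(1-5) \<phi> s(4,5) by (simp add: f\<phi>)
  also have "\<dots> = D.nul (Dom C (f \<cdot> g)) (Cod C (f \<cdot> g))"
    unfolding sh using D.comp_whisker[OF h(3), of "q u"] u(1-5) h(1,2) \<phi> s(5) by simp
  finally obtain z where z: "z \<in> \<Sigma>" "Cod C z = Dom C g" "f \<cdot> g \<cdot> z = nul (Dom C z) (Cod C f)"
    using q_eq_nul[of "f \<cdot> g"] u by auto
  then obtain w where w: "w \<in> Arr C" "Dom C w = Dom C z" "Cod C w = Dom C k" "k \<cdot> w = g \<cdot> z"
    using is_kernel_factor[OF k, of "g \<cdot> z"] u by auto
  have uz: "u \<cdot> z \<in> \<Sigma>" using u z by simp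
  define t where "t = qi (u \<cdot> z)"
  have t: "t \<in> Arr D" "Dom D t = Cod C (u \<cdot> z)" "Cod D t = Dom C (u \<cdot> z)" "q (u \<cdot> z) \<odot> t = Ident D (Cod C (u \<cdot> z))"
    unfolding t_def using qi_simps[OF uz] qi_inverse[OF uz] by auto
  have "h' \<odot> q (u \<cdot> z) = q k \<odot> q w"
    using D.comp_whisker[OF u(6), of "q z"] u(1-5) z(1,2) w by (simp add: q_comp flip: q_comp[of w k])
  then have "h' \<odot> q (u \<cdot> z) \<odot> t = (q k \<odot> q w) \<odot> t"
    using D.comp_whisker[of h' "q (u \<cdot> z)" "q k \<odot> q w" t] u(1-5) z(1,2) w t(1-3) by simp
  then have "h' = q k \<odot> q w \<odot> t" using t u(1-5) z(1,2) w(1-3) by simp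
  then have "q (s \<cdot> k) \<odot> (q w \<odot> t) = h" using sh sk w(1-3) t(1-3) u(1-5) z(1,2) by simp
  then show "\<exists>u. u \<in> Arr D \<and> Dom D u = Dom D h \<and> Cod D u = Dom D (q (s \<cdot> k)) \<and> q (s \<cdot> k) \<odot> u = h"
    using w(1-3) t(1-3) u(1-5) z(1,2) by (intro exI[of _ "q w \<odot> t"]) simp
qed

lemma cokernel_D:
  assumes \<phi>: "\<phi> \<in> Arr D" and fr: "fraction s f \<phi>" and c: "is_cokernel C f c"
  shows "is_cokernel D \<phi> (q c)"
proof (rule D.is_cokernelI[OF \<phi>])
  note s = fractionD[OF fr]
  note c' [simp] = is_cokernelD(1-3)[OF c]
  note cq = cokernel_q[OF c]
  show "is_epi D (q c)" by (rule D.is_cokernelD(5)[OF cq])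
  show "Dom D (q c) = Cod D \<phi>" using s by simp
  have *: "h \<odot> \<phi> \<odot> q s = h \<odot> q f" for h by (simp add: s(6))
  have "q c \<odot> q f = D.nul (Dom C f) (Cod C c)" using D.is_cokernelD(4)[OF cq] by simp
  then have "(q c \<odot> \<phi>) \<odot> q s = D.nul (Dom D \<phi>) (Cod C c) \<odot> q s" using \<phi> s(1-5) by (simp add: *)
  then have "q c \<odot> \<phi> = D.nul (Dom D \<phi>) (Cod C c)"
    by (rule D.epi_cancel[OF q_Sig_epi[OF s(1)]]) (use \<phi> s(1-5) in auto)
  then show "q c \<odot> \<phi> = D.nul (Dom D \<phi>) (Cod D (q c))" by simp
  fix h assume h: "h \<in> Arr D" "Dom D h = Cod D \<phi>" "h \<odot> \<phi> = D.nul (Dom D \<phi>) (Cod D h)"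
  have "h \<odot> q f = (h \<odot> \<phi>) \<odot> q s" using h(1,2) \<phi> s(1-5) by (simp add: *)
  also have "\<dots> = D.nul (Dom D (q f)) (Cod D h)" unfolding h(3) using \<phi> s(1-5) h(1,2) by simp
  finally obtain u where "u \<in> Arr D" "Dom D u = Cod D (q c)" "Cod D u = Cod D h" "u \<odot> q c = h"
    using D.is_cokernel_factor[OF cq, of h] h(1,2) s(2,5) by auto
  then show "\<exists>u. u \<in> Arr D \<and> Dom D u = Cod D (q c) \<and> Cod D u = Cod D h \<and> u \<odot> q c = h"
    by blast
qed

text \<open>
  Represent the monomorphism by \<open>f = n e\<close>, with \<open>n\<close> the image of \<open>f\<close>.  The kernel of \<open>e\<close> is killed by \<open>q\<close>,
  so it is torsion and \<open>q e\<close> is invertible; thus the monomorphism agrees up to isomorphism with \<open>q n\<close>,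
  the kernel of \<open>q c\<close>.  Dually, for an epimorphism the cokernel \<open>c\<close> of \<open>f\<close> is torsion, so \<open>q n\<close> is
  invertible and \<open>q e\<close> is what remains.
\<close>

lemma mono_D_is_kernel:
  assumes m: "is_mono D \<phi>" shows "\<exists>c. is_kernel D c \<phi>"
proof -
  note \<phi> = D.mono_Arr[OF m]
  obtain s f where fr: "fraction s f \<phi>" using fraction_ex[OF \<phi>] .
  note s = fractionD[OF fr]
  note [simp] = \<phi> s(1-5)
  obtain n e c where im: "image_factorization f n e c" using image_factor[OF s(2)] .
  note n = image_factorizationD(1-10)[OF im] and ne = image_factorizationD(11)[OF im]
  note [simp] = n(6-10) is_cokernelD(2,3)[OF n(1)]
  obtain k where k: "is_kernel C e k" using kernel_ex[OF n(7)] .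
  note k' = is_kernelD[OF k]
  note [simp] = k'(2,3)
  have "(n \<cdot> e) \<cdot> k = nul (Dom C k) (Cod C f)" using k'(4) by simp
  then have "f \<cdot> k = nul (Dom C k) (Cod C f)" by (simp only: ne)
  then have "(\<phi> \<odot> q s) \<odot> q k = D.nul (Dom C k) (Cod D \<phi>)" unfolding s(6) by (simp flip: q_comp)
  moreover have "is_mono D (\<phi> \<odot> q s)" by (rule D.mono_comp[OF m]) (auto simp: q_Sig_mono)
  ultimately have "q k = D.nul (Dom C k) (Cod C k)"
    using D.mono_nul[of "\<phi> \<odot> q s" "q k"] by simp
  then obtain z where "z \<in> \<Sigma>" "Cod C z = Dom C k" "k \<cdot> z = nul (Dom C z) (Cod C k)"
    using q_eq_nul[of k] by auto
  then have "Dom C k \<in> T" using mono_torsion[OF k'(5)] by simp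
  then have e: "e \<in> \<Sigma>" using Sig_epiI[OF n(5) k] by simp
  let ?t = "qi e"
  note [simp] = e
  have "is_kernel D (q c) (q (Ident C (Dom C c) \<cdot> n))"
    by (rule kernel_D[where f = c]) (use n(2) in \<open>auto simp: fraction_def\<close>)
  then have kn: "is_kernel D (q c) (q n)" by simp
  have "is_kernel D (q c) \<phi>"
  proof (rule D.is_kernelI[OF _ m])
    show "q c \<odot> \<phi> = D.nul (Dom D \<phi>) (Cod D (q c))"
      using D.is_cokernelD(4)[OF cokernel_D[OF \<phi> fr n(1)]] .
    fix h assume h: "h \<in> Arr D" "Cod D h = Dom D (q c)" "q c \<odot> h = D.nul (Dom D h) (Cod D (q c))"
    then obtain w where w: "w \<in> Arr D" "Dom D w = Dom D h" "Cod D w = Dom C n" "q n \<odot> w = h"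
      using D.is_kernel_factor[OF kn, of h] by auto
    have "\<phi> \<odot> q s \<odot> ?t \<odot> w = q f \<odot> ?t \<odot> w"
      using D.comp_whisker[OF s(6), of "?t \<odot> w"] w(1-3) by simp
    also have "\<dots> = (q n \<odot> q e) \<odot> ?t \<odot> w" by (simp add: ne flip: q_comp)
    also have "\<dots> = h" using w(1-3) by (simp add: w(4))
    finally show "\<exists>u. u \<in> Arr D \<and> Dom D u = Dom D h \<and> Cod D u = Dom D \<phi> \<and> \<phi> \<odot> u = h"
      using w by (intro exI[of _ "q s \<odot> ?t \<odot> w"]) auto
  qed simp_all
  then show ?thesis by blast
qed

lemma epi_D_is_cokernel:
  assumes p: "is_epi D \<phi>" shows "\<exists>k. is_cokernel D k \<phi>"
proof -
  note \<phi> = D.epi_Arr[OF p]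
  obtain s f where fr: "fraction s f \<phi>" using fraction_ex[OF \<phi>] .
  note s = fractionD[OF fr]
  note [simp] = \<phi> s(1-5)
  obtain n e c where im: "image_factorization f n e c" using image_factor[OF s(2)] .
  note n = image_factorizationD(1-10)[OF im] and ne = image_factorizationD(11)[OF im]
  note [simp] = n(6-10) is_cokernelD(2,3)[OF n(1)]
  obtain k where k: "is_kernel C e k" using kernel_ex[OF n(7)] .
  note k' = is_kernelD[OF k]
  note [simp] = k'(2,3)
  have "(n \<cdot> e) \<cdot> k = nul (Dom C k) (Cod C f)" using k'(4) by simp
  then have fk: "f \<cdot> k = nul (Dom C k) (Cod C f)" by (simp only: ne)
  have "q c \<odot> \<phi> = D.nul (Dom D \<phi>) (Cod C c)"
    using D.is_cokernelD(4)[OF cokernel_D[OF \<phi> fr n(1)]] by simp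
  then have "q c = D.nul (Dom C c) (Cod C c)" using D.epi_nul[OF p, of "q c"] by simp
  then obtain z where "z \<in> \<Sigma>" "Cod C z = Dom C c" "c \<cdot> z = nul (Dom C z) (Cod C c)"
    using q_eq_nul[of c] by auto
  then have "Cod C c \<in> T" using epi_torsion[OF is_cokernelD(5)[OF n(1)]] by simp
  then have nS: "n \<in> \<Sigma>" using Sig_monoI[OF n(4,3)] by simp
  define t where "t = qi n"
  have t [simp]: "t \<in> Arr D" "Dom D t = Cod C n" "Cod D t = Dom C n" and tn: "t \<odot> q n = Ident D (Dom C n)"
    unfolding t_def using nS by auto
  have ce: "is_cokernel D (q k) (q e)"
    by (rule cokernel_q, rule epi_is_cokernel_of_kernel[OF n(5) k])
  have *: "h \<odot> \<phi> \<odot> q s = h \<odot> q f" for h by (simp add: s(6))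
  have "is_cokernel D (q (s \<cdot> k)) \<phi>"
  proof (rule D.is_cokernelI[OF _ p])
    show "\<phi> \<odot> q (s \<cdot> k) = D.nul (Dom D (q (s \<cdot> k))) (Cod D \<phi>)"
      using D.comp_whisker[OF s(6), of "q k"] fk by (simp add: q_comp) (simp flip: q_comp)
    fix h assume h: "h \<in> Arr D" "Dom D h = Cod D (q (s \<cdot> k))" "h \<odot> q (s \<cdot> k) = D.nul (Dom D (q (s \<cdot> k))) (Cod D h)"
    then have "(h \<odot> q s) \<odot> q k = D.nul (Dom D (q k)) (Cod D h)" by (simp add: q_comp)
    then obtain w where w: "w \<in> Arr D" "Dom D w = Cod C e" "Cod D w = Cod D h" "w \<odot> q e = h \<odot> q s"
      using D.is_cokernel_factor[OF ce, of "h \<odot> q s"] h by auto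
    have "((w \<odot> t) \<odot> \<phi>) \<odot> q s = w \<odot> t \<odot> q f" using w(1-3) by (simp add: *)
    also have "\<dots> = w \<odot> t \<odot> q n \<odot> q e" by (simp add: ne flip: q_comp)
    also have "\<dots> = h \<odot> q s" using D.comp_whisker[OF tn, of "q e"] w by simp
    finally have "(w \<odot> t) \<odot> \<phi> = h"
      by (rule D.epi_cancel[OF q_Sig_epi[OF s(1)]]) (use w h in auto)
    then show "\<exists>u. u \<in> Arr D \<and> Dom D u = Cod D \<phi> \<and> Cod D u = Cod D h \<and> u \<odot> \<phi> = h"
      using w(1-3) by (intro exI[of _ "w \<odot> t"]) auto
  qed simp_all
  then show ?thesis by blast
qed

lemma abelian_D: "abelian D"
  unfolding abelian_def
proof (intro conjI ballI allI impI)
  show "\<exists>add. preadditive D add" using preadditive_D by blast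
  show "\<exists>Z. zero_object D Z" by (rule D.zero_ex)
  fix A B assume "A \<in> Obj D" "B \<in> Obj D"
  then have AB: "A \<in> Obj C" "B \<in> Obj C" by auto
  then obtain P i j where "is_binary_coproduct C A B P i j"
    using abelian unfolding abelian_def by blast
  then have "is_coproduct D UNIV (case_bool A B) P (\<lambda>b. q (case_bool i j b))"
    unfolding is_binary_coproduct_def by (rule coproduct_q) (use AB in \<open>auto split: bool.split\<close>)
  moreover have "(\<lambda>b. q (case_bool i j b)) = case_bool (q i) (q j)" by (rule ext) (simp split: bool.split)
  ultimately have "is_binary_coproduct D A B P (q i) (q j)" unfolding is_binary_coproduct_def by simp
  then show "\<exists>P i j. is_binary_coproduct D A B P i j" by blast
next
  fix \<phi> assume \<phi>: "\<phi> \<in> Arr D"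
  obtain s f where fr: "fraction s f \<phi>" using fraction_ex[OF \<phi>] .
  note s = fractionD[OF fr]
  obtain k where "is_kernel C f k" using kernel_ex[OF s(2)] .
  then show "\<exists>k. is_kernel D \<phi> k" using kernel_D[OF \<phi> fr] by blast
  obtain c where "is_cokernel C f c" using cokernel_ex[OF s(2)] .
  then show "\<exists>c. is_cokernel D \<phi> c" using cokernel_D[OF \<phi> fr] by blast
next
  show "\<exists>f. is_kernel D f m" if "is_mono D m" for m using mono_D_is_kernel[OF that] .
  show "\<exists>f. is_cokernel D f p" if "is_epi D p" for p using epi_D_is_cokernel[OF that] .
qed

end

sublocale torsion_section \<subseteq> D: abelian_cat "gabriel_quotient C T" addD
  by unfold_locales (rule abelian_D)

section \<open>Direct limits and finitely presented objects\<close>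

context category_loc
begin

lemma direct_systemD:
  assumes "direct_system \<kappa> C S"
  shows "small \<kappa> (Idx S)" "Idx S \<noteq> {}" "(i, j) \<in> Ord S \<Longrightarrow> i \<in> Idx S" "(i, j) \<in> Ord S \<Longrightarrow> j \<in> Idx S"
    "i \<in> Idx S \<Longrightarrow> (i, i) \<in> Ord S" "(i, j) \<in> Ord S \<Longrightarrow> (j, k) \<in> Ord S \<Longrightarrow> (i, k) \<in> Ord S"
    "i \<in> Idx S \<Longrightarrow> DObj S i \<in> Obj C"
    "(i, j) \<in> Ord S \<Longrightarrow> DArr S i j \<in> Arr C" "(i, j) \<in> Ord S \<Longrightarrow> Dom C (DArr S i j) = DObj S i"
    "(i, j) \<in> Ord S \<Longrightarrow> Cod C (DArr S i j) = DObj S j"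
    "(i, j) \<in> Ord S \<Longrightarrow> (j, k) \<in> Ord S \<Longrightarrow> DArr S i k = DArr S j k \<cdot> DArr S i j"
  using assms unfolding direct_system_def preorder_on_def refl_on_def trans_def by auto

lemma direct_system_upper:
  assumes "direct_system \<kappa> C S" "i \<in> Idx S" "j \<in> Idx S"
  obtains k where "(i, k) \<in> Ord S" "(j, k) \<in> Ord S"
  using assms unfolding direct_system_def by blast

lemma is_coconeD:
  assumes "is_cocone C S L l"
  shows "L \<in> Obj C" "i \<in> Idx S \<Longrightarrow> l i \<in> Arr C" "i \<in> Idx S \<Longrightarrow> Dom C (l i) = DObj S i"
    "i \<in> Idx S \<Longrightarrow> Cod C (l i) = L" "(i, j) \<in> Ord S \<Longrightarrow> l j \<cdot> DArr S i j = l i"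
  using assms unfolding is_cocone_def by auto

lemma limit_ex:
  assumes "is_direct_limit C S L l" "is_cocone C S M m"
  obtains h where "h \<in> Arr C" "Dom C h = L" "Cod C h = M" "\<And>i. i \<in> Idx S \<Longrightarrow> h \<cdot> l i = m i"
proof -
  have "\<exists>!h. h \<in> Hom C L M \<and> (\<forall>i\<in>Idx S. h \<cdot> l i = m i)"
    using assms unfolding is_direct_limit_def by blast
  then show thesis using that by auto
qed

lemma limit_cocone: "is_direct_limit C S L l \<Longrightarrow> is_cocone C S L l"
  unfolding is_direct_limit_def by blast

lemma cocone_comp:
  assumes "direct_system \<kappa> C S" "is_cocone C S L l" "h \<in> Arr C" "Dom C h = L"
  shows "is_cocone C S (Cod C h) (\<lambda>i. h \<cdot> l i)"
  unfolding is_cocone_def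
  using is_coconeD[OF assms(2)] direct_systemD(3,4,8-10)[OF assms(1)] assms(3,4) by auto

lemma limit_eq:
  assumes "direct_system \<kappa> C S" "is_direct_limit C S L l" "h \<in> Arr C" "h' \<in> Arr C" "Dom C h = L" "Dom C h' = L"
    "Cod C h = Cod C h'" "\<And>i. i \<in> Idx S \<Longrightarrow> h \<cdot> l i = h' \<cdot> l i"
  shows "h = h'"
proof -
  have "is_cocone C S (Cod C h) (\<lambda>i. h \<cdot> l i)"
    by (rule cocone_comp[OF assms(1) limit_cocone[OF assms(2)] assms(3,5)])
  then have "\<exists>!k. k \<in> Hom C L (Cod C h) \<and> (\<forall>i\<in>Idx S. k \<cdot> l i = h \<cdot> l i)"
    using assms(2) unfolding is_direct_limit_def by blast
  then show ?thesis using assms by (metis Hom_iff)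
qed

end

text \<open>
  For the canonical map from a direct limit of Hom sets this yields the two statements in
  \<open>set_direct_limit_bij_iff\<close>: maps to the limit lift to some stage, and maps that agree in the limit
  agree at some stage.
\<close>

lemma bij_betw_quotient_iff:
  assumes R: "equiv A R" and g: "\<And>x y. (x, y) \<in> R \<Longrightarrow> g x = g y"
  shows "bij_betw (\<lambda>\<xi>. the_elem (g ` \<xi>)) (A // R) H \<longleftrightarrow>
    g ` A = H \<and> (\<forall>x\<in>A. \<forall>y\<in>A. g x = g y \<longrightarrow> (x, y) \<in> R)"
proof -
  have e: "the_elem (g ` (R `` {x})) = g x" if "x \<in> A" for x
  proof -
    have "x \<in> R `` {x}" by (rule equiv_class_self[OF R that])
    moreover have "g y = g x" if "y \<in> R `` {x}" for y using that g[of x y] by simp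
    ultimately have "g ` (R `` {x}) = {g x}" by blast
    then show ?thesis by simp
  qed
  have Q: "A // R = (\<lambda>x. R `` {x}) ` A" by (auto simp: quotient_def)
  have "(\<lambda>\<xi>. the_elem (g ` \<xi>)) ` (A // R) = g ` A"
    unfolding Q image_image using e by simp
  moreover have "inj_on (\<lambda>\<xi>. the_elem (g ` \<xi>)) (A // R) \<longleftrightarrow> (\<forall>x\<in>A. \<forall>y\<in>A. g x = g y \<longrightarrow> (x, y) \<in> R)"
    unfolding Q inj_on_def using e eq_equiv_class_iff[OF R] by simp
  ultimately show ?thesis unfolding bij_betw_def by blast
qed

context category_loc
begin

lemma set_direct_limit_bij_iff:
  assumes S: "direct_system \<kappa> C S" and l: "is_cocone C S L l"
  shows "bij_betw (\<lambda>\<xi>. the_elem ((\<lambda>(i, u). l i \<cdot> u) ` \<xi>))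
      (set_direct_limit (Idx S) (Ord S) (\<lambda>i. Hom C X (DObj S i)) (\<lambda>i j u. DArr S i j \<cdot> u)) (Hom C X L) \<longleftrightarrow>
    (\<forall>u\<in>Hom C X L. \<exists>i\<in>Idx S. \<exists>a\<in>Hom C X (DObj S i). l i \<cdot> a = u) \<and>
    (\<forall>i\<in>Idx S. \<forall>j\<in>Idx S. \<forall>a\<in>Hom C X (DObj S i). \<forall>b\<in>Hom C X (DObj S j). l i \<cdot> a = l j \<cdot> b \<longrightarrow>
      (\<exists>k. (i, k) \<in> Ord S \<and> (j, k) \<in> Ord S \<and> DArr S i k \<cdot> a = DArr S j k \<cdot> b))"
proof -
  note s = direct_systemD[OF S] and l' = is_coconeD[OF l]
  define A where "A = Sigma (Idx S) (\<lambda>i. Hom C X (DObj S i))"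
  define R where "R = {((i, x), (j, y)). (i, x) \<in> A \<and> (j, y) \<in> A \<and>
        (\<exists>k. (i, k) \<in> Ord S \<and> (j, k) \<in> Ord S \<and> DArr S i k \<cdot> x = DArr S j k \<cdot> y)}"
  have push: "DArr S i m \<cdot> x = DArr S k m \<cdot> DArr S i k \<cdot> x"
    if "(i, x) \<in> A" "(i, k) \<in> Ord S" "(k, m) \<in> Ord S" for i x k m
    using that(1) s(8-10)[OF that(2)] s(8-10)[OF that(3)] unfolding A_def s(11)[OF that(2,3)] by simp
  have "equiv A R"
  proof (rule equivI)
    show "R \<subseteq> A \<times> A" unfolding R_def by auto
    show "refl_on A R" unfolding refl_on_def R_def using s(5) by (auto simp: A_def)
    show "sym R"
      unfolding sym_def R_def by clarsimp metis
    show "trans R"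
    proof (rule transI, clarify)
      fix i x j y m z assume "((i, x), (j, y)) \<in> R" "((j, y), (m, z)) \<in> R"
      then obtain k k' where a: "(i, x) \<in> A" "(j, y) \<in> A" "(m, z) \<in> A"
        and k: "(i, k) \<in> Ord S" "(j, k) \<in> Ord S" "DArr S i k \<cdot> x = DArr S j k \<cdot> y"
        and k': "(j, k') \<in> Ord S" "(m, k') \<in> Ord S" "DArr S j k' \<cdot> y = DArr S m k' \<cdot> z"
        unfolding R_def by auto
      obtain n where n: "(k, n) \<in> Ord S" "(k', n) \<in> Ord S"
        using direct_system_upper[OF S] s(4)[OF k(1)] s(4)[OF k'(1)] by metis
      have "DArr S i n \<cdot> x = DArr S k n \<cdot> DArr S j k \<cdot> y" using push[OF a(1) k(1) n(1)] k(3) by simp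
      also have "\<dots> = DArr S k' n \<cdot> DArr S j k' \<cdot> y"
        using push[OF a(2) k(2) n(1)] push[OF a(2) k'(1) n(2)] by simp
      also have "\<dots> = DArr S m n \<cdot> z" using push[OF a(3) k'(2) n(2)] k'(3) by simp
      finally have "DArr S i n \<cdot> x = DArr S m n \<cdot> z" .
      moreover have "(i, n) \<in> Ord S" "(m, n) \<in> Ord S" using s(6) k k' n by blast+
      ultimately show "((i, x), (m, z)) \<in> R" unfolding R_def using a by blast
    qed
  qed
  moreover have "(\<lambda>(i, u). l i \<cdot> u) p = (\<lambda>(i, u). l i \<cdot> u) p'" if "(p, p') \<in> R" for p p'
  proof -
    obtain i x j y k where p: "p = (i, x)" "p' = (j, y)" and a: "(i, x) \<in> A" "(j, y) \<in> A"
      and k: "(i, k) \<in> Ord S" "(j, k) \<in> Ord S" "DArr S i k \<cdot> x = DArr S j k \<cdot> y"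
      using \<open>(p, p') \<in> R\<close> unfolding R_def by auto
    have *: "l k \<cdot> DArr S i k \<cdot> x = l i \<cdot> x" if "(i, x) \<in> A" "(i, k) \<in> Ord S" for i x
      using that(1) s(3,4,8-10)[OF that(2)] l'(1-4) comp_whisker[OF l'(5)[OF that(2)], of x]
      unfolding A_def by simp
    show ?thesis unfolding p using *[OF a(1) k(1)] *[OF a(2) k(2)] k(3) by simp
  qed
  ultimately have "bij_betw (\<lambda>\<xi>. the_elem ((\<lambda>(i, u). l i \<cdot> u) ` \<xi>)) (A // R) (Hom C X L) \<longleftrightarrow>
    (\<lambda>(i, u). l i \<cdot> u) ` A = Hom C X L \<and>
    (\<forall>x\<in>A. \<forall>y\<in>A. (\<lambda>(i, u). l i \<cdot> u) x = (\<lambda>(i, u). l i \<cdot> u) y \<longrightarrow> (x, y) \<in> R)"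
    by (rule bij_betw_quotient_iff)
  moreover have "set_direct_limit (Idx S) (Ord S) (\<lambda>i. Hom C X (DObj S i)) (\<lambda>i j u. DArr S i j \<cdot> u) = A // R"
    unfolding set_direct_limit_def A_def R_def ..
  moreover have "(\<lambda>(i, u). l i \<cdot> u) ` A = Hom C X L \<longleftrightarrow>
      (\<forall>u\<in>Hom C X L. \<exists>i\<in>Idx S. \<exists>a\<in>Hom C X (DObj S i). l i \<cdot> a = u)" (is "?a \<longleftrightarrow> ?b")
  proof -
    have "(\<lambda>(i, u). l i \<cdot> u) ` A \<subseteq> Hom C X L" unfolding A_def using l' by auto
    then have "?a \<longleftrightarrow> Hom C X L \<subseteq> (\<lambda>(i, u). l i \<cdot> u) ` A" by blast
    also have "\<dots> \<longleftrightarrow> ?b" unfolding A_def subset_iff image_iff by force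
    finally show ?thesis .
  qed
  moreover have "(\<forall>x\<in>A. \<forall>y\<in>A. (\<lambda>(i, u). l i \<cdot> u) x = (\<lambda>(i, u). l i \<cdot> u) y \<longrightarrow> (x, y) \<in> R) \<longleftrightarrow>
    (\<forall>i\<in>Idx S. \<forall>j\<in>Idx S. \<forall>a\<in>Hom C X (DObj S i). \<forall>b\<in>Hom C X (DObj S j). l i \<cdot> a = l j \<cdot> b \<longrightarrow>
      (\<exists>k. (i, k) \<in> Ord S \<and> (j, k) \<in> Ord S \<and> DArr S i k \<cdot> a = DArr S j k \<cdot> b))"
  proof -
    have "(\<forall>x\<in>A. P x) \<longleftrightarrow> (\<forall>i\<in>Idx S. \<forall>a\<in>Hom C X (DObj S i). P (i, a))" for P
      unfolding A_def by auto
    then show ?thesis unfolding R_def A_def by auto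
  qed
  ultimately show ?thesis by simp
qed

lemma fp_lift:
  fixes \<kappa> :: "'u rel" and S :: "('u, 'o, 'a) dsys"
  assumes "finitely_presented \<kappa> C X" "direct_system \<kappa> C S" "is_direct_limit C S L l"
    "u \<in> Arr C" "Dom C u = X" "Cod C u = L"
  obtains i a where "i \<in> Idx S" "a \<in> Arr C" "Dom C a = X" "Cod C a = DObj S i" "l i \<cdot> a = u"
proof -
  have "\<exists>i\<in>Idx S. \<exists>a\<in>Hom C X (DObj S i). l i \<cdot> a = u"
    using assms set_direct_limit_bij_iff[OF assms(2) limit_cocone[OF assms(3)], of X]
    unfolding finitely_presented_def by simp
  then show thesis using that by auto
qed

lemma fp_equal:
  fixes \<kappa> :: "'u rel" and S :: "('u, 'o, 'a) dsys"
  assumes "finitely_presented \<kappa> C X" "direct_system \<kappa> C S" "is_direct_limit C S L l"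
    "i \<in> Idx S" "j \<in> Idx S" "a \<in> Arr C" "Dom C a = X" "Cod C a = DObj S i" "b \<in> Arr C" "Dom C b = X" "Cod C b = DObj S j"
    "l i \<cdot> a = l j \<cdot> b"
  obtains k where "(i, k) \<in> Ord S" "(j, k) \<in> Ord S" "DArr S i k \<cdot> a = DArr S j k \<cdot> b"
proof -
  have "\<exists>k. (i, k) \<in> Ord S \<and> (j, k) \<in> Ord S \<and> DArr S i k \<cdot> a = DArr S j k \<cdot> b"
    using assms set_direct_limit_bij_iff[OF assms(2) limit_cocone[OF assms(3)], of X]
    unfolding finitely_presented_def by simp
  then show thesis using that by auto
qed

lemma direct_system_map:
  assumes F: "is_functor C D F" and S: "direct_system \<kappa> C S"
  shows "direct_system \<kappa> D (map_dsys F S)"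
proof -
  note s = direct_systemD[OF S]
  note F' = F[unfolded is_functor_def]
  have "FArr F (DArr S i k) = FArr F (DArr S j k) \<cdot>\<^bsub>D\<^esub> FArr F (DArr S i j)" if "(i, j) \<in> Ord S" "(j, k) \<in> Ord S" for i j k
    using F' s(8-10)[OF that(1)] s(8-10)[OF that(2)] unfolding s(11)[OF that] by simp
  moreover have "FArr F (DArr S i j) \<in> Hom D (FObj F (DObj S i)) (FObj F (DObj S j))" if "(i, j) \<in> Ord S" for i j
    using F' s(8-10)[OF that] by metis
  ultimately show ?thesis
    using S F' unfolding direct_system_def map_dsys_def by simp
qed

end

text \<open>
  Let \<open>t B\<close> be the endomorphism of \<open>P\<close> that kills the summands in \<open>B\<close> and fixes the others; these
  maps stand in for the finite subsums.  Over the directed set of finite subsets \<open>M\<close> of the index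
  set, the constant objects \<open>P\<close> with transition maps \<open>t (M' - M)\<close> have the direct limit \<open>P\<close>, via the
  maps \<open>t (K - M)\<close>.  So a map to \<open>P\<close> factors through some \<open>t (K - M)\<close>, which is a finite sum of maps
  through the summands.
\<close>

lemma (in preadditive_cat) fp_hom_coproduct_zero:
  fixes \<kappa> :: "'u rel" and K :: "'u set"
  assumes inacc: "inaccessible \<kappa>" and fp: "finitely_presented \<kappa> C X" and K: "small \<kappa> K"
    and c: "is_coproduct C K F P e" and F: "\<And>k. k \<in> K \<Longrightarrow> F k \<in> Obj C"
    and zero: "\<And>k u. k \<in> K \<Longrightarrow> u \<in> Arr C \<Longrightarrow> Dom C u = X \<Longrightarrow> Cod C u = F k \<Longrightarrow> u = nul X (F k)"
    and \<psi>: "\<psi> \<in> Arr C" "Dom C \<psi> = X" "Cod C \<psi> = P"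
  shows "\<psi> = nul X P"
proof -
  note c' = coproductD[OF c]
  have PO [simp]: "P \<in> Obj C" by (rule c'(1))
  note e [simp] = c'(2-4) F
  have XO [simp]: "X \<in> Obj C" using fp by (simp add: finitely_presented_def)
  define Fin where "Fin = {M. M \<subseteq> K \<and> finite M}"
  have "small \<kappa> (Pow K)" using inacc K by (simp add: inaccessible_def small_def)
  then have "small \<kappa> Fin" by (rule small_subset) (auto simp: Fin_def)
  then obtain N :: "'u set" and f where N: "small \<kappa> N" and f: "bij_betw f N Fin"
    using small_encode[OF inacc] by metis
  have fFin: "f x \<subseteq> K" "finite (f x)" if "x \<in> N" for x
    using bij_betwE[OF f] that by (auto simp: Fin_def)
  have fex: "\<exists>x\<in>N. f x = M" if "M \<subseteq> K" "finite M" for M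
  proof -
    have "M \<in> f ` N" using bij_betw_imp_surj_on[OF f] that by (simp add: Fin_def)
    then show ?thesis by blast
  qed
  have "\<exists>h. h \<in> Hom C P P \<and> (\<forall>k\<in>K. h \<cdot> e k = (if k \<in> B then nul (F k) P else e k))" for B
    by (rule coproduct_ex[OF c, of "\<lambda>k. if k \<in> B then nul (F k) P else e k" P]) auto
  then obtain t where t0: "\<And>B. t B \<in> Hom C P P \<and> (\<forall>k\<in>K. t B \<cdot> e k = (if k \<in> B then nul (F k) P else e k))"
    by metis
  then have t [simp]: "t B \<in> Arr C" "Dom C (t B) = P" "Cod C (t B) = P"
    and te: "k \<in> K \<Longrightarrow> t B \<cdot> e k = (if k \<in> B then nul (F k) P else e k)" for B k
    by auto
  have tt: "t B \<cdot> t B' = t B''" if "B \<inter> K \<subseteq> B''" "B' \<inter> K \<subseteq> B''" "B'' \<subseteq> B \<union> B'" for B B' B''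
  proof (rule coproduct_eq[OF c])
    fix k assume k: "k \<in> K"
    show "(t B \<cdot> t B') \<cdot> e k = t B'' \<cdot> e k"
      using k that te[OF k, of B] te[OF k, of B'] te[OF k, of B''] by (auto split: if_splits)
  qed auto
  have t0: "t {} = Ident C P" by (rule coproduct_eq[OF c]) (auto simp: te)
  have tK: "t K = nul P P" by (rule coproduct_eq[OF c]) (auto simp: te)
  define S where "S = \<lparr>Idx = N, Ord = {(x, y). x \<in> N \<and> y \<in> N \<and> f x \<subseteq> f y}, DObj = \<lambda>_. P,
    DArr = \<lambda>x y. t (f y - f x)\<rparr>"
  have S: "Idx S = N" "(x, y) \<in> Ord S \<longleftrightarrow> x \<in> N \<and> y \<in> N \<and> f x \<subseteq> f y" "DObj S x = P"
    "DArr S x y = t (f y - f x)" for x y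
    unfolding S_def by auto
  have dS: "direct_system \<kappa> C S"
    unfolding direct_system_def S
  proof (intro conjI ballI allI impI)
    show "N \<noteq> {}" using fex[of "{}"] by auto
    show "preorder_on N (Ord S)"
      unfolding preorder_on_def refl_on_def trans_def using S(2) by auto
    fix x y assume xy: "x \<in> N" "y \<in> N"
    obtain k where "k \<in> N" "f k = f x \<union> f y"
      using fex[of "f x \<union> f y"] fFin[OF xy(1)] fFin[OF xy(2)] by auto
    then show "\<exists>k\<in>N. (x \<in> N \<and> k \<in> N \<and> f x \<subseteq> f k) \<and> y \<in> N \<and> k \<in> N \<and> f y \<subseteq> f k"
      using xy by (intro bexI[of _ k]) simp_all
  next
    fix x y z assume "x \<in> N \<and> y \<in> N \<and> f x \<subseteq> f y" "y \<in> N \<and> z \<in> N \<and> f y \<subseteq> f z"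
    then show "t (f z - f x) = t (f z - f y) \<cdot> t (f y - f x)"
      by (intro tt[symmetric]) auto
  qed (use N t0 in auto)
  define l where "l x = t (K - f x)" for x
  have cocone: "is_cocone C S P l"
    unfolding is_cocone_def S l_def
  proof (intro conjI ballI allI impI)
    fix x y assume a: "x \<in> N \<and> y \<in> N \<and> f x \<subseteq> f y"
    then show "t (K - f y) \<cdot> t (f y - f x) = t (K - f x)"
      by (intro tt) (use fFin a in auto)
  qed auto
  have "is_direct_limit C S P l"
    unfolding is_direct_limit_def
  proof (intro conjI cocone allI impI)
    fix M m assume m: "is_cocone C S M m"
    note m' = is_coconeD[OF m, unfolded S]
    note [simp] = m'(1-4)
    have "\<exists>y. y \<in> N \<and> f y = {k}" if "k \<in> K" for k
      using fex[of "{k}"] that by auto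
    then have "\<exists>x. \<forall>k\<in>K. x k \<in> N \<and> f (x k) = {k}"
      by (intro bchoice) blast
    then obtain x where x: "\<And>k. k \<in> K \<Longrightarrow> x k \<in> N \<and> f (x k) = {k}" by blast
    obtain h where h [simp]: "h \<in> Arr C" "Dom C h = P" "Cod C h = M" and he: "\<And>k. k \<in> K \<Longrightarrow> h \<cdot> e k = m (x k) \<cdot> e k"
      by (rule coproduct_ex[OF c, of "\<lambda>k. m (x k) \<cdot> e k" M]) (use x in auto)
    have me: "m y \<cdot> e k = (if k \<in> f y then h \<cdot> e k else nul (F k) M)" if y: "y \<in> N" and k: "k \<in> K" for y k
    proof (cases "k \<in> f y")
      case True
      then have "m y \<cdot> t (f y - f (x k)) = m (x k)" using m'(5)[of "x k" y] x[OF k] y by auto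
      moreover have "m y \<cdot> t (f y - f (x k)) \<cdot> e k = m y \<cdot> e k" using te[OF k] x[OF k] by simp
      ultimately have "m y \<cdot> e k = m (x k) \<cdot> e k"
        using comp_whisker[of "m y" "t (f y - f (x k))" "m (x k)" "e k"] y k x[OF k] by simp
      then show ?thesis using True he[OF k] by simp
    next
      case False
      obtain z where z: "z \<in> N" "f z = insert k (f y)" using fex[of "insert k (f y)"] fFin[OF y] k by auto
      then have "m z \<cdot> t (f z - f y) = m y" using m'(5)[of y z] y by auto
      moreover have "m z \<cdot> t (f z - f y) \<cdot> e k = nul (F k) M" using te[OF k, of "f z - f y"] z False k by simp
      ultimately have "m y \<cdot> e k = nul (F k) M"
        using comp_whisker[of "m z" "t (f z - f y)" "m y" "e k"] y z k by simp
      then show ?thesis using False by simp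
    qed
    show "\<exists>!h. h \<in> Hom C P M \<and> (\<forall>i\<in>Idx S. h \<cdot> l i = m i)"
    proof (rule ex1I)
      have "h \<cdot> l y = m y" if y: "y \<in> N" for y
      proof (rule coproduct_eq[OF c])
        fix k assume k: "k \<in> K"
        show "(h \<cdot> l y) \<cdot> e k = m y \<cdot> e k"
          using k me[OF y k] te[OF k, of "K - f y"] unfolding l_def by auto
      qed (use y in \<open>auto simp: l_def\<close>)
      then show "h \<in> Hom C P M \<and> (\<forall>i\<in>Idx S. h \<cdot> l i = m i)" by (simp add: S)
      fix g assume g: "g \<in> Hom C P M \<and> (\<forall>i\<in>Idx S. g \<cdot> l i = m i)"
      show "g = h"
      proof (rule coproduct_eq[OF c])
        fix k assume k: "k \<in> K"
        have "g \<cdot> l (x k) = m (x k)" using g x[OF k] by (simp add: S)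
        moreover have "g \<cdot> l (x k) \<cdot> e k = g \<cdot> e k" using te[OF k] x[OF k] by (simp add: l_def)
        ultimately have "g \<cdot> e k = m (x k) \<cdot> e k"
          using comp_whisker[of g "l (x k)" "m (x k)" "e k"] g k x[OF k] by (simp add: l_def)
        then show "g \<cdot> e k = h \<cdot> e k" using he[OF k] by simp
      qed (use g in auto)
    qed
  qed
  then obtain x a where x: "x \<in> N" and a: "a \<in> Arr C" "Dom C a = X" "Cod C a = P" and \<psi>a: "l x \<cdot> a = \<psi>"
    using fp_lift[OF fp dS _ \<psi>] by (auto simp: S)
  have "t (K - M) \<cdot> a = nul X P" if "finite M" "M \<subseteq> K" for M
    using that
  proof (induction M rule: finite_induct)
    case empty
    then show ?case using a by (simp add: tK)
  next
    case (insert k M)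
    then have k: "k \<in> K" by simp
    obtain p where p [simp]: "p \<in> Arr C" "Dom C p = P" "Cod C p = F k"
      and pe: "\<And>j. j \<in> K \<Longrightarrow> p \<cdot> e j = (if j = k then Ident C (F k) else nul (F j) (F k))"
      by (rule coproduct_ex[OF c, of "\<lambda>j. if j = k then Ident C (F k) else nul (F j) (F k)" "F k"])
        (use k in auto)
    have "t (K - insert k M) = add (t (K - M)) (e k \<cdot> p)"
    proof (rule coproduct_eq[OF c])
      fix j assume j: "j \<in> K"
      show "t (K - insert k M) \<cdot> e j = add (t (K - M)) (e k \<cdot> p) \<cdot> e j"
        using te[OF j] pe[OF j] insert.hyps k j by (auto simp: comp_add)
    qed (use k in auto)
    moreover have "p \<cdot> a = nul X (F k)" by (rule zero[OF k]) (use a in auto)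
    ultimately show ?case using insert k a by (simp add: comp_add)
  qed
  then show ?thesis using \<psi>a fFin[OF x] unfolding l_def by simp
qed

text \<open>
  Cokernels always commute with direct limits; that a direct limit of monomorphisms is monic is tested on maps from the generators,
  which lift to a finite stage.
\<close>

lemma (in abelian_cat) fp_generators_exact_direct_limits:
  fixes \<kappa> :: "'u rel"
  assumes gen: "generates C G" and fp: "\<And>X. X \<in> G \<Longrightarrow> finitely_presented \<kappa> C X"
  shows "exact_direct_limits \<kappa> C"
  unfolding exact_direct_limits_def
proof (intro allI impI)
  fix A1 A2 A3 :: "('u, 'a, 'b) dsys" and L1 l1 L2 l2 L3 l3 \<phi> \<psi> f g
  assume S1: "direct_system \<kappa> C A1" and S2: "direct_system \<kappa> C A2" and S3: "direct_system \<kappa> C A3"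
    and I [simp]: "Idx A2 = Idx A1" "Idx A3 = Idx A1" "Ord A2 = Ord A1" "Ord A3 = Ord A1"
    and L1: "is_direct_limit C A1 L1 l1" and L2: "is_direct_limit C A2 L2 l2" and L3: "is_direct_limit C A3 L3 l3"
    and se: "\<forall>i\<in>Idx A1. \<phi> i \<in> Hom C (DObj A1 i) (DObj A2 i) \<and> \<psi> i \<in> Hom C (DObj A2 i) (DObj A3 i) \<and>
        short_exact C (\<phi> i) (\<psi> i)"
    and nat: "\<forall>i j. (i, j) \<in> Ord A1 \<longrightarrow> \<phi> j \<cdot> DArr A1 i j = DArr A2 i j \<cdot> \<phi> i \<and> \<psi> j \<cdot> DArr A2 i j = DArr A3 i j \<cdot> \<psi> i"
    and f: "f \<in> Hom C L1 L2" and g: "g \<in> Hom C L2 L3"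
    and fg: "\<forall>i\<in>Idx A1. f \<cdot> l1 i = l2 i \<cdot> \<phi> i \<and> g \<cdot> l2 i = l3 i \<cdot> \<psi> i"
  have f' [simp]: "f \<in> Arr C" "Dom C f = L1" "Cod C f = L2" "g \<in> Arr C" "Dom C g = L2" "Cod C g = L3"
    using f g by auto
  note c1 = is_coconeD[OF limit_cocone[OF L1]] and c2 = is_coconeD[OF limit_cocone[OF L2]]
    and c3 = is_coconeD[OF limit_cocone[OF L3]]
  note s1 = direct_systemD[OF S1] and s2 = direct_systemD[OF S2] and s3 = direct_systemD[OF S3]
  note [simp] = c1(1-4) c2(1-4) c3(1-4)
  have p [simp]: "\<phi> i \<in> Arr C" "Dom C (\<phi> i) = DObj A1 i" "Cod C (\<phi> i) = DObj A2 i"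
      "\<psi> i \<in> Arr C" "Dom C (\<psi> i) = DObj A2 i" "Cod C (\<psi> i) = DObj A3 i"
    and ck: "is_kernel C (\<psi> i) (\<phi> i)" "is_cokernel C (\<phi> i) (\<psi> i)"
    if "i \<in> Idx A1" for i
    using se that by (auto simp: short_exact_def)
  have fl: "f \<cdot> l1 i = l2 i \<cdot> \<phi> i" "g \<cdot> l2 i = l3 i \<cdot> \<psi> i" if "i \<in> Idx A1" for i
    using fg that by auto
  have monof: "is_mono C f"
    unfolding is_mono_def
  proof (intro conjI ballI impI f')
    fix W u v assume W: "W \<in> Obj C" and "u \<in> Hom C W (Dom C f)" "v \<in> Hom C W (Dom C f)" and fuv: "f \<cdot> u = f \<cdot> v"
    then have uv [simp]: "u \<in> Arr C" "Dom C u = W" "Cod C u = L1" "v \<in> Arr C" "Dom C v = W" "Cod C v = L1" by auto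
    show "u = v"
    proof (rule ccontr)
      assume "u \<noteq> v"
      moreover have "u \<in> Arr C" "v \<in> Hom C (Dom C u) (Cod C u)" by auto
      ultimately have "\<exists>X\<in>G. \<exists>h\<in>Hom C X (Dom C u). u \<cdot> h \<noteq> v \<cdot> h"
        using gen unfolding generates_def by blast
      then obtain X h where X: "X \<in> G" and h [simp]: "h \<in> Arr C" "Dom C h = X" "Cod C h = W" and ne: "u \<cdot> h \<noteq> v \<cdot> h"
        by auto
      obtain i a where i: "i \<in> Idx A1" and a [simp]: "a \<in> Arr C" "Dom C a = X" "Cod C a = DObj A1 i" and la: "l1 i \<cdot> a = u \<cdot> h"
        by (rule fp_lift[OF fp[OF X] S1 L1, of "u \<cdot> h"]) auto
      obtain j b where j: "j \<in> Idx A1" and b [simp]: "b \<in> Arr C" "Dom C b = X" "Cod C b = DObj A1 j" and lb: "l1 j \<cdot> b = v \<cdot> h"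
        by (rule fp_lift[OF fp[OF X] S1 L1, of "v \<cdot> h"]) auto
      obtain k where k: "(i, k) \<in> Ord A1" "(j, k) \<in> Ord A1" using direct_system_upper[OF S1 i j] .
      have K: "k \<in> Idx A1" using s1(4)[OF k(1)] .
      note [simp] = s1(8-10)[OF k(1)] s1(8-10)[OF k(2)]
      define a' where "a' = DArr A1 i k \<cdot> a"
      define b' where "b' = DArr A1 j k \<cdot> b"
      have a' [simp]: "a' \<in> Arr C" "Dom C a' = X" "Cod C a' = DObj A1 k" "b' \<in> Arr C" "Dom C b' = X" "Cod C b' = DObj A1 k"
        unfolding a'_def b'_def by auto
      have la': "l1 k \<cdot> a' = u \<cdot> h"
        using comp_whisker[OF c1(5)[OF k(1)], of a] la K unfolding a'_def by simp
      have lb': "l1 k \<cdot> b' = v \<cdot> h"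
        using comp_whisker[OF c1(5)[OF k(2)], of b] lb K unfolding b'_def by simp
      have "l2 k \<cdot> \<phi> k \<cdot> a' = f \<cdot> l1 k \<cdot> a'" using comp_whisker[OF fl(1)[OF K], of a'] K by simp
      also have "\<dots> = f \<cdot> l1 k \<cdot> b'"
        unfolding la' lb' using comp_whisker[OF fuv, of h] comp_assoc[of h v f] by simp
      also have "\<dots> = l2 k \<cdot> \<phi> k \<cdot> b'" using comp_whisker[OF fl(1)[OF K], of b'] K by simp
      finally have eq: "l2 k \<cdot> \<phi> k \<cdot> a' = l2 k \<cdot> \<phi> k \<cdot> b'" .
      obtain m where m: "(k, m) \<in> Ord A1" "DArr A2 k m \<cdot> \<phi> k \<cdot> a' = DArr A2 k m \<cdot> \<phi> k \<cdot> b'"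
        by (rule fp_equal[OF fp[OF X] S2 L2 _ _ _ _ _ _ _ _ eq]) (use K in auto)
      have M: "m \<in> Idx A1" using s1(4)[OF m(1)] .
      note [simp] = s1(8-10)[OF m(1)] s2(8-10)[unfolded I, OF m(1)]
      have n: "\<phi> m \<cdot> DArr A1 k m = DArr A2 k m \<cdot> \<phi> k" using nat m(1) by blast
      have "\<phi> m \<cdot> DArr A1 k m \<cdot> a' = \<phi> m \<cdot> DArr A1 k m \<cdot> b'"
        using comp_whisker[OF n, of a'] comp_whisker[OF n, of b'] m(2) K M by simp
      then have "DArr A1 k m \<cdot> a' = DArr A1 k m \<cdot> b'"
        by (rule mono_cancel[OF is_kernelD(5)[OF ck(1)[OF M]]]) (use M in auto)
      then have "l1 k \<cdot> a' = l1 k \<cdot> b'"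
        using comp_whisker[OF c1(5)[OF m(1)], of a'] comp_whisker[OF c1(5)[OF m(1)], of b'] M by simp
      then show False using la' lb' ne by simp
    qed
  qed
  have "is_cokernel C f g"
  proof (rule is_cokernelI)
    show "is_epi C g"
    proof (rule epiI)
      fix u assume u: "u \<in> Arr C" "Dom C u = Cod C g" "u \<cdot> g = nul (Dom C g) (Cod C u)"
      show "u = nul (Cod C g) (Cod C u)"
      proof (rule limit_eq[OF S3 L3])
        fix i assume "i \<in> Idx A3"
        then have i: "i \<in> Idx A1" by simp
        have "(u \<cdot> l3 i) \<cdot> \<psi> i = u \<cdot> g \<cdot> l2 i" using fl(2)[OF i] u(1,2) i by simp
        also have "\<dots> = nul (Dom C (\<psi> i)) (Cod C (u \<cdot> l3 i))" using comp_whisker[OF u(3), of "l2 i"] u(1,2) i by simp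
        finally have "u \<cdot> l3 i = nul (DObj A3 i) (Cod C u)"
          using epi_nul[OF is_cokernelD(5)[OF ck(2)[OF i]], of "u \<cdot> l3 i"] u(1,2) i by simp
        then show "u \<cdot> l3 i = nul (Cod C g) (Cod C u) \<cdot> l3 i" using u(1,2) i by simp
      qed (use u in auto)
    qed simp
    show "g \<cdot> f = nul (Dom C f) (Cod C g)"
    proof (rule limit_eq[OF S1 L1])
      fix i assume i: "i \<in> Idx A1"
      have "(g \<cdot> f) \<cdot> l1 i = g \<cdot> l2 i \<cdot> \<phi> i" using fl(1)[OF i] i by simp
      also have "\<dots> = l3 i \<cdot> \<psi> i \<cdot> \<phi> i" using comp_whisker[OF fl(2)[OF i], of "\<phi> i"] i by simp
      also have "\<dots> = nul (Dom C f) (Cod C g) \<cdot> l1 i" using is_cokernelD(4)[OF ck(2)[OF i]] s1(7) i by simp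
      finally show "(g \<cdot> f) \<cdot> l1 i = nul (Dom C f) (Cod C g) \<cdot> l1 i" .
    qed auto
    fix h assume h: "h \<in> Arr C" "Dom C h = Cod C f" "h \<cdot> f = nul (Dom C f) (Cod C h)"
    have "\<exists>w. w \<in> Arr C \<and> Dom C w = DObj A3 i \<and> Cod C w = Cod C h \<and> w \<cdot> \<psi> i = h \<cdot> l2 i" if i: "i \<in> Idx A1" for i
    proof -
      have "(h \<cdot> l2 i) \<cdot> \<phi> i = h \<cdot> f \<cdot> l1 i" using fl(1)[OF i] h(1,2) i by simp
      also have "\<dots> = nul (Dom C (\<phi> i)) (Cod C (h \<cdot> l2 i))" using comp_whisker[OF h(3), of "l1 i"] h(1,2) i by simp
      finally obtain w where "w \<in> Arr C" "Dom C w = Cod C (\<psi> i)" "Cod C w = Cod C (h \<cdot> l2 i)" "w \<cdot> \<psi> i = h \<cdot> l2 i"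
        using is_cokernel_factor[OF ck(2)[OF i], of "h \<cdot> l2 i"] h(1,2) i by auto
      then show ?thesis using h(1,2) i by auto
    qed
    then obtain w where w: "\<And>i. i \<in> Idx A1 \<Longrightarrow> w i \<in> Arr C \<and> Dom C (w i) = DObj A3 i \<and> Cod C (w i) = Cod C h \<and>
        w i \<cdot> \<psi> i = h \<cdot> l2 i"
      by metis
    have "is_cocone C A3 (Cod C h) w"
      unfolding is_cocone_def
    proof (intro conjI allI impI ballI)
      fix i j assume ij: "(i, j) \<in> Ord A3"
      have i: "i \<in> Idx A1" "j \<in> Idx A1" using s3(3,4)[OF ij] by auto
      note [simp] = s3(8-10)[OF ij] s2(8-10)[unfolded I, OF ij[unfolded I]]
      have n: "\<psi> j \<cdot> DArr A2 i j = DArr A3 i j \<cdot> \<psi> i" using nat ij by simp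
      have "(w j \<cdot> DArr A3 i j) \<cdot> \<psi> i = w j \<cdot> (\<psi> j \<cdot> DArr A2 i j)" using n w[OF i(2)] i by simp
      also have "\<dots> = (w j \<cdot> \<psi> j) \<cdot> DArr A2 i j" using w[OF i(2)] i by (metis (no_types, lifting) comp_assoc p s2(8,10) I(3) I(4) ij)
      also have "\<dots> = h \<cdot> (l2 j \<cdot> DArr A2 i j)" using w[OF i(2)] h(1,2) i by simp
      also have "\<dots> = h \<cdot> l2 i" using c2(5) ij by simp
      also have "\<dots> = w i \<cdot> \<psi> i" using w[OF i(1)] by simp
      finally show "w j \<cdot> DArr A3 i j = w i"
        by (rule epi_cancel[OF is_cokernelD(5)[OF ck(2)[OF i(1)]]]) (use w[OF i(1)] w[OF i(2)] i in auto)
    qed (use w h in auto)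
    then obtain v where v: "v \<in> Arr C" "Dom C v = L3" "Cod C v = Cod C h" "\<And>i. i \<in> Idx A3 \<Longrightarrow> v \<cdot> l3 i = w i"
      using limit_ex[OF L3] by metis
    have "v \<cdot> g = h"
    proof (rule limit_eq[OF S2 L2])
      fix i assume "i \<in> Idx A2"
      then have i: "i \<in> Idx A1" by simp
      have "(v \<cdot> g) \<cdot> l2 i = v \<cdot> l3 i \<cdot> \<psi> i" using fl(2)[OF i] v(1-3) i by simp
      also have "\<dots> = w i \<cdot> \<psi> i" using comp_whisker[of v "l3 i" "w i" "\<psi> i"] v i by simp
      finally show "(v \<cdot> g) \<cdot> l2 i = h \<cdot> l2 i" using w[OF i] by simp
    qed (use v h in auto)
    then show "\<exists>u. u \<in> Arr C \<and> Dom C u = Cod C g \<and> Cod C u = Cod C h \<and> u \<cdot> g = h" using v(1-3) by auto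
  qed auto
  then show "short_exact C f g"
    unfolding short_exact_def using mono_is_kernel_of_cokernel[OF monof] by blast
qed

section \<open>The quotient category is locally finitely presented\<close>

lemma map_dsys_simps [simp]:
  "Idx (map_dsys F S) = Idx S" "Ord (map_dsys F S) = Ord S" "DObj (map_dsys F S) i = FObj F (DObj S i)"
  "DArr (map_dsys F S) i j = FArr F (DArr S i j)"
  by (simp_all add: map_dsys_def)

context torsion_section
begin

lemma quotient_functor_is_functor: "is_functor C D (quotient_functor C T)"
  unfolding is_functor_def by (simp add: q_comp)

lemma direct_limit_q:
  assumes S: "direct_system \<kappa>' C S" and l: "is_direct_limit C S L l"
  shows "is_direct_limit D (map_dsys (quotient_functor C T) S) L (\<lambda>i. q (l i))"
  unfolding is_direct_limit_def
proof (intro conjI allI impI)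
  note c = is_coconeD[OF limit_cocone[OF l]] and s = direct_systemD[OF S]
  note [simp] = c(1-4)
  show "is_cocone D (map_dsys (quotient_functor C T) S) L (\<lambda>i. q (l i))"
    unfolding is_cocone_def
  proof (intro conjI allI impI ballI)
    fix i j assume "(i, j) \<in> Ord (map_dsys (quotient_functor C T) S)"
    then have ij: "(i, j) \<in> Ord S" by simp
    have "q (l j \<cdot> DArr S i j) = q (l j) \<odot> q (DArr S i j)"
      by (rule q_comp) (use s(4,8-10)[OF ij] in auto)
    then show "q (l j) \<odot> DArr (map_dsys (quotient_functor C T) S) i j = q (l i)"
      using c(5)[OF ij] by simp
  qed auto
  fix M m assume m: "is_cocone D (map_dsys (quotient_functor C T) S) M m"
  note m' = D.is_coconeD[OF m, simplified]
  note [simp] = m'(1-4)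
  have "is_cocone C S (I M) (\<lambda>i. Ph (m i))"
    unfolding is_cocone_def
  proof (intro conjI allI impI ballI)
    fix i j assume ij: "(i, j) \<in> Ord S"
    have "Ph (m j) \<cdot> DArr S i j = Ph (m j \<odot> q (DArr S i j))"
      by (rule Ph_pre[symmetric]) (use s(4,8-10)[OF ij] in auto)
    then show "Ph (m j) \<cdot> DArr S i j = Ph (m i)" using m'(5)[OF ij] by simp
  qed auto
  then obtain h where h: "h \<in> Arr C" "Dom C h = L" "Cod C h = I M" "\<And>i. i \<in> Idx S \<Longrightarrow> h \<cdot> l i = Ph (m i)"
    using limit_ex[OF l] by metis
  obtain g where g: "g \<in> Arr D" "Dom D g = L" "Cod D g = M" "Ph g = h"
    using Ph_surj[of h M] h by auto
  show "\<exists>!h. h \<in> Hom D L M \<and> (\<forall>i\<in>Idx (map_dsys (quotient_functor C T) S). h \<odot> q (l i) = m i)"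
  proof (rule ex1I)
    have "g \<odot> q (l i) = m i" if "i \<in> Idx S" for i
      by (rule Ph_inj) (use g h that in \<open>auto simp: Ph_pre\<close>)
    then show "g \<in> Hom D L M \<and> (\<forall>i\<in>Idx (map_dsys (quotient_functor C T) S). g \<odot> q (l i) = m i)"
      using g by simp
    fix g' assume g': "g' \<in> Hom D L M \<and> (\<forall>i\<in>Idx (map_dsys (quotient_functor C T) S). g' \<odot> q (l i) = m i)"
    have "Ph g' = h"
    proof (rule limit_eq[OF S l])
      fix i assume i: "i \<in> Idx S"
      have "Ph g' \<cdot> l i = Ph (g' \<odot> q (l i))" by (rule Ph_pre[symmetric]) (use g' i in auto)
      also have "\<dots> = h \<cdot> l i" using g' i h by simp
      finally show "Ph g' \<cdot> l i = h \<cdot> l i" .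
    qed (use g' h in auto)
    then show "g' = g" by (intro Ph_inj) (use g g' in auto)
  qed
qed

text \<open>
  The adjunction identifies \<open>Hom\<^bsub>D\<^esub>(X, -)\<close> with \<open>Hom\<^bsub>C\<^esub>(X, I -)\<close>, and \<open>I\<close> preserves direct limits.
\<close>

lemma fp_q:
  assumes fp: "finitely_presented \<kappa> C X" and pres: "preserves_direct_limits \<kappa> D C \<iota>"
  shows "finitely_presented \<kappa> D X"
  unfolding finitely_presented_def
proof (intro conjI allI impI)
  show XO: "X \<in> Obj D" using fp by (simp add: finitely_presented_def)
  fix S :: "('c, 'a, ('b \<times> 'b) set) dsys" and L l
  assume S: "direct_system \<kappa> D S" and l: "is_direct_limit D S L l"
  note c = D.is_coconeD[OF D.limit_cocone[OF l]] and s = D.direct_systemD[OF S]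
  note [simp] = c(1-4)
  have iS: "direct_system \<kappa> C (map_dsys \<iota> S)" by (rule D.direct_system_map[OF section_functor S])
  have il: "is_direct_limit C (map_dsys \<iota> S) (I L) (\<lambda>i. Ia (l i))"
    using pres S l unfolding preserves_direct_limits_def by blast
  show "bij_betw (\<lambda>\<xi>. the_elem ((\<lambda>(i, u). l i \<odot> u) ` \<xi>))
          (set_direct_limit (Idx S) (Ord S) (\<lambda>i. Hom D X (DObj S i)) (\<lambda>i j u. DArr S i j \<odot> u))
          (Hom D X L)"
    unfolding D.set_direct_limit_bij_iff[OF S D.limit_cocone[OF l]]
  proof (intro conjI ballI impI)
    fix u assume u: "u \<in> Hom D X L"
    obtain i a where i: "i \<in> Idx S" and a: "a \<in> Arr C" "Dom C a = X" "Cod C a = I (DObj S i)" "Ia (l i) \<cdot> a = Ph u"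
      by (rule fp_lift[OF fp iS il, of "Ph u"]) (use u in auto)
    obtain b where b: "b \<in> Arr D" "Dom D b = X" "Cod D b = DObj S i" "Ph b = a"
      using Ph_surj[of a "DObj S i"] a s(7)[OF i] by auto
    have "b \<in> Hom D X (DObj S i)" using b by simp
    moreover have "l i \<odot> b = u" by (rule Ph_inj) (use u a b i in \<open>auto simp: Ph_post\<close>)
    ultimately show "\<exists>i\<in>Idx S. \<exists>a\<in>Hom D X (DObj S i). l i \<odot> a = u" using i by blast
  next
    fix i j a b assume i: "i \<in> Idx S" "j \<in> Idx S" and a: "a \<in> Hom D X (DObj S i)" "b \<in> Hom D X (DObj S j)"
      and e: "l i \<odot> a = l j \<odot> b"
    have eq: "Ia (l i) \<cdot> Ph a = Ia (l j) \<cdot> Ph b"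
      using arg_cong[OF e, of Ph] a i by (simp add: Ph_post)
    obtain k where k: "(i, k) \<in> Ord S" "(j, k) \<in> Ord S" "Ia (DArr S i k) \<cdot> Ph a = Ia (DArr S j k) \<cdot> Ph b"
      by (rule fp_equal[OF fp iS il _ _ _ _ _ _ _ _ eq]) (use a i in auto)
    have "DArr S i k \<odot> a = DArr S j k \<odot> b"
      by (rule Ph_inj) (use a k s(8-10)[OF k(1)] s(8-10)[OF k(2)] in \<open>auto simp: Ph_post\<close>)
    then show "\<exists>k. (i, k) \<in> Ord S \<and> (j, k) \<in> Ord S \<and> DArr S i k \<odot> a = DArr S j k \<odot> b"
      using k by blast
  qed
qed

lemma generates_q:
  assumes G: "generates C G" shows "generates D G"
  unfolding generates_def
proof (intro conjI ballI impI)
  show "G \<subseteq> Obj D" using G by (simp add: generates_def)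
  fix f g assume f: "f \<in> Arr D" and g: "g \<in> Hom D (Dom D f) (Cod D f)" and ne: "f \<noteq> g"
  have "Ph f \<noteq> Ph g" using Ph_inj[of f g] f g ne by auto
  moreover have "Ph f \<in> Arr C" "Ph g \<in> Hom C (Dom C (Ph f)) (Cod C (Ph f))" using f g by auto
  ultimately obtain X h where X: "X \<in> G" "h \<in> Hom C X (Dom C (Ph f))" "Ph f \<cdot> h \<noteq> Ph g \<cdot> h"
    using G unfolding generates_def by blast
  then have "f \<odot> q h \<noteq> g \<odot> q h"
    using f g Ph_pre[of f h] Ph_pre[of g h] by auto
  then show "\<exists>X\<in>G. \<exists>h\<in>Hom D X (Dom D f). f \<odot> h \<noteq> g \<odot> h" using X f by (intro bexI[of _ X] bexI[of _ "q h"]) auto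
qed

lemma locally_small_D: "locally_small \<kappa>' C \<Longrightarrow> locally_small \<kappa>' D"
  unfolding locally_small_def
proof (intro ballI)
  fix A B assume C: "\<forall>A\<in>Obj C. \<forall>B\<in>Obj C. small \<kappa>' (Hom C A B)" and "A \<in> Obj D" "B \<in> Obj D"
  then have AB: "A \<in> Obj C" "B \<in> Obj C" by simp_all
  have "small \<kappa>' (Hom D A B) \<longleftrightarrow> small \<kappa>' (Hom C A (I B))" by (rule small_bij[OF Phi_bij[OF AB]])
  then show "small \<kappa>' (Hom D A B)" using C AB section_simps(1)[OF AB(2)] by blast
qed

lemma has_coproducts_D:
  fixes \<kappa>' :: "'v rel"
  assumes "has_coproducts \<kappa>' C" shows "has_coproducts \<kappa>' D"
  unfolding has_coproducts_def
proof (intro allI impI)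
  fix J :: "'v set" and F assume J: "small \<kappa>' J" and F: "\<forall>j\<in>J. F j \<in> Obj D"
  then obtain P e where "is_coproduct C J F P e" using assms unfolding has_coproducts_def by force
  then have "is_coproduct D J F P (\<lambda>k. q (e k))" by (rule coproduct_q) (use F in auto)
  then show "\<exists>P e. is_coproduct D J F P e" by blast
qed

lemma locally_finitely_presented_D:
  assumes lfp: "locally_finitely_presented \<kappa> C" and pres: "preserves_direct_limits \<kappa> D C \<iota>"
  shows "locally_finitely_presented \<kappa> D"
proof -
  have gr: "grothendieck \<kappa> C" using lfp unfolding locally_finitely_presented_def by blast
  obtain G where G: "small \<kappa> G" "\<And>X. X \<in> G \<Longrightarrow> finitely_presented \<kappa> C X" "generates C G"
    using lfp unfolding locally_finitely_presented_def by blast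
  have G': "\<And>X. X \<in> G \<Longrightarrow> finitely_presented \<kappa> D X" "generates D G"
    using G fp_q[OF _ pres] generates_q by blast+
  have "\<exists>U. generates D {U}" using gr generates_q unfolding grothendieck_def by blast
  then have "grothendieck \<kappa> D"
    using gr abelian_D locally_small_D has_coproducts_D D.fp_generators_exact_direct_limits[OF G'(2,1)]
    unfolding grothendieck_def by blast
  moreover have "\<exists>(S :: ('c, 'a, ('b \<times> 'b) set) dsys) l. direct_system \<kappa> D S \<and>
        (\<forall>i\<in>Idx S. finitely_presented \<kappa> D (DObj S i)) \<and> is_direct_limit D S M l"
    if M: "M \<in> Obj D" for M
  proof -
    obtain S :: "('c, 'a, 'b) dsys" and l where S: "direct_system \<kappa> C S"
      "\<forall>i\<in>Idx S. finitely_presented \<kappa> C (DObj S i)" "is_direct_limit C S M l"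
      using lfp M unfolding locally_finitely_presented_def by auto
    show ?thesis
      using direct_system_map[OF quotient_functor_is_functor S(1)] direct_limit_q[OF S(1,3)] S(2) fp_q[OF _ pres]
      by (intro exI[of _ "map_dsys (quotient_functor C T) S"] exI[of _ "\<lambda>i. q (l i)"]) auto
  qed
  ultimately show ?thesis
    unfolding locally_finitely_presented_def using G(1) G' by blast
qed

end

section \<open>The unit of the adjunction\<close>

context torsion_section
begin

text \<open>
  Torsion radicals will be obtained as kernels of this unit.
\<close>

definition \<eta> where "\<eta> A = Ph (Ident D A)"

lemma eta_simps [simp]:
  assumes "A \<in> Obj C" shows "\<eta> A \<in> Arr C" "Dom C (\<eta> A) = A" "Cod C (\<eta> A) = I A"
  using assms Ph_simps[of "Ident D A"] by (simp_all add: \<eta>_def)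

lemma Ph_eta: "f \<in> Arr D \<Longrightarrow> Ph f = Ia f \<cdot> \<eta> (Dom D f)"
  using Ph_post[of "Ident D (Dom D f)" f] by (simp add: \<eta>_def)

lemma Ph_q: "b \<in> Arr C \<Longrightarrow> Ph (q b) = \<eta> (Cod C b) \<cdot> b"
  using Ph_pre[of "Ident D (Cod C b)" b] by (simp add: \<eta>_def)

lemma eta_natural: "b \<in> Arr C \<Longrightarrow> Ia (q b) \<cdot> \<eta> (Dom C b) = \<eta> (Cod C b) \<cdot> b"
  using Ph_eta[of "q b"] Ph_q[of b] by simp

lemma kernel_eta_torsion:
  assumes A: "A \<in> Obj C" and k: "is_kernel C (\<eta> A) k" shows "Dom C k \<in> T"
proof -
  note k' = is_kernelD[OF k]
  have "Ph (q k) = nul (Dom C k) (I A)" using k' A by (simp add: Ph_q)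
  then have "q k = D.nul (Dom C k) (Cod C k)" using Ph_eq_nul[of "q k"] k' A by simp
  then obtain z where "z \<in> \<Sigma>" "Cod C z = Dom C k" "k \<cdot> z = nul (Dom C z) (Cod C k)"
    using q_eq_nul[of k] k' by auto
  then show ?thesis using mono_torsion[OF k'(5)] by simp
qed

text \<open>Objects \<open>I B\<close> are torsion-free, because a torsion object becomes zero in the quotient category.\<close>

lemma torsion_to_section_nul:
  assumes X: "X \<in> T" and h: "h \<in> Arr C" "Dom C h = X" "Cod C h = I B" and B: "B \<in> Obj C"
  shows "h = nul X (I B)"
proof -
  have XO [simp]: "X \<in> Obj C" using h by auto
  obtain Z where Z: "zero_object C Z" using zero_ex by blast
  note [simp] = zero_object_Obj[OF Z] B
  let ?z = "nul Z X"
  have m: "is_mono C ?z"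
  proof (rule monoI)
    fix u assume "u \<in> Arr C" "Cod C u = Dom C ?z"
    then show "u = nul (Dom C u) (Dom C ?z)" using zero_object_nul[OF Z, of u] by simp
  qed simp
  have "is_cokernel C ?z (Ident C X)"
  proof (rule is_cokernelI)
    show "is_epi C (Ident C X)" by (auto simp: is_epi_def)
    fix g assume g: "g \<in> Arr C" "Dom C g = Cod C ?z"
    then show "\<exists>u. u \<in> Arr C \<and> Dom C u = Cod C (Ident C X) \<and> Cod C u = Cod C g \<and> u \<cdot> Ident C X = g"
      by (intro exI[of _ g]) simp
  qed auto
  then have z: "?z \<in> \<Sigma>" using Sig_monoI[OF m] X by simp
  have "Ident C X \<cdot> ?z = nul X X \<cdot> ?z" by simp
  then have "q (Ident C X) = q (nul X X)"
    by (subst q_eq_iff) (use z in \<open>auto intro!: bexI[of _ "nul Z X"]\<close>)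
  then have id: "Ident D X = D.nul X X" by simp
  obtain f where f: "f \<in> Arr D" "Dom D f = X" "Cod D f = B" "Ph f = h"
    using Ph_surj[of h B] h by auto
  have "f = f \<odot> Ident D X" using f by simp
  also have "\<dots> = D.nul X B" unfolding id using f by simp
  finally show ?thesis using f by simp
qed

lemma kernel_eta_radical:
  assumes A: "A \<in> Obj C" and k: "is_kernel C (\<eta> A) k" shows "is_torsion_radical C T A k"
  unfolding is_torsion_radical_def subobject_def
proof (intro conjI allI impI)
  note k' = is_kernelD[OF k]
  show "is_mono C k" "Cod C k = A" "Dom C k \<in> T" using k' A kernel_eta_torsion[OF A k] by auto
  fix m assume m: "is_mono C m \<and> Cod C m = A" "Dom C m \<in> T"
  then have m' [simp]: "m \<in> Arr C" "Cod C m = A" using mono_Arr by auto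
  have "\<eta> A \<cdot> m = nul (Dom C m) (I A)"
    by (rule torsion_to_section_nul) (use m A in auto)
  then obtain u where "u \<in> Arr C" "Dom C u = Dom C m" "Cod C u = Dom C k" "k \<cdot> u = m"
    using is_kernel_factor[OF k, of m] A by auto
  then show "sub_le C m k" unfolding sub_le_def by auto
qed

text \<open>
  The counit \<open>e\<close> at \<open>A\<close> is inverse to \<open>q (\<eta> A)\<close>.  The family \<open>q (\<eta> A)\<close> is natural for all arrows of the
  quotient category, because these are fractions of arrows \<open>q b\<close>; naturality at \<open>e\<close> and the triangle
  identity give \<open>q (\<eta> A) e = 1\<close>.  Hence an epimorphism that kills \<open>\<eta> A\<close> is killed by \<open>q\<close>.
\<close>

lemma cokernel_eta_torsion:
  assumes A: "A \<in> Obj C" and c: "is_cokernel C (\<eta> A) c" shows "Cod C c \<in> T"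
proof -
  note c' = is_cokernelD[OF c]
  note [simp] = c'(2,3) A
  obtain e where e [simp]: "e \<in> Arr D" "Dom D e = I A" "Cod D e = A" and Pe: "Ph e = Ident C (I A)"
    using Ph_surj[of "Ident C (I A)" A] by auto
  have nat: "q (Ia b) \<odot> q (\<eta> (Dom D b)) = q (\<eta> (Cod D b)) \<odot> b" if b: "b \<in> Arr D" for b
  proof -
    obtain s g where fr: "fraction s g b" using fraction_ex[OF b] .
  note s = fractionD[OF fr]
    note [simp] = b s(1-5)
    have ns: "Ia (q s) \<cdot> \<eta> (Dom C s) = \<eta> (Dom D b) \<cdot> s" using eta_natural[of s] by simp
    have ng: "Ia (q g) \<cdot> \<eta> (Dom C s) = \<eta> (Cod D b) \<cdot> g" using eta_natural[of g] by simp
    have "Ia b \<cdot> \<eta> (Dom D b) \<cdot> s = (Ia b \<cdot> Ia (q s)) \<cdot> \<eta> (Dom C s)" by (simp add: ns)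
    also have "\<dots> = Ia (q g) \<cdot> \<eta> (Dom C s)" using section_comp[of "q s" b] by (simp add: s(6))
    finally have i: "Ia b \<cdot> \<eta> (Dom D b) \<cdot> s = \<eta> (Cod D b) \<cdot> g" by (simp only: ng)
    have "(q (Ia b) \<odot> q (\<eta> (Dom D b))) \<odot> q s = q (Ia b \<cdot> \<eta> (Dom D b) \<cdot> s)"
      by (simp add: q_comp)
    also have "\<dots> = (q (\<eta> (Cod D b)) \<odot> b) \<odot> q s" unfolding i by (simp add: q_comp s(6))
    finally show ?thesis
      by (rule D.epi_cancel[OF q_Sig_epi[OF s(1)]]) auto
  qed
  have "Ia e \<cdot> \<eta> (I A) = Ident C (I A)" using Ph_eta[of e] Pe by simp
  then have "q (Ia e) \<odot> q (\<eta> (I A)) = Ident D (I A)" by (simp flip: q_comp)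
  then have inv: "q (\<eta> A) \<odot> e = Ident D (I A)" using nat[of e] by simp
  have "q c = q c \<odot> (q (\<eta> A) \<odot> e)" unfolding inv by simp
  also have "\<dots> = q (c \<cdot> \<eta> A) \<odot> e" by (simp add: q_comp)
  also have "\<dots> = D.nul (Dom C c) (Cod C c)" using c'(4) by simp
  finally obtain z where "z \<in> \<Sigma>" "Cod C z = Dom C c" "c \<cdot> z = nul (Dom C z) (Cod C c)"
    using q_eq_nul[of c] by auto
  then show ?thesis using epi_torsion[OF c'(5)] by simp
qed

section \<open>Vanishing of morphisms in the quotient category\<close>

text \<open>
  Morphisms \<open>X \<rightarrow> A\<close> of the quotient category are morphisms \<open>h : X \<rightarrow> I A\<close>, and \<open>Y = A/t(A)\<close> is the
  image of \<open>\<eta> A\<close>, with torsion cokernel \<open>Q = I A/Y\<close>.  The image \<open>T'\<close> of \<open>h\<close> in \<open>Q\<close> is a torsion quotient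
  of \<open>X\<close>.  The preimage of \<open>T'\<close> in \<open>I A\<close> is an extension of \<open>T'\<close> by \<open>Y\<close>; if it splits, then \<open>T'\<close> embeds
  into the torsion-free object \<open>I A\<close>, so \<open>T' = 0\<close> and \<open>h\<close> factors through \<open>Y\<close>.
\<close>

lemma hom_D_zero:
  assumes A: "A \<in> Obj C" and \<phi>: "\<phi> \<in> Arr D" "Dom D \<phi> = X" "Cod D \<phi> = A"
    and hom: "\<And>Y f. Y \<in> torsion_free_quotients C T {A} \<Longrightarrow> f \<in> Hom C X Y \<Longrightarrow> zero_arrow C f"
    and ext: "\<And>Y T' f g. Y \<in> torsion_free_quotients C T {A} \<Longrightarrow> T' \<in> torsion_images C T X \<Longrightarrow>
      (f, g) \<in> extensions C T' Y \<Longrightarrow> \<exists>s. s \<in> Hom C T' (Cod C f) \<and> g \<cdot> s = Ident C T'"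
  shows "\<phi> = D.nul X A"
proof -
  have X [simp]: "X \<in> Obj C" using \<phi> by auto
  note [simp] = A
  obtain m e c where im: "image_factorization (\<eta> A) m e c" by (rule image_factor[of "\<eta> A"]) auto
  note m = image_factorizationD[OF im]
  note [simp] = m(6-10) is_cokernelD(2,3)[OF m(1)]
  obtain k where k: "is_kernel C (\<eta> A) k" using kernel_ex[of "\<eta> A"] by auto
  have "is_cokernel C k e"
    by (rule epi_is_cokernel_of_kernel[OF m(5)], rule kernel_of_mono_comp[OF k]) (use m in auto)
  then have Y: "Dom C m \<in> torsion_free_quotients C T {A}"
    unfolding torsion_free_quotients_def using kernel_eta_radical[OF A k] m(9) by blast
  define h where "h = Ph \<phi>"
  have h [simp]: "h \<in> Arr C" "Dom C h = X" "Cod C h = I A" unfolding h_def using \<phi> by auto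
  obtain n e' d where im: "image_factorization (c \<cdot> h) n e' d" by (rule image_factor[of "c \<cdot> h"]) auto
  note n = image_factorizationD[OF im]
  note [simp] = n(6,7) n(8-10)[simplified]
  have T': "Dom C n \<in> T" using T_sub[OF n(4)] cokernel_eta_torsion[OF A m(1)] by simp
  then have im: "Dom C n \<in> torsion_images C T X"
    unfolding torsion_images_def using n(5) by auto
  obtain p1 p2 k' where p: "p1 \<in> Arr C" "p2 \<in> Arr C" "Dom C p2 = Dom C p1" "Cod C p1 = Dom C n"
    "Cod C p2 = Dom C c" "n \<cdot> p1 = c \<cdot> p2" "is_epi C p1" "is_kernel C p1 k'" "Dom C k' = Dom C m" "p2 \<cdot> k' = m"
    by (rule pullback_epi[OF is_cokernelD(5)[OF m(1)] m(2) n(6)]) (use n in auto)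
  have "(k', p1) \<in> extensions C (Dom C n) (Dom C m)"
    unfolding extensions_def short_exact_def using p epi_is_cokernel_of_kernel[OF p(7,8)] by simp
  then obtain s where s: "s \<in> Hom C (Dom C n) (Cod C k')" "p1 \<cdot> s = Ident C (Dom C n)"
    using ext[OF Y im] by blast
  note [simp] = is_kernelD(2,3)[OF p(8)] p(1-4) p(5)[simplified]
  have s' [simp]: "s \<in> Arr C" "Dom C s = Dom C n" "Cod C s = Dom C p1" using s by auto
  have p2s: "p2 \<cdot> s = nul (Dom C n) (I A)" by (rule torsion_to_section_nul[OF T']) auto
  have "n = n \<cdot> p1 \<cdot> s" by (simp add: s(2))
  also have "\<dots> = c \<cdot> p2 \<cdot> s" using comp_whisker[OF p(6), of s] by simp
  also have "\<dots> = nul (Dom C n) (Cod C c)" by (simp add: p2s)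
  finally have n0: "n = nul (Dom C n) (Cod C c)" .
  have "c \<cdot> h = nul (Dom C n) (Cod C c) \<cdot> e'" using n(11) n0 by metis
  then have "c \<cdot> h = nul X (Cod C c)" by simp
  then obtain w where w: "w \<in> Arr C" "Dom C w = X" "Cod C w = Dom C m" "m \<cdot> w = h"
    using is_kernel_factor[OF m(2), of h] by auto
  then have "w = nul X (Dom C m)" using hom[OF Y, of w] by (simp add: zero_arrow_iff)
  then have "h = nul X (I A)" using w by simp
  then show ?thesis using Ph_eq_nul[of \<phi>] \<phi> unfolding h_def by simp
qed

text \<open>
  If parallel arrows \<open>f\<close> and \<open>g\<close> are separated by some \<open>h\<close> with domain \<open>X\<close>, then they are still separated after restriction to
  the trace, since the inclusion of the trace is inverted by \<open>q\<close>; and a morphism that kills all the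
  images that make up the trace kills the trace.
\<close>

lemma generates_of_trace:
  assumes gen: "generates C G" and XX: "XX \<subseteq> Obj C"
    and tr: "\<And>X. X \<in> G \<Longrightarrow> \<exists>XX' s p. XX' \<subseteq> XX \<and> is_trace C XX' X s \<and> is_cokernel C s p \<and> Cod C p \<in> T"
  shows "generates D XX"
  unfolding generates_def
proof (intro conjI ballI impI)
  show "XX \<subseteq> Obj D" using XX by simp
  fix f g assume f: "f \<in> Arr D" and "g \<in> Hom D (Dom D f) (Cod D f)" and ne: "f \<noteq> g"
  then have g: "g \<in> Arr D" "Dom D g = Dom D f" "Cod D g = Cod D f" by auto
  obtain X h where X: "X \<in> G" and h: "h \<in> Hom D X (Dom D f)" and fh: "f \<odot> h \<noteq> g \<odot> h"
    using generates_q[OF gen] f g ne unfolding generates_def by force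
  have h' [simp]: "h \<in> Arr D" "Dom D h = X" "Cod D h = Dom D f" using h by auto
  have XO [simp]: "X \<in> Obj C" using D_Obj(1)[OF h'(1)] by simp
  note [simp] = f g
  obtain XX' s p where XX': "XX' \<subseteq> XX" and s: "is_trace C XX' X s" and p: "is_cokernel C s p" "Cod C p \<in> T"
    using tr[OF X] by blast
  have ms: "is_mono C s" and [simp]: "Cod C s = X"
    using s unfolding is_trace_def is_subobject_sum_def subobject_def by auto
  note [simp] = mono_Arr[OF ms]
  have sS: "s \<in> \<Sigma>" by (rule Sig_monoI[OF ms p])
  define d where "d = sub (Ph (f \<odot> h)) (Ph (g \<odot> h))"
  have d [simp]: "d \<in> Arr C" "Dom C d = X" "Cod C d = I (Cod D f)" unfolding d_def by auto
  have d_iff: "d \<cdot> u = nul (Dom C u) (I (Cod D f)) \<longleftrightarrow> (f \<odot> h) \<odot> q u = (g \<odot> h) \<odot> q u"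
    if u: "u \<in> Arr C" "Cod C u = X" for u
  proof -
    have "d \<cdot> u = sub (Ph (f \<odot> h) \<cdot> u) (Ph (g \<odot> h) \<cdot> u)" unfolding d_def using u by (simp add: comp_sub)
    then have "d \<cdot> u = nul (Dom C u) (I (Cod D f)) \<longleftrightarrow> Ph (f \<odot> h) \<cdot> u = Ph (g \<odot> h) \<cdot> u"
      using sub_nul[of "Ph (f \<odot> h) \<cdot> u" "Ph (g \<odot> h) \<cdot> u"] u by simp
    also have "\<dots> \<longleftrightarrow> Ph ((f \<odot> h) \<odot> q u) = Ph ((g \<odot> h) \<odot> q u)"
      using Ph_pre[of "f \<odot> h" u] Ph_pre[of "g \<odot> h" u] u by (simp del: D.comp_assoc)
    also have "\<dots> \<longleftrightarrow> (f \<odot> h) \<odot> q u = (g \<odot> h) \<odot> q u"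
      using Ph_inj[of "(f \<odot> h) \<odot> q u" "(g \<odot> h) \<odot> q u"] u by auto
    finally show ?thesis .
  qed
  have "\<exists>X'\<in>XX'. \<exists>u\<in>Hom C X' X. d \<cdot> u \<noteq> nul (Dom C u) (I (Cod D f))"
  proof (rule ccontr)
    assume "\<not> ?thesis"
    then have z: "d \<cdot> u = nul X' (I (Cod D f))" if "X' \<in> XX'" "u \<in> Hom C X' X" for X' u using that by auto
    obtain k where k: "is_kernel C d k" using kernel_ex[OF d(1)] .
    note k' = is_kernelD[OF k]
    have "sub_le C s k"
    proof -
      have "sub_le C m k" if m: "X' \<in> XX'" "u \<in> Hom C X' X" "is_image C u m" for X' u m
      proof -
        obtain c where c: "is_cokernel C u c" "is_kernel C c m" using m(3) unfolding is_image_def by blast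
        note c' = is_cokernelD[OF c(1)] and m' = is_kernelD[OF c(2)]
        have u: "u \<in> Arr C" "Dom C u = X'" "Cod C u = X" using m(2) by auto
        obtain d' where d': "d' \<in> Arr C" "Dom C d' = Cod C c" "Cod C d' = I (Cod D f)" "d' \<cdot> c = d"
          using is_cokernel_factor[OF c(1), of d] z[OF m(1,2)] u by auto
        have "d \<cdot> m = nul (Dom C m) (Cod C d)"
          using comp_assoc[of m c d'] d' c' m' u by simp
        then obtain w where "w \<in> Arr C" "Dom C w = Dom C m" "Cod C w = Dom C k" "k \<cdot> w = m"
          using is_kernel_factor[OF k, of m] m' c' u by auto
        then show ?thesis unfolding sub_le_def by auto
      qed
      then show ?thesis
        using s k' unfolding is_trace_def is_subobject_sum_def subobject_def by (simp del: Hom_iff) blast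
    qed
    then obtain v where v: "v \<in> Arr C" "Dom C v = Dom C s" "Cod C v = Dom C k" "s = k \<cdot> v"
      unfolding sub_le_def by auto
    have "d \<cdot> s = d \<cdot> k \<cdot> v" by (simp only: v(4))
    also have "\<dots> = nul (Dom C s) (I (Cod D f))"
      using comp_whisker[OF k'(4), of v] v(1-3) k' by simp
    finally have "(f \<odot> h) \<odot> q s = (g \<odot> h) \<odot> q s" using d_iff[of s] by simp
    then have "f \<odot> h = g \<odot> h"
      by (rule D.epi_cancel[OF q_Sig_epi[OF sS]]) auto
    then show False using fh by simp
  qed
  then obtain X' u where u: "X' \<in> XX'" "u \<in> Hom C X' X" "d \<cdot> u \<noteq> nul (Dom C u) (I (Cod D f))" by blast
  then have "(f \<odot> h) \<odot> q u \<noteq> (g \<odot> h) \<odot> q u" using d_iff[of u] by simp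
  then have "f \<odot> h \<odot> q u \<noteq> g \<odot> h \<odot> q u" using u(2) by simp
  then show "\<exists>X\<in>XX. \<exists>h\<in>Hom D X (Dom D f). f \<odot> h \<noteq> g \<odot> h"
    using u(1,2) XX' by (intro bexI[of _ X'] bexI[of _ "h \<odot> q u"]) auto
qed

end

section \<open>Maps to flat objects\<close>

text \<open>
  Take the coproduct \<open>P\<close>, over all maps \<open>w j\<close> from members of \<open>XX\<close> to \<open>F\<close>, of the domains of these maps.
  Since \<open>XX\<close> generates, the induced map \<open>P \<rightarrow> F\<close> is epic, hence pure, and maps \<open>X \<rightarrow> F\<close> lift to \<open>P\<close>.
\<close>

lemma (in preadditive_cat) hom_flat_zero:
  fixes \<kappa> :: "'u rel"
  assumes inacc: "inaccessible \<kappa>" and ls: "locally_small \<kappa> C" and cop: "has_coproducts \<kappa> C"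
    and XX: "small \<kappa> XX" and gen: "generates C XX" and fp: "finitely_presented \<kappa> C X"
    and zero: "\<And>X' u. X' \<in> XX \<Longrightarrow> u \<in> Arr C \<Longrightarrow> Dom C u = X \<Longrightarrow> Cod C u = X' \<Longrightarrow> u = nul X X'"
    and F: "flat \<kappa> C F" and u: "u \<in> Arr C" "Dom C u = X" "Cod C u = F"
  shows "u = nul X F"
proof -
  have [simp]: "F \<in> Obj C" "X \<in> Obj C" using u by auto
  have XXO: "XX \<subseteq> Obj C" using gen by (simp add: generates_def)
  define H where "H = (\<Union>X'\<in>XX. Hom C X' F)"
  have "small \<kappa> H"
    unfolding H_def by (rule small_UN[OF inacc XX]) (use ls XXO in \<open>auto simp: locally_small_def simp del: Hom_iff\<close>)
  then obtain J :: "'u set" and w where J: "small \<kappa> J" and w: "bij_betw w J H"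
    using small_encode[OF inacc] by metis
  have wH: "w j \<in> Arr C" "Dom C (w j) \<in> XX" "Cod C (w j) = F" if "j \<in> J" for j
    using bij_betwE[OF w] that unfolding H_def by auto
  obtain P e where c: "is_coproduct C J (\<lambda>j. Dom C (w j)) P e"
    using cop J wH unfolding has_coproducts_def by (meson dom_cod_Obj(1))
  note [simp] = coproductD(2-4)[OF c] coproductD(1)[OF c]
  obtain h where h [simp]: "h \<in> Arr C" "Dom C h = P" "Cod C h = F" and he: "\<And>j. j \<in> J \<Longrightarrow> h \<cdot> e j = w j"
    by (rule coproduct_ex[OF c, of w F]) (use wH in auto)
  have "is_epi C h"
    unfolding is_epi_def
  proof (intro conjI ballI impI h(1))
    fix B a b assume "B \<in> Obj C" "a \<in> Hom C (Cod C h) B" "b \<in> Hom C (Cod C h) B" and ab: "a \<cdot> h = b \<cdot> h"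
    then have a [simp]: "a \<in> Arr C" "Dom C a = F" "Cod C a = B" "b \<in> Arr C" "Dom C b = F" "Cod C b = B" by auto
    show "a = b"
    proof (rule ccontr)
      assume "a \<noteq> b"
      moreover have "b \<in> Hom C (Dom C a) (Cod C a)" by simp
      ultimately obtain X' v where X': "X' \<in> XX" and v: "v \<in> Hom C X' (Dom C a)" "a \<cdot> v \<noteq> b \<cdot> v"
        using gen a(1) unfolding generates_def by blast
      then have "v \<in> w ` J" using bij_betw_imp_surj_on[OF w] unfolding H_def by auto
      then obtain j where j: "j \<in> J" "v = w j" by blast
      have "a \<cdot> v = b \<cdot> v"
        using comp_whisker[OF ab, of "e j"] j wH[OF j(1)] he[OF j(1)] by simp
      then show False using v by simp
    qed
  qed
  then have "pure_epi \<kappa> C h" using F unfolding flat_def by simp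
  then have "(\<lambda>v. h \<cdot> v) ` Hom C X P = Hom C X F" using fp unfolding pure_epi_def by simp
  moreover have "u \<in> Hom C X F" using u by simp
  ultimately obtain v where v: "v \<in> Hom C X P" "u = h \<cdot> v" by blast
  have "v = nul X P"
    by (rule fp_hom_coproduct_zero[OF inacc fp J c]) (use wH zero v in auto)
  then show ?thesis using v by simp
qed

section \<open>Absence of nonzero flat objects\<close>

text \<open>
  As no \<open>b\<close> is a minimum, for each \<open>b\<close> there is an element not above \<open>b\<close>; a common lower bound of
  finitely many of these lies above none of the \<open>b\<close>.
\<close>

lemma directed_below_avoids:
  fixes B :: "'i::preorder set"
  assumes dir: "\<forall>i j :: 'i. \<exists>k. k \<le> i \<and> k \<le> j" and nomin: "\<not> (\<exists>m :: 'i. \<forall>i. m \<le> i)" and fin: "finite B"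
  shows "\<exists>j. \<forall>b\<in>B. \<not> b \<le> j"
  using fin
proof (induction B rule: finite_induct)
  case (insert b B)
  then obtain j where j: "\<forall>b\<in>B. \<not> b \<le> j" by blast
  obtain m where m: "\<not> b \<le> m" using nomin by blast
  obtain k where k: "k \<le> j" "k \<le> m" using dir by blast
  have "\<not> b' \<le> k" if "b' \<in> insert b B" for b'
    using that j m k order_trans by blast
  then show ?case by blast
qed simp

text \<open>
  The zero class of \<open>Ext1\<close> consists of the split extensions, and every extension lies in its own class.
\<close>

lemma (in abelian_cat) split_extension:
  assumes fg: "(f, g) \<in> extensions C T Y" and triv: "\<forall>\<xi>\<in>Ext1 C T Y. \<xi> = Ext1_zero C T Y"
  shows "\<exists>s. s \<in> Hom C T (Cod C f) \<and> g \<cdot> s = Ident C T"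
proof -
  have k: "is_kernel C g f" "Dom C f = Y" "Cod C g = T" using fg by (auto simp: extensions_def short_exact_def)
  note k' = is_kernelD[OF k(1)]
  have "is_iso C (Ident C (Cod C f))" unfolding is_iso_def using k' by auto
  then have "((f, g), (f, g)) \<in> extension_equiv C T Y"
    unfolding extension_equiv_def using fg k' by auto
  then have "(f, g) \<in> extension_equiv C T Y `` {(f, g)}" by simp
  moreover have "extension_equiv C T Y `` {(f, g)} \<in> Ext1 C T Y"
    unfolding Ext1_def using fg by (rule quotientI)
  ultimately have "(f, g) \<in> Ext1_zero C T Y" using triv by auto
  then obtain s where s: "is_binary_coproduct C Y T (Cod C f) f s" "g \<cdot> s = Ident C T"
    unfolding Ext1_zero_def by auto
  have "s \<in> Hom C T (Cod C f)"
    using coproductD(2-4)[OF s(1)[unfolded is_binary_coproduct_def], of False] by simp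
  then show ?thesis using s by blast
qed

theorem proposition2p5:
  fixes \<kappa> :: "'u rel"
    and \<G> :: "('o, 'a) cat"
    and \<T> :: "'o set"
    and \<S> :: "'o set"
    and S :: "'i::preorder \<Rightarrow> 'o set"
  assumes "inaccessible \<kappa>"
    and "small \<kappa> (UNIV :: 'i set)"
    and "\<forall>i j :: 'i. \<exists>k. k \<le> i \<and> k \<le> j"
    and "\<not> (\<exists>m :: 'i. \<forall>i. m \<le> i)"
    and "locally_finitely_presented \<kappa> \<G>"
    and "small \<kappa> \<S>"
    and "\<forall>X\<in>\<S>. finitely_presented \<kappa> \<G> X"
    and "generates \<G> \<S>"
    and "\<S> = (\<Union>i. S i)"
    and "\<forall>i. S i \<noteq> {}"
    and "hereditary_torsion_class \<kappa> \<G> \<T>"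
    and "finite_type \<kappa> \<G> \<T>"
    and "\<forall>i. \<forall>X\<in>S i.
      finite {j. j < i \<and>
        ((\<exists>Y\<in>torsion_free_quotients \<G> \<T> (S j). \<exists>f\<in>Hom \<G> X Y. \<not> zero_arrow \<G> f) \<or>
         (\<exists>T\<in>torsion_images \<G> \<T> X. \<exists>Y\<in>torsion_free_quotients \<G> \<T> (S j).
            \<exists>\<xi>\<in>Ext1 \<G> T Y. \<xi> \<noteq> Ext1_zero \<G> T Y))}"
    and "\<forall>i j. j < i \<longrightarrow> (\<forall>X\<in>S i.
      \<exists>s p. is_trace \<G> (\<Union>k\<in>{..j}. S k) X s \<and> is_cokernel \<G> s p \<and> Cod \<G> p \<in> \<T>)"
  shows "locally_finitely_presented \<kappa> (gabriel_quotient \<G> \<T>) \<and>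
    \<not> (\<exists>F. flat \<kappa> (gabriel_quotient \<G> \<T>) F \<and> \<not> zero_object (gabriel_quotient \<G> \<T>) F)"
proof -
  note directed = assms(3) and no_min = assms(4) and lfp = assms(5) and finite_bad = assms(13) and traces = assms(14)
  have "abelian \<G>" using lfp unfolding locally_finitely_presented_def grothendieck_def by blast
  then obtain add where abelian_cat: "abelian_cat \<G> add" using abelian_cat_ex by blast
  then interpret torsion_cat \<G> add \<kappa> \<T>
    unfolding torsion_cat_def torsion_cat_axioms_def using assms(1,11) by blast
  obtain \<iota> where adj: "right_adjoint \<G> D (quotient_functor \<G> \<T>) \<iota>"
    and pres: "preserves_direct_limits \<kappa> D \<G> \<iota>"
    using assms(12) unfolding finite_type_def by blast
  obtain \<Phi> where section_functor: "is_functor D \<G> \<iota>"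
    and bij: "\<forall>A\<in>Obj \<G>. \<forall>B\<in>Obj D. bij_betw (\<Phi> A B) (Hom D (FObj (quotient_functor \<G> \<T>) A) B) (Hom \<G> A (FObj \<iota> B))"
    and nat: "\<forall>a\<in>Arr \<G>. \<forall>b\<in>Arr D. \<forall>f\<in>Hom D (FObj (quotient_functor \<G> \<T>) (Cod \<G> a)) (Dom D b).
           \<Phi> (Dom \<G> a) (Cod D b) (b \<cdot>\<^bsub>D\<^esub> f \<cdot>\<^bsub>D\<^esub> FArr (quotient_functor \<G> \<T>) a) =
           FArr \<iota> b \<cdot>\<^bsub>\<G>\<^esub> \<Phi> (Cod \<G> a) (Dom D b) f \<cdot>\<^bsub>\<G>\<^esub> a"
    using adj unfolding right_adjoint_def by blast
  interpret torsion_section \<G> add \<kappa> \<T> \<iota> \<Phi>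
    by unfold_locales (use section_functor bij nat in \<open>simp_all del: Hom_iff\<close>)
  have lfpD: "locally_finitely_presented \<kappa> D"
    by (rule locally_finitely_presented_D[OF lfp pres])
  then have grD: "locally_small \<kappa> D" "has_coproducts \<kappa> D"
    unfolding locally_finitely_presented_def grothendieck_def by blast+
  have SO: "\<S> \<subseteq> Obj \<G>" using assms(8) by (simp add: generates_def)
  have "zero_object D F" if F: "flat \<kappa> D F" for F
  proof -
    have FO: "F \<in> Obj D" using F by (simp add: flat_def)
    have zero: "u = D.nul X F" if X: "X \<in> \<S>" and u: "u \<in> Arr D" "Dom D u = X" "Cod D u = F" for X u
    proof -
      obtain i where i: "X \<in> S i" using X assms(9) by blast
      define B where "B = {j. j < i \<and>
        ((\<exists>Y\<in>torsion_free_quotients \<G> \<T> (S j). \<exists>f\<in>Hom \<G> X Y. \<not> zero_arrow \<G> f) \<or>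
         (\<exists>T\<in>torsion_images \<G> \<T> X. \<exists>Y\<in>torsion_free_quotients \<G> \<T> (S j).
            \<exists>\<xi>\<in>Ext1 \<G> T Y. \<xi> \<noteq> Ext1_zero \<G> T Y))}"
      \<comment> \<open>Avoiding \<open>i\<close> as well makes the index \<open>j\<close> below strictly smaller than \<open>i\<close>.\<close>
      have "finite (insert i B)" using finite_bad i unfolding B_def by simp
      then obtain j0 where j0: "\<forall>b\<in>insert i B. \<not> b \<le> j0"
        using directed_below_avoids[OF directed no_min] by blast
      obtain j where j: "j \<le> i" "j \<le> j0" using directed by blast
      have good: "k < i" "k \<notin> B" if k: "k \<le> j" for k
      proof -
        have "k \<le> j0" using k j(2) by (rule order_trans)
        then have "\<not> b \<le> k" if "b \<in> insert i B" for b using j0 that order_trans by blast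
        then show "k < i" "k \<notin> B"
          using order_trans[OF k j(1)] by (auto simp: less_le_not_le)
      qed
      define XX where "XX = (\<Union>k\<in>{..j}. S k)"
      have XXS: "XX \<subseteq> \<S>" unfolding XX_def assms(9) by blast
      have gen: "generates D XX"
      proof (rule generates_of_trace[OF assms(8)])
        show "XX \<subseteq> Obj \<G>" using XXS SO by blast
        fix X' assume "X' \<in> \<S>"
        then obtain i' where i': "X' \<in> S i'" using assms(9) by blast
        \<comment> \<open>The traces with torsion quotient belong to indices strictly below \<open>i'\<close>; those below \<open>j\<close> come from \<open>XX\<close>.\<close>
        obtain l where l: "\<not> i' \<le> l" using no_min by blast
        obtain k0 where k0: "k0 \<le> l" "k0 \<le> i'" using directed by blast
        obtain k where k: "k \<le> k0" "k \<le> j" using directed by blast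
        have "k \<le> i'" "k \<le> l" using order_trans[OF k(1)] k0 by blast+
        then have "k < i'" using l order_trans unfolding less_le_not_le by blast
        then obtain s p where "is_trace \<G> (\<Union>k\<in>{..k}. S k) X' s" "is_cokernel \<G> s p" "Cod \<G> p \<in> \<T>"
          using traces i' by blast
        moreover have "(\<Union>k\<in>{..k}. S k) \<subseteq> XX" unfolding XX_def using k(2) order_trans by fastforce
        ultimately show "\<exists>XX' s p. XX' \<subseteq> XX \<and> is_trace \<G> XX' X' s \<and> is_cokernel \<G> s p \<and> Cod \<G> p \<in> \<T>"
          by blast
      qed
      show ?thesis
      proof (rule D.hom_flat_zero[OF assms(1) grD _ gen _ _ F u])
        show "small \<kappa> XX" by (rule small_subset[OF assms(6) XXS])
        show "finitely_presented \<kappa> D X" using assms(7) X fp_q[OF _ pres] by blast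
        fix A v assume A: "A \<in> XX" and v: "v \<in> Arr D" "Dom D v = X" "Cod D v = A"
        then obtain k where k: "k \<le> j" "A \<in> S k" unfolding XX_def by blast
        have sub: "torsion_free_quotients \<G> \<T> {A} \<subseteq> torsion_free_quotients \<G> \<T> (S k)"
          unfolding torsion_free_quotients_def using k(2) by blast
        show "v = D.nul X A"
        proof (rule hom_D_zero[OF _ v])
          show "A \<in> Obj \<G>" using A XXS SO by blast
          show "zero_arrow \<G> f" if "Y \<in> torsion_free_quotients \<G> \<T> {A}" "f \<in> Hom \<G> X Y" for Y f
            using good[OF k(1)] that sub unfolding B_def by blast
          show "\<exists>s. s \<in> Hom \<G> T' (Cod \<G> f) \<and> g \<cdot>\<^bsub>\<G>\<^esub> s = Ident \<G> T'"
            if "Y \<in> torsion_free_quotients \<G> \<T> {A}" "T' \<in> torsion_images \<G> \<T> X" "(f, g) \<in> extensions \<G> T' Y"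
            for Y T' f g
          proof (rule split_extension[OF that(3)])
            show "\<forall>\<xi>\<in>Ext1 \<G> T' Y. \<xi> = Ext1_zero \<G> T' Y"
              using good[OF k(1)] that(1,2) sub unfolding B_def by blast
          qed
        qed
      qed
    qed
    have "Ident D F = D.nul F F"
    proof (rule ccontr)
      assume "Ident D F \<noteq> D.nul F F"
      moreover have "Ident D F \<in> Arr D" "D.nul F F \<in> Hom D (Dom D (Ident D F)) (Cod D (Ident D F))"
        using FO by auto
      ultimately obtain X h where X: "X \<in> \<S>" "h \<in> Hom D X (Dom D (Ident D F))"
        "Ident D F \<cdot>\<^bsub>D\<^esub> h \<noteq> D.nul F F \<cdot>\<^bsub>D\<^esub> h"
        using generates_q[OF assms(8)] unfolding generates_def by blast
      then have h: "h \<in> Arr D" "Dom D h = X" "Cod D h = F" using FO by auto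
      then have "D.nul F F \<cdot>\<^bsub>D\<^esub> h = D.nul X F" "Ident D F \<cdot>\<^bsub>D\<^esub> h = h" using FO by auto
      then show False using X(3) zero[OF X(1) h] by simp
    qed
    then show ?thesis using D.zero_objectI FO by blast
  qed
  then show ?thesis using lfpD by blast
qed

end
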